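(* Let $\mathcal K$ be an equipment that has opcartesian tabulations. Let $j\colon A\to B$, $d\colon A\to M$ and $r\colon B\to M$ be vertical morphisms, let $\varepsilon\colon r\circ j\Rightarrow d$ be a vertical cell, and let $\varepsilon'\colon j^*\Rightarrow 1_M$ be the unique cell, with vertical source $r$ and vertical target $d$, such that $\varepsilon=\varepsilon'\circ\eta_j$, where $\eta_j\colon 1_A\Rightarrow j^*$ is the opcartesian cell defining the conjoint $j^*\colon B\nrightarrow A$ of $j$. Then $\varepsilon$ defines $r$ as the pointwise right Kan extension of $d$ along $j$ in the $2$-category $V(\mathcal K)$, in the sense of Street, if and only if $\varepsilon'$ defines $r$ as the pointwise right Kan extension of $d$ along $j^*$ in the double category $\mathcal K$.
   Context: **Double categories.** Double categories are weak (pseudo) double categories. A double category $\mathcal K$ has objects; vertical morphisms $f\colon A\to C$, forming a category; horizontal morphisms $J\colon A\nrightarrow B$; and square cells. A cell $\phi\colon J\Rightarrow K$, where $J\colon A\nrightarrow B$ and $K\colon C\nrightarrow D$, has a vertical source $f\colon A\to C$ and a vertical target $g\colon B\to D$. Cells compose vertically, written $\psi\circ\phi$ (first $\phi$, then $\psi$), strictly associatively and with identities $\mathrm{id}_J$. Horizontal composition is written in diagrammatic order: $J\colon A\nrightarrow B$ and $H\colon B\nrightarrow E$ compose to $J\odot H\colon A\nrightarrow E$, and cells $\phi\colon J\Rightarrow K$, $\chi\colon H\Rightarrow L$ such that the vertical target of $\phi$ equals the vertical source of $\chi$ compose to $\phi\odot\chi\colon J\odot H\Rightarrow K\odot L$;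 this is functorial (interchange law). There are horizontal units $1_A\colon A\nrightarrow A$ and unit cells $1_f\colon 1_A\Rightarrow 1_C$ with vertical source and target $f$. Horizontal composition is associative and unital up to coherent invertible cells with identity vertical source and target; these are suppressed from the notation. A vertical cell $\phi\colon f\Rightarrow g$, for $f,g\colon A\to C$, is a cell $1_A\Rightarrow 1_C$ with vertical source $f$ and vertical target $g$. **The 2-category $V(\mathcal K)$** consists of the objects, vertical morphisms and vertical cells of $\mathcal K$; the vertical composite in $V(\mathcal K)$ of $\phi\colon f\Rightarrow g$ and $\psi\colon g\Rightarrow h$ is $\phi\odot\psi$, while the horizontal composite in $V(\mathcal K)$ of $\phi\colon f\Rightarrow g$ and $\chi\colon k\Rightarrow l$ is $\chi\circ\phi$. **Companions, conjoints, equipments.** A companion of $f\colon A\to C$ is a horizontal morphism $f_*\colon A\nrightarrow C$ with cells ${}_f\varepsilon\colon f_*\Rightarrow 1_C$ (vertical source $f$, vertical target $\mathrm{id}_C$) and ${}_f\eta\colon 1_A\Rightarrow f_*$ (vertical source $\mathrm{id}_A$, vertical target $f$) such that ${}_f\varepsilon\circ{}_f\eta=1_f$ and ${}_f\eta\odot{}_f\varepsilon=\mathrm{id}_{f_*}$. A conjoint of $f$ is a horizontal morphism $f^*\colon C\nrightarrow A$ with cells $\varepsilon_f\colon f^*\Rightarrow 1_C$ (vertical source $\mathrm{id}_C$, vertical target $f$) and $\eta_f\colon 1_A\Rightarrow f^*$ (vertical source $f$, vertical target $\mathrm{id}_A$) such that $\varepsilon_f\circ\eta_f=1_f$ and $\varepsilon_f\odot\eta_f=\mathrm{id}_{f^*}$.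 An equipment is a double category with a specified companion and a specified conjoint for each vertical morphism. **Opcartesian cells.** A cell $\phi\colon J\Rightarrow K$ with vertical source $f$ and vertical target $g$ is opcartesian if every cell $\chi\colon J\Rightarrow L$ with vertical source $h\circ f$ and vertical target $k\circ g$ factors as $\chi=\chi'\circ\phi$ for a unique cell $\chi'\colon K\Rightarrow L$ with vertical source $h$ and vertical target $k$. Conjoint cells $\eta_f$ are opcartesian. **Pointwise right Kan extensions in $\mathcal K$.** Let $\varepsilon\colon J\Rightarrow 1_M$ be a cell with $J\colon A\nrightarrow B$, vertical source $r\colon A\to M$ and vertical target $d\colon B\to M$. It defines $r$ as the pointwise right Kan extension of $d$ along $J$ if for all $H\colon C\nrightarrow A$ and $s\colon C\to M$, every cell $\phi\colon H\odot J\Rightarrow 1_M$ with vertical source $s$ and vertical target $d$ factors as $\phi=\phi'\odot\varepsilon$ for a unique cell $\phi'\colon H\Rightarrow 1_M$ with vertical source $s$ and vertical target $r$. **Tabulations.** A tabulation of $J\colon A\nrightarrow B$ is an object $\langle J\rangle$ with a cell $\pi\colon 1_{\langle J\rangle}\Rightarrow J$, with vertical source $\pi_A\colon\langle J\rangle\to A$ and vertical target $\pi_B\colon\langle J\rangle\to B$, such that: (1-dimensional property) for every cell $\phi\colon 1_X\Rightarrow J$, with vertical source $\phi_A$ and vertical target $\phi_B$, there is a unique vertical morphism $\phi'\colon X\to\langle J\rangle$ with $\pi\circ 1_{\phi'}=\phi$ (in particular $\pi_A\circ\phi'=\phi_A$ and $\pi_B\circ\phi'=\phi_B$); (2-dimensional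 property) given cells $\phi\colon 1_X\Rightarrow J$ and $\psi\colon 1_Y\Rightarrow J$, factoring as $\phi'\colon X\to\langle J\rangle$ and $\psi'\colon Y\to\langle J\rangle$, a horizontal morphism $H\colon X\nrightarrow Y$ and cells $\xi_A\colon H\Rightarrow 1_A$ (vertical source $\phi_A$, vertical target $\psi_A$) and $\xi_B\colon H\Rightarrow 1_B$ (vertical source $\phi_B$, vertical target $\psi_B$) with $\xi_A\odot\psi=\phi\odot\xi_B$, there is a unique cell $\xi'\colon H\Rightarrow 1_{\langle J\rangle}$ with vertical source $\phi'$ and vertical target $\psi'$ such that $1_{\pi_A}\circ\xi'=\xi_A$ and $1_{\pi_B}\circ\xi'=\xi_B$. The tabulation is opcartesian if $\pi$ is opcartesian. $\mathcal K$ has opcartesian tabulations if every horizontal morphism of $\mathcal K$ has an opcartesian tabulation. **Comma objects.** In a 2-category, the comma object $f/g$ of $f\colon A\to C$ and $g\colon B\to C$ is an object $f/g$ with projections $\pi_A\colon f/g\to A$, $\pi_B\colon f/g\to B$ and a 2-cell $\pi\colon f\circ\pi_A\Rightarrow g\circ\pi_B$ such that: for every 2-cell $\phi\colon f\circ\phi_A\Rightarrow g\circ\phi_B$ with $\phi_A\colon X\to A$, $\phi_B\colon X\to B$ there is a unique $\phi'\colon X\to f/g$ with $\pi_A\circ\phi'=\phi_A$, $\pi_B\circ\phi'=\phi_B$ and $\pi\circ\phi'=\phi$; and, given another such $\psi\colon f\circ\psi_A\Rightarrow g\circ\psi_B$ on $X$, with factorisation $\psi'$, and 2-cells $\xi_A\colon\phi_A\Rightarrow\psi_A$,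 $\xi_B\colon\phi_B\Rightarrow\psi_B$ such that the composites $f\phi_A\xrightarrow{f\xi_A}f\psi_A\xrightarrow{\psi}g\psi_B$ and $f\phi_A\xrightarrow{\phi}g\phi_B\xrightarrow{g\xi_B}g\psi_B$ agree, there is a unique 2-cell $\xi'\colon\phi'\Rightarrow\psi'$ with $\pi_A\circ\xi'=\xi_A$ and $\pi_B\circ\xi'=\xi_B$. **Street's pointwise right Kan extensions.** In a 2-category, a 2-cell $\varepsilon\colon r\circ j\Rightarrow d$ (with $j\colon A\to B$, $d\colon A\to M$, $r\colon B\to M$) defines $r$ as the right Kan extension of $d$ along $j$ if every 2-cell $\psi\colon s\circ j\Rightarrow d$, with $s\colon B\to M$, equals the composite $s j\xrightarrow{\psi' j}r j\xrightarrow{\varepsilon}d$ for a unique 2-cell $\psi'\colon s\Rightarrow r$. In a 2-category with all comma objects, $\varepsilon$ defines $r$ as the pointwise right Kan extension of $d$ along $j$ (Street) if for each $f\colon C\to B$, with comma object $f/j$, projections $\pi_C\colon f/j\to C$, $\pi_A\colon f/j\to A$ and 2-cell $\pi\colon f\circ\pi_C\Rightarrow j\circ\pi_A$, the composite $r f\pi_C\xrightarrow{r\pi}r j\pi_A\xrightarrow{\varepsilon\pi_A}d\pi_A$ defines $r\circ f$ as the right Kan extension of $d\circ\pi_A$ along $\pi_C$. (For $\mathcal K$ an equipment with opcartesian tabulations, $V(\mathcal K)$ has all comma objects.) *)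

theory Defs
  imports Main
begin

section \<open>Double categories\<close>

text \<open>
  A cell with horizontal source \<open>J\<close> and horizontal target \<open>L\<close>, vertical source \<open>f\<close> and
  vertical target \<open>g\<close> is a square with \<open>J\<close> on top, \<open>L\<close> at the bottom, \<open>f\<close> on the left and
  \<open>g\<close> on the right.  Vertical compositions \<open>g \<bullet> f\<close> and \<open>\<psi> \<cdot> \<phi>\<close> are written in the usual
  (applicative) order, horizontal compositions \<open>J \<odot> H\<close> and \<open>\<phi> \<Odot> \<chi>\<close> in diagrammatic order.
\<close>

record ('o, 'v, 'h, 'c) dblcat =
  Obj :: "'o set"
  Ver :: "'v set"
  Hor :: "'h set"
  Cell :: "'c set"
  vdom :: "'v \<Rightarrow> 'o"
  vcod :: "'v \<Rightarrow> 'o"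
  vid :: "'o \<Rightarrow> 'v"
  vcomp :: "'v \<Rightarrow> 'v \<Rightarrow> 'v"  (infixr "\<bullet>\<index>" 75)
  hdom :: "'h \<Rightarrow> 'o"
  hcod :: "'h \<Rightarrow> 'o"
  hsrc :: "'c \<Rightarrow> 'h"
  htgt :: "'c \<Rightarrow> 'h"
  vsrc :: "'c \<Rightarrow> 'v"
  vtgt :: "'c \<Rightarrow> 'v"
  cid :: "'h \<Rightarrow> 'c"
  ccomp :: "'c \<Rightarrow> 'c \<Rightarrow> 'c"  (infixr "\<cdot>\<index>" 65)
  hunit :: "'o \<Rightarrow> 'h"
  cunit :: "'v \<Rightarrow> 'c"
  hcomp :: "'h \<Rightarrow> 'h \<Rightarrow> 'h"  (infixl "\<odot>\<index>" 75)
  chcomp :: "'c \<Rightarrow> 'c \<Rightarrow> 'c"  (infixl "\<Odot>\<index>" 70)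
  asc :: "'h \<Rightarrow> 'h \<Rightarrow> 'h \<Rightarrow> 'c"
  lunit :: "'h \<Rightarrow> 'c"
  runit :: "'h \<Rightarrow> 'c"

definition is_ver :: "('o, 'v, 'h, 'c, 'm) dblcat_scheme \<Rightarrow> 'v \<Rightarrow> 'o \<Rightarrow> 'o \<Rightarrow> bool" where
  "is_ver K f A C \<longleftrightarrow> f \<in> Ver K \<and> vdom K f = A \<and> vcod K f = C"

definition is_hor :: "('o, 'v, 'h, 'c, 'm) dblcat_scheme \<Rightarrow> 'h \<Rightarrow> 'o \<Rightarrow> 'o \<Rightarrow> bool" where
  "is_hor K J A B \<longleftrightarrow> J \<in> Hor K \<and> hdom K J = A \<and> hcod K J = B"

definition is_cell ::
  "('o, 'v, 'h, 'c, 'm) dblcat_scheme \<Rightarrow> 'c \<Rightarrow> 'h \<Rightarrow> 'h \<Rightarrow> 'v \<Rightarrow> 'v \<Rightarrow> bool" where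
  "is_cell K \<phi> J L f g \<longleftrightarrow>
     \<phi> \<in> Cell K \<and> hsrc K \<phi> = J \<and> htgt K \<phi> = L \<and> vsrc K \<phi> = f \<and> vtgt K \<phi> = g"

definition is_inverse_cell :: "('o, 'v, 'h, 'c, 'm) dblcat_scheme \<Rightarrow> 'c \<Rightarrow> 'c \<Rightarrow> bool" where
  "is_inverse_cell K \<phi> \<psi> \<longleftrightarrow>
     \<psi> \<in> Cell K \<and> hsrc K \<psi> = htgt K \<phi> \<and> htgt K \<psi> = hsrc K \<phi> \<and>
     \<psi> \<cdot>\<^bsub>K\<^esub> \<phi> = cid K (hsrc K \<phi>) \<and> \<phi> \<cdot>\<^bsub>K\<^esub> \<psi> = cid K (htgt K \<phi>)"

definition inv_cell :: "('o, 'v, 'h, 'c, 'm) dblcat_scheme \<Rightarrow> 'c \<Rightarrow> 'c" where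
  "inv_cell K \<phi> = (THE \<psi>. is_inverse_cell K \<phi> \<psi>)"

text \<open>Invertible cells whose vertical source and target are identities.\<close>

definition is_coherence ::
  "('o, 'v, 'h, 'c, 'm) dblcat_scheme \<Rightarrow> 'c \<Rightarrow> 'h \<Rightarrow> 'h \<Rightarrow> bool" where
  "is_coherence K \<phi> J L \<longleftrightarrow>
     is_cell K \<phi> J L (vid K (hdom K J)) (vid K (hcod K J)) \<and>
     (\<exists>\<psi>. is_cell K \<psi> L J (vid K (hdom K J)) (vid K (hcod K J)) \<and> is_inverse_cell K \<phi> \<psi>)"

locale double_category =
  fixes K :: "('o, 'v, 'h, 'c, 'm) dblcat_scheme" (structure)
  assumes ver_obj: "f \<in> Ver K \<Longrightarrow> vdom K f \<in> Obj K \<and> vcod K f \<in> Obj K"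
    and vid: "A \<in> Obj K \<Longrightarrow> is_ver K (vid K A) A A"
    and vcomp: "\<lbrakk>is_ver K f A C; is_ver K g C E\<rbrakk> \<Longrightarrow> is_ver K (g \<bullet> f) A E"
    and vcomp_id: "is_ver K f A C \<Longrightarrow> f \<bullet> vid K A = f \<and> vid K C \<bullet> f = f"
    and vcomp_assoc: "\<lbrakk>is_ver K f A C; is_ver K g C E; is_ver K h E B\<rbrakk>
      \<Longrightarrow> (h \<bullet> g) \<bullet> f = h \<bullet> (g \<bullet> f)"
    and hor_obj: "J \<in> Hor K \<Longrightarrow> hdom K J \<in> Obj K \<and> hcod K J \<in> Obj K"
    and cell_hor: "\<phi> \<in> Cell K \<Longrightarrow> hsrc K \<phi> \<in> Hor K \<and> htgt K \<phi> \<in> Hor K"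
    and cell_vsrc: "\<phi> \<in> Cell K
      \<Longrightarrow> is_ver K (vsrc K \<phi>) (hdom K (hsrc K \<phi>)) (hdom K (htgt K \<phi>))"
    and cell_vtgt: "\<phi> \<in> Cell K
      \<Longrightarrow> is_ver K (vtgt K \<phi>) (hcod K (hsrc K \<phi>)) (hcod K (htgt K \<phi>))"
    and cid: "is_hor K J A B \<Longrightarrow> is_cell K (cid K J) J J (vid K A) (vid K B)"
    and ccomp: "\<lbrakk>is_cell K \<phi> J L f g; is_cell K \<psi> L N h k\<rbrakk>
      \<Longrightarrow> is_cell K (\<psi> \<cdot> \<phi>) J N (h \<bullet> f) (k \<bullet> g)"
    and ccomp_id: "is_cell K \<phi> J L f g \<Longrightarrow> \<phi> \<cdot> cid K J = \<phi> \<and> cid K L \<cdot> \<phi> = \<phi>"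
    and ccomp_assoc: "\<lbrakk>is_cell K \<phi> J L f g; is_cell K \<psi> L N h k; is_cell K \<omega> N P p q\<rbrakk>
      \<Longrightarrow> (\<omega> \<cdot> \<psi>) \<cdot> \<phi> = \<omega> \<cdot> (\<psi> \<cdot> \<phi>)"
    and hunit: "A \<in> Obj K \<Longrightarrow> is_hor K (hunit K A) A A"
    and cunit: "is_ver K f A C \<Longrightarrow> is_cell K (cunit K f) (hunit K A) (hunit K C) f f"
    and cunit_vid: "A \<in> Obj K \<Longrightarrow> cunit K (vid K A) = cid K (hunit K A)"
    and cunit_vcomp: "\<lbrakk>is_ver K f A C; is_ver K g C E\<rbrakk>
      \<Longrightarrow> cunit K (g \<bullet> f) = cunit K g \<cdot> cunit K f"
    and hcomp: "\<lbrakk>is_hor K J A B; is_hor K H B E\<rbrakk> \<Longrightarrow> is_hor K (J \<odot> H) A E"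
    and chcomp: "\<lbrakk>is_cell K \<phi> J L f g; is_cell K \<chi> H N g k\<rbrakk>
      \<Longrightarrow> is_cell K (\<phi> \<Odot> \<chi>) (J \<odot> H) (L \<odot> N) f k"
    and chcomp_cid: "\<lbrakk>is_hor K J A B; is_hor K H B E\<rbrakk>
      \<Longrightarrow> cid K J \<Odot> cid K H = cid K (J \<odot> H)"
    and interchange:
      "\<lbrakk>is_cell K \<phi> J L f g; is_cell K \<chi> H N g k; is_cell K \<psi> L P p q; is_cell K \<omega> N Q q s\<rbrakk>
      \<Longrightarrow> (\<psi> \<cdot> \<phi>) \<Odot> (\<omega> \<cdot> \<chi>) = (\<psi> \<Odot> \<omega>) \<cdot> (\<phi> \<Odot> \<chi>)"
    and asc: "\<lbrakk>is_hor K J A B; is_hor K H B C; is_hor K G C D\<rbrakk>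
      \<Longrightarrow> is_coherence K (asc K J H G) ((J \<odot> H) \<odot> G) (J \<odot> (H \<odot> G))"
    and lunit: "is_hor K J A B \<Longrightarrow> is_coherence K (lunit K J) (hunit K A \<odot> J) J"
    and runit: "is_hor K J A B \<Longrightarrow> is_coherence K (runit K J) (J \<odot> hunit K B) J"
    and asc_natural:
      "\<lbrakk>is_cell K \<phi> J J' f g; is_cell K \<chi> H H' g h; is_cell K \<omega> G G' h k\<rbrakk>
      \<Longrightarrow> asc K J' H' G' \<cdot> ((\<phi> \<Odot> \<chi>) \<Odot> \<omega>) = (\<phi> \<Odot> (\<chi> \<Odot> \<omega>)) \<cdot> asc K J H G"
    and lunit_natural: "is_cell K \<phi> J L f g
      \<Longrightarrow> lunit K L \<cdot> (cunit K f \<Odot> \<phi>) = \<phi> \<cdot> lunit K J"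
    and runit_natural: "is_cell K \<phi> J L f g
      \<Longrightarrow> runit K L \<cdot> (\<phi> \<Odot> cunit K g) = \<phi> \<cdot> runit K J"
    and pentagon: "\<lbrakk>is_hor K J A B; is_hor K H B C; is_hor K G C D; is_hor K F D E\<rbrakk>
      \<Longrightarrow> asc K J H (G \<odot> F) \<cdot> asc K (J \<odot> H) G F
        = (cid K J \<Odot> asc K H G F) \<cdot> asc K J (H \<odot> G) F \<cdot> (asc K J H G \<Odot> cid K F)"
    and triangle: "\<lbrakk>is_hor K J A B; is_hor K H B C\<rbrakk>
      \<Longrightarrow> (cid K J \<Odot> lunit K H) \<cdot> asc K J (hunit K B) H = runit K J \<Odot> cid K H"

definition is_opcartesian :: "('o, 'v, 'h, 'c, 'm) dblcat_scheme \<Rightarrow> 'c \<Rightarrow> bool" where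
  "is_opcartesian K \<phi> \<longleftrightarrow> \<phi> \<in> Cell K \<and>
     (\<forall>\<chi> L h k.
        h \<in> Ver K \<and> vdom K h = vcod K (vsrc K \<phi>) \<and>
        k \<in> Ver K \<and> vdom K k = vcod K (vtgt K \<phi>) \<and>
        is_cell K \<chi> (hsrc K \<phi>) L (h \<bullet>\<^bsub>K\<^esub> vsrc K \<phi>) (k \<bullet>\<^bsub>K\<^esub> vtgt K \<phi>)
        \<longrightarrow> (\<exists>!\<chi>'. is_cell K \<chi>' (htgt K \<phi>) L h k \<and> \<chi> = \<chi>' \<cdot>\<^bsub>K\<^esub> \<phi>))"

section \<open>Companions, conjoints and equipments\<close>

text \<open>
  The second triangle identities read \<open>\<eta> \<Odot> \<epsilon> = id\<close> and \<open>\<epsilon> \<Odot> \<eta> = id\<close> when the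
  unitors are suppressed.
\<close>

definition is_companion ::
  "('o, 'v, 'h, 'c, 'm) dblcat_scheme \<Rightarrow> 'v \<Rightarrow> 'h \<Rightarrow> 'c \<Rightarrow> 'c \<Rightarrow> bool" where
  "is_companion K f F \<epsilon> \<eta> \<longleftrightarrow> f \<in> Ver K \<and>
     is_hor K F (vdom K f) (vcod K f) \<and>
     is_cell K \<epsilon> F (hunit K (vcod K f)) f (vid K (vcod K f)) \<and>
     is_cell K \<eta> (hunit K (vdom K f)) F (vid K (vdom K f)) f \<and>
     \<epsilon> \<cdot>\<^bsub>K\<^esub> \<eta> = cunit K f \<and>
     runit K F \<cdot>\<^bsub>K\<^esub> (\<eta> \<Odot>\<^bsub>K\<^esub> \<epsilon>) \<cdot>\<^bsub>K\<^esub> inv_cell K (lunit K F) = cid K F"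

definition is_conjoint ::
  "('o, 'v, 'h, 'c, 'm) dblcat_scheme \<Rightarrow> 'v \<Rightarrow> 'h \<Rightarrow> 'c \<Rightarrow> 'c \<Rightarrow> bool" where
  "is_conjoint K f F \<epsilon> \<eta> \<longleftrightarrow> f \<in> Ver K \<and>
     is_hor K F (vcod K f) (vdom K f) \<and>
     is_cell K \<epsilon> F (hunit K (vcod K f)) (vid K (vcod K f)) f \<and>
     is_cell K \<eta> (hunit K (vdom K f)) F f (vid K (vdom K f)) \<and>
     \<epsilon> \<cdot>\<^bsub>K\<^esub> \<eta> = cunit K f \<and>
     lunit K F \<cdot>\<^bsub>K\<^esub> (\<epsilon> \<Odot>\<^bsub>K\<^esub> \<eta>) \<cdot>\<^bsub>K\<^esub> inv_cell K (runit K F) = cid K F"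

record ('o, 'v, 'h, 'c) equip = "('o, 'v, 'h, 'c) dblcat" +
  companion :: "'v \<Rightarrow> 'h"
  companion_eps :: "'v \<Rightarrow> 'c"
  companion_eta :: "'v \<Rightarrow> 'c"
  conjoint :: "'v \<Rightarrow> 'h"
  conjoint_eps :: "'v \<Rightarrow> 'c"
  conjoint_eta :: "'v \<Rightarrow> 'c"

locale equipment = double_category K
  for K :: "('o, 'v, 'h, 'c, 'm) equip_scheme" (structure) +
  assumes companion: "f \<in> Ver K
      \<Longrightarrow> is_companion K f (companion K f) (companion_eps K f) (companion_eta K f)"
    and conjoint: "f \<in> Ver K
      \<Longrightarrow> is_conjoint K f (conjoint K f) (conjoint_eps K f) (conjoint_eta K f)"

section \<open>Pointwise right Kan extensions in a double category\<close>

text \<open>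
  \<open>defines_pointwise_ran K J d r \<epsilon>\<close>: the cell \<open>\<epsilon>\<close> defines \<open>r\<close> as the pointwise right Kan
  extension of \<open>d\<close> along \<open>J\<close>.  The unitor at \<open>hunit K M\<close> identifies \<open>1 \<odot> 1\<close> with \<open>1\<close>.
\<close>

definition defines_pointwise_ran ::
  "('o, 'v, 'h, 'c, 'm) dblcat_scheme \<Rightarrow> 'h \<Rightarrow> 'v \<Rightarrow> 'v \<Rightarrow> 'c \<Rightarrow> bool" where
  "defines_pointwise_ran K J d r \<epsilon> \<longleftrightarrow>
     (\<exists>A B M. is_hor K J A B \<and> is_ver K r A M \<and> is_ver K d B M \<and>
       is_cell K \<epsilon> J (hunit K M) r d \<and>
       (\<forall>C H s \<phi>.
          is_hor K H C A \<and> is_ver K s C M \<and> is_cell K \<phi> (H \<odot>\<^bsub>K\<^esub> J) (hunit K M) s d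
          \<longrightarrow> (\<exists>!\<phi>'. is_cell K \<phi>' H (hunit K M) s r \<and>
                 \<phi> = lunit K (hunit K M) \<cdot>\<^bsub>K\<^esub> (\<phi>' \<Odot>\<^bsub>K\<^esub> \<epsilon>))))"

section \<open>Tabulations\<close>

definition tab_factor ::
  "('o, 'v, 'h, 'c, 'm) dblcat_scheme \<Rightarrow> 'o \<Rightarrow> 'c \<Rightarrow> 'o \<Rightarrow> 'c \<Rightarrow> 'v \<Rightarrow> bool" where
  "tab_factor K T \<pi> X \<phi> \<phi>' \<longleftrightarrow> is_ver K \<phi>' X T \<and> \<pi> \<cdot>\<^bsub>K\<^esub> cunit K \<phi>' = \<phi>"

definition is_tabulation ::
  "('o, 'v, 'h, 'c, 'm) dblcat_scheme \<Rightarrow> 'h \<Rightarrow> 'o \<Rightarrow> 'c \<Rightarrow> bool" where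
  "is_tabulation K J T \<pi> \<longleftrightarrow> J \<in> Hor K \<and> T \<in> Obj K \<and>
     \<pi> \<in> Cell K \<and> hsrc K \<pi> = hunit K T \<and> htgt K \<pi> = J \<and>
     (\<forall>X \<phi>. X \<in> Obj K \<and> \<phi> \<in> Cell K \<and> hsrc K \<phi> = hunit K X \<and> htgt K \<phi> = J
        \<longrightarrow> (\<exists>!\<phi>'. tab_factor K T \<pi> X \<phi> \<phi>')) \<and>
     (\<forall>X Y \<phi> \<psi> \<phi>' \<psi>' H \<xi>\<^sub>A \<xi>\<^sub>B.
        X \<in> Obj K \<and> \<phi> \<in> Cell K \<and> hsrc K \<phi> = hunit K X \<and> htgt K \<phi> = J \<and>
        Y \<in> Obj K \<and> \<psi> \<in> Cell K \<and> hsrc K \<psi> = hunit K Y \<and> htgt K \<psi> = J \<and>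
        tab_factor K T \<pi> X \<phi> \<phi>' \<and> tab_factor K T \<pi> Y \<psi> \<psi>' \<and>
        is_hor K H X Y \<and>
        is_cell K \<xi>\<^sub>A H (hunit K (hdom K J)) (vsrc K \<phi>) (vsrc K \<psi>) \<and>
        is_cell K \<xi>\<^sub>B H (hunit K (hcod K J)) (vtgt K \<phi>) (vtgt K \<psi>) \<and>
        lunit K J \<cdot>\<^bsub>K\<^esub> (\<xi>\<^sub>A \<Odot>\<^bsub>K\<^esub> \<psi>) \<cdot>\<^bsub>K\<^esub> inv_cell K (runit K H)
          = runit K J \<cdot>\<^bsub>K\<^esub> (\<phi> \<Odot>\<^bsub>K\<^esub> \<xi>\<^sub>B) \<cdot>\<^bsub>K\<^esub> inv_cell K (lunit K H)
        \<longrightarrow> (\<exists>!\<xi>'. is_cell K \<xi>' H (hunit K T) \<phi>' \<psi>' \<and>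
               cunit K (vsrc K \<pi>) \<cdot>\<^bsub>K\<^esub> \<xi>' = \<xi>\<^sub>A \<and> cunit K (vtgt K \<pi>) \<cdot>\<^bsub>K\<^esub> \<xi>' = \<xi>\<^sub>B))"

definition has_opcartesian_tabulations :: "('o, 'v, 'h, 'c, 'm) dblcat_scheme \<Rightarrow> bool" where
  "has_opcartesian_tabulations K \<longleftrightarrow>
     (\<forall>J \<in> Hor K. \<exists>T \<pi>. is_tabulation K J T \<pi> \<and> is_opcartesian K \<pi>)"

section \<open>Comma objects and Kan extensions in a 2-category\<close>

text \<open>
  Horizontal composition \<open>\<chi> \<star> \<phi>\<close> of 2-cells is written in the same order as composition
  \<open>g \<bullet> f\<close> of morphisms; vertical composition \<open>\<phi> \<Zcomp> \<psi>\<close> is written in diagrammatic order.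
\<close>

record ('o, 'a, 'c) twocat =
  Ob :: "'o set"
  Arr :: "'a set"
  Cell2 :: "'c set"
  dom1 :: "'a \<Rightarrow> 'o"
  cod1 :: "'a \<Rightarrow> 'o"
  id1 :: "'o \<Rightarrow> 'a"
  comp1 :: "'a \<Rightarrow> 'a \<Rightarrow> 'a"  (infixr "\<diamondop>\<index>" 75)
  src2 :: "'c \<Rightarrow> 'a"
  tgt2 :: "'c \<Rightarrow> 'a"
  id2 :: "'a \<Rightarrow> 'c"
  vcomp2 :: "'c \<Rightarrow> 'c \<Rightarrow> 'c"  (infixl "\<Zcomp>\<index>" 65)
  hcomp2 :: "'c \<Rightarrow> 'c \<Rightarrow> 'c"  (infixr "\<star>\<index>" 70)

definition is_arr :: "('o, 'a, 'c, 'm) twocat_scheme \<Rightarrow> 'a \<Rightarrow> 'o \<Rightarrow> 'o \<Rightarrow> bool" where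
  "is_arr T f A C \<longleftrightarrow> f \<in> Arr T \<and> dom1 T f = A \<and> cod1 T f = C"

definition is_cell2 :: "('o, 'a, 'c, 'm) twocat_scheme \<Rightarrow> 'c \<Rightarrow> 'a \<Rightarrow> 'a \<Rightarrow> bool" where
  "is_cell2 T \<phi> f g \<longleftrightarrow> \<phi> \<in> Cell2 T \<and> src2 T \<phi> = f \<and> tgt2 T \<phi> = g"

text \<open>Whiskering a 2-cell with a morphism is horizontal composition with an identity 2-cell.\<close>

definition whisker_left :: "('o, 'a, 'c, 'm) twocat_scheme \<Rightarrow> 'a \<Rightarrow> 'c \<Rightarrow> 'c"  (infixr "\<rhd>\<index>" 72) where
  "g \<rhd>\<^bsub>T\<^esub> \<phi> = id2 T g \<star>\<^bsub>T\<^esub> \<phi>"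

definition whisker_right :: "('o, 'a, 'c, 'm) twocat_scheme \<Rightarrow> 'c \<Rightarrow> 'a \<Rightarrow> 'c"  (infixl "\<lhd>\<index>" 72) where
  "\<phi> \<lhd>\<^bsub>T\<^esub> f = \<phi> \<star>\<^bsub>T\<^esub> id2 T f"

locale two_category =
  fixes T :: "('o, 'a, 'c, 'm) twocat_scheme" (structure)
  assumes arr_ob: "f \<in> Arr T \<Longrightarrow> dom1 T f \<in> Ob T \<and> cod1 T f \<in> Ob T"
    and id1: "A \<in> Ob T \<Longrightarrow> is_arr T (id1 T A) A A"
    and comp1: "\<lbrakk>is_arr T f A C; is_arr T g C E\<rbrakk> \<Longrightarrow> is_arr T (g \<diamondop> f) A E"
    and comp1_id: "is_arr T f A C \<Longrightarrow> f \<diamondop> id1 T A = f \<and> id1 T C \<diamondop> f = f"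
    and comp1_assoc: "\<lbrakk>is_arr T f A C; is_arr T g C E; is_arr T h E B\<rbrakk>
      \<Longrightarrow> (h \<diamondop> g) \<diamondop> f = h \<diamondop> (g \<diamondop> f)"
    and cell2_arr: "is_cell2 T \<phi> f g \<Longrightarrow> f \<in> Arr T \<and> g \<in> Arr T \<and>
      dom1 T f = dom1 T g \<and> cod1 T f = cod1 T g"
    and id2: "f \<in> Arr T \<Longrightarrow> is_cell2 T (id2 T f) f f"
    and vcomp2: "\<lbrakk>is_cell2 T \<phi> f g; is_cell2 T \<psi> g h\<rbrakk> \<Longrightarrow> is_cell2 T (\<phi> \<Zcomp> \<psi>) f h"
    and vcomp2_id: "is_cell2 T \<phi> f g \<Longrightarrow> id2 T f \<Zcomp> \<phi> = \<phi> \<and> \<phi> \<Zcomp> id2 T g = \<phi>"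
    and vcomp2_assoc: "\<lbrakk>is_cell2 T \<phi> f g; is_cell2 T \<psi> g h; is_cell2 T \<chi> h k\<rbrakk>
      \<Longrightarrow> (\<phi> \<Zcomp> \<psi>) \<Zcomp> \<chi> = \<phi> \<Zcomp> (\<psi> \<Zcomp> \<chi>)"
    and hcomp2: "\<lbrakk>is_cell2 T \<phi> f g; is_cell2 T \<chi> k l; cod1 T f = dom1 T k\<rbrakk>
      \<Longrightarrow> is_cell2 T (\<chi> \<star> \<phi>) (k \<diamondop> f) (l \<diamondop> g)"
    and hcomp2_id: "is_cell2 T \<phi> f g
      \<Longrightarrow> \<phi> \<star> id2 T (id1 T (dom1 T f)) = \<phi> \<and> id2 T (id1 T (cod1 T f)) \<star> \<phi> = \<phi>"
    and hcomp2_assoc: "\<lbrakk>is_cell2 T \<phi> f f'; is_cell2 T \<chi> g g'; is_cell2 T \<omega> h h';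
        cod1 T f = dom1 T g; cod1 T g = dom1 T h\<rbrakk>
      \<Longrightarrow> (\<omega> \<star> \<chi>) \<star> \<phi> = \<omega> \<star> (\<chi> \<star> \<phi>)"
    and hcomp2_id2: "\<lbrakk>is_arr T f A C; is_arr T g C E\<rbrakk>
      \<Longrightarrow> id2 T g \<star> id2 T f = id2 T (g \<diamondop> f)"
    and interchange2: "\<lbrakk>is_cell2 T \<phi> f g; is_cell2 T \<psi> g h; is_cell2 T \<phi>' f' g'; is_cell2 T \<psi>' g' h';
        cod1 T f = dom1 T f'\<rbrakk>
      \<Longrightarrow> (\<phi>' \<Zcomp> \<psi>') \<star> (\<phi> \<Zcomp> \<psi>) = (\<phi>' \<star> \<phi>) \<Zcomp> (\<psi>' \<star> \<psi>)"

text \<open>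
  For \<open>f: A \<rightarrow> C\<close> and \<open>g: B \<rightarrow> C\<close>, \<open>comma_factor\<close> says that \<open>\<phi>'\<close> is a factorisation of
  \<open>(\<phi>\<^sub>A, \<phi>\<^sub>B, \<phi>)\<close> through \<open>(\<pi>\<^sub>A, \<pi>\<^sub>B, \<pi>)\<close>.
\<close>

definition comma_cone ::
  "('o, 'a, 'c, 'm) twocat_scheme \<Rightarrow> 'a \<Rightarrow> 'a \<Rightarrow> 'o \<Rightarrow> 'a \<Rightarrow> 'a \<Rightarrow> 'c \<Rightarrow> bool" where
  "comma_cone T f g X \<phi>\<^sub>A \<phi>\<^sub>B \<phi> \<longleftrightarrow> X \<in> Ob T \<and>
     is_arr T \<phi>\<^sub>A X (dom1 T f) \<and> is_arr T \<phi>\<^sub>B X (dom1 T g) \<and>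
     is_cell2 T \<phi> (f \<diamondop>\<^bsub>T\<^esub> \<phi>\<^sub>A) (g \<diamondop>\<^bsub>T\<^esub> \<phi>\<^sub>B)"

definition comma_factor ::
  "('o, 'a, 'c, 'm) twocat_scheme \<Rightarrow> 'o \<Rightarrow> 'a \<Rightarrow> 'a \<Rightarrow> 'c \<Rightarrow> 'o \<Rightarrow> 'a \<Rightarrow> 'a \<Rightarrow> 'c \<Rightarrow> 'a \<Rightarrow> bool" where
  "comma_factor T P \<pi>\<^sub>A \<pi>\<^sub>B \<pi> X \<phi>\<^sub>A \<phi>\<^sub>B \<phi> \<phi>' \<longleftrightarrow> is_arr T \<phi>' X P \<and>
     \<pi>\<^sub>A \<diamondop>\<^bsub>T\<^esub> \<phi>' = \<phi>\<^sub>A \<and> \<pi>\<^sub>B \<diamondop>\<^bsub>T\<^esub> \<phi>' = \<phi>\<^sub>B \<and> \<pi> \<lhd>\<^bsub>T\<^esub> \<phi>' = \<phi>"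

definition is_comma_object ::
  "('o, 'a, 'c, 'm) twocat_scheme \<Rightarrow> 'a \<Rightarrow> 'a \<Rightarrow> 'o \<Rightarrow> 'a \<Rightarrow> 'a \<Rightarrow> 'c \<Rightarrow> bool" where
  "is_comma_object T f g P \<pi>\<^sub>A \<pi>\<^sub>B \<pi> \<longleftrightarrow>
     f \<in> Arr T \<and> g \<in> Arr T \<and> cod1 T f = cod1 T g \<and> comma_cone T f g P \<pi>\<^sub>A \<pi>\<^sub>B \<pi> \<and>
     (\<forall>X \<phi>\<^sub>A \<phi>\<^sub>B \<phi>. comma_cone T f g X \<phi>\<^sub>A \<phi>\<^sub>B \<phi>
        \<longrightarrow> (\<exists>!\<phi>'. comma_factor T P \<pi>\<^sub>A \<pi>\<^sub>B \<pi> X \<phi>\<^sub>A \<phi>\<^sub>B \<phi> \<phi>')) \<and>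
     (\<forall>X \<phi>\<^sub>A \<phi>\<^sub>B \<phi> \<psi>\<^sub>A \<psi>\<^sub>B \<psi> \<phi>' \<psi>' \<xi>\<^sub>A \<xi>\<^sub>B.
        comma_cone T f g X \<phi>\<^sub>A \<phi>\<^sub>B \<phi> \<and> comma_cone T f g X \<psi>\<^sub>A \<psi>\<^sub>B \<psi> \<and>
        comma_factor T P \<pi>\<^sub>A \<pi>\<^sub>B \<pi> X \<phi>\<^sub>A \<phi>\<^sub>B \<phi> \<phi>' \<and>
        comma_factor T P \<pi>\<^sub>A \<pi>\<^sub>B \<pi> X \<psi>\<^sub>A \<psi>\<^sub>B \<psi> \<psi>' \<and>
        is_cell2 T \<xi>\<^sub>A \<phi>\<^sub>A \<psi>\<^sub>A \<and> is_cell2 T \<xi>\<^sub>B \<phi>\<^sub>B \<psi>\<^sub>B \<and>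
        (f \<rhd>\<^bsub>T\<^esub> \<xi>\<^sub>A) \<Zcomp>\<^bsub>T\<^esub> \<psi> = \<phi> \<Zcomp>\<^bsub>T\<^esub> (g \<rhd>\<^bsub>T\<^esub> \<xi>\<^sub>B)
        \<longrightarrow> (\<exists>!\<xi>'. is_cell2 T \<xi>' \<phi>' \<psi>' \<and> \<pi>\<^sub>A \<rhd>\<^bsub>T\<^esub> \<xi>' = \<xi>\<^sub>A \<and> \<pi>\<^sub>B \<rhd>\<^bsub>T\<^esub> \<xi>' = \<xi>\<^sub>B))"

definition defines_ran ::
  "('o, 'a, 'c, 'm) twocat_scheme \<Rightarrow> 'a \<Rightarrow> 'a \<Rightarrow> 'a \<Rightarrow> 'c \<Rightarrow> bool" where
  "defines_ran T j d r \<epsilon> \<longleftrightarrow>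
     (\<exists>A B M. is_arr T j A B \<and> is_arr T d A M \<and> is_arr T r B M \<and>
       is_cell2 T \<epsilon> (r \<diamondop>\<^bsub>T\<^esub> j) d \<and>
       (\<forall>s \<psi>. is_arr T s B M \<and> is_cell2 T \<psi> (s \<diamondop>\<^bsub>T\<^esub> j) d
          \<longrightarrow> (\<exists>!\<psi>'. is_cell2 T \<psi>' s r \<and> \<psi> = (\<psi>' \<lhd>\<^bsub>T\<^esub> j) \<Zcomp>\<^bsub>T\<^esub> \<epsilon>)))"

text \<open>
  Street's notion presupposes that \<open>T\<close> has all comma objects.  Since the condition does not
  depend on the choice of the comma object \<open>f/j\<close>, it is stated for all of them.
\<close>

definition defines_pointwise_ran_street ::
  "('o, 'a, 'c, 'm) twocat_scheme \<Rightarrow> 'a \<Rightarrow> 'a \<Rightarrow> 'a \<Rightarrow> 'c \<Rightarrow> bool" where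
  "defines_pointwise_ran_street T j d r \<epsilon> \<longleftrightarrow>
     (\<exists>A B M. is_arr T j A B \<and> is_arr T d A M \<and> is_arr T r B M \<and>
       is_cell2 T \<epsilon> (r \<diamondop>\<^bsub>T\<^esub> j) d \<and>
       (\<forall>C f P \<pi>\<^sub>C \<pi>\<^sub>A \<pi>.
          is_arr T f C B \<and> is_comma_object T f j P \<pi>\<^sub>C \<pi>\<^sub>A \<pi>
          \<longrightarrow> defines_ran T \<pi>\<^sub>C (d \<diamondop>\<^bsub>T\<^esub> \<pi>\<^sub>A) (r \<diamondop>\<^bsub>T\<^esub> f)
                ((r \<rhd>\<^bsub>T\<^esub> \<pi>) \<Zcomp>\<^bsub>T\<^esub> (\<epsilon> \<lhd>\<^bsub>T\<^esub> \<pi>\<^sub>A))))"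

section \<open>The vertical 2-category of a double category\<close>

definition is_vcell :: "('o, 'v, 'h, 'c, 'm) dblcat_scheme \<Rightarrow> 'c \<Rightarrow> 'v \<Rightarrow> 'v \<Rightarrow> bool" where
  "is_vcell K \<phi> f g \<longleftrightarrow>
     (\<exists>A C. is_ver K f A C \<and> is_ver K g A C \<and>
        is_cell K \<phi> (hunit K A) (hunit K C) f g)"

text \<open>
  The unitors in the vertical composite identify \<open>1 \<odot> 1\<close> with \<open>1\<close>; the left and right unitors
  agree at a horizontal unit.
\<close>

definition vertical_2cat ::
  "('o, 'v, 'h, 'c, 'm) dblcat_scheme \<Rightarrow> ('o, 'v, 'c) twocat"  ("\<V>") where
  "\<V> K = \<lparr>
     Ob = Obj K,
     Arr = Ver K,
     Cell2 = {\<phi>. \<exists>f g. is_vcell K \<phi> f g},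
     dom1 = vdom K,
     cod1 = vcod K,
     id1 = vid K,
     comp1 = vcomp K,
     src2 = vsrc K,
     tgt2 = vtgt K,
     id2 = cunit K,
     vcomp2 = (\<lambda>\<phi> \<psi>. lunit K (hunit K (vcod K (vsrc K \<phi>))) \<cdot>\<^bsub>K\<^esub> (\<phi> \<Odot>\<^bsub>K\<^esub> \<psi>)
                \<cdot>\<^bsub>K\<^esub> inv_cell K (lunit K (hunit K (vdom K (vsrc K \<phi>))))),
     hcomp2 = (\<lambda>\<chi> \<phi>. \<chi> \<cdot>\<^bsub>K\<^esub> \<phi>)
   \<rparr>"

subsection \<open>The 2-category axioms\<close>

context double_category
begin

text \<open>Globular cells, i.e. cells whose vertical source and target are identities.\<close>

definition "gl \<phi> J L A B \<longleftrightarrow> is_hor K J A B \<and> is_hor K L A B \<and> is_cell K \<phi> J L (vid K A) (vid K B)"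

lemma hor_Obj: "is_hor K J A B \<Longrightarrow> A \<in> Obj K \<and> B \<in> Obj K"
  using hor_obj unfolding is_hor_def by auto

lemma ver_Obj: "is_ver K J A B \<Longrightarrow> A \<in> Obj K \<and> B \<in> Obj K"
  using ver_obj unfolding is_ver_def by auto

lemma vid_vid: "A \<in> Obj K \<Longrightarrow> vid K A \<bullet> vid K A = vid K A"
  using vid vcomp_id by blast

lemma gl_comp: "gl \<phi> J L A B \<Longrightarrow> gl \<psi> L N A B \<Longrightarrow> gl (\<psi> \<cdot> \<phi>) J N A B"
  using ccomp[of \<phi> J L "vid K A" "vid K B" \<psi> N "vid K A" "vid K B"] hor_Obj[of J A B] vid_vid unfolding gl_def by auto

lemma gl_id: "is_hor K J A B \<Longrightarrow> gl (cid K J) J J A B"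
  unfolding gl_def using cid by auto

lemma gl_h: "gl \<phi> J L A B \<Longrightarrow> gl \<psi> H N B E \<Longrightarrow> gl (\<phi> \<Odot> \<psi>) (J \<odot> H) (L \<odot> N) A E"
  unfolding gl_def using chcomp hcomp by blast

lemma gl_assoc: "gl \<phi> J L A B \<Longrightarrow> gl \<psi> L N A B \<Longrightarrow> gl \<omega> N P A B \<Longrightarrow> (\<omega> \<cdot> \<psi>) \<cdot> \<phi> = \<omega> \<cdot> (\<psi> \<cdot> \<phi>)"
  unfolding gl_def using ccomp_assoc by blast

lemma gl_idl: "gl \<phi> J L A B \<Longrightarrow> cid K L \<cdot> \<phi> = \<phi>" and gl_idr: "gl \<phi> J L A B \<Longrightarrow> \<phi> \<cdot> cid K J = \<phi>"
  unfolding gl_def using ccomp_id by blast+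

lemma gl_ic: "gl \<phi> J L A B \<Longrightarrow> gl \<chi> H N B E \<Longrightarrow> gl \<psi> L P A B \<Longrightarrow> gl \<omega> N Q B E
   \<Longrightarrow> (\<psi> \<cdot> \<phi>) \<Odot> (\<omega> \<cdot> \<chi>) = (\<psi> \<Odot> \<omega>) \<cdot> (\<phi> \<Odot> \<chi>)"
  unfolding gl_def using interchange by blast

text \<open>Globular cells with a given inverse.\<close>

definition "gi \<phi> \<psi> J L A B \<longleftrightarrow> gl \<phi> J L A B \<and> gl \<psi> L J A B \<and> \<psi> \<cdot> \<phi> = cid K J \<and> \<phi> \<cdot> \<psi> = cid K L"

lemma coh_gi: assumes "is_coherence K \<phi> J L" "is_hor K J A B" "is_hor K L A B" shows "\<exists>\<psi>. gi \<phi> \<psi> J L A B"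
proof -
  have d: "hdom K J = A" "hcod K J = B" using assms(2) unfolding is_hor_def by auto
  obtain \<psi> where p: "is_cell K \<phi> J L (vid K A) (vid K B)" "is_cell K \<psi> L J (vid K A) (vid K B)" "is_inverse_cell K \<phi> \<psi>"
    using assms(1) unfolding is_coherence_def d by blast
  have "hsrc K \<phi> = J" "htgt K \<phi> = L" using p(1) unfolding is_cell_def by auto
  then show ?thesis using p assms(2,3) unfolding gi_def gl_def is_inverse_cell_def by auto
qed

lemma gi_inv: assumes "gi \<phi> \<psi> J L A B" shows "inv_cell K \<phi> = \<psi>"
  unfolding inv_cell_def
proof (rule the_equality)
  have a: "gl \<phi> J L A B" "gl \<psi> L J A B" "\<psi> \<cdot> \<phi> = cid K J" "\<phi> \<cdot> \<psi> = cid K L" using assms(1) unfolding gi_def by auto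
  have c: "is_cell K \<phi> J L (vid K A) (vid K B)" "is_cell K \<psi> L J (vid K A) (vid K B)" using a unfolding gl_def by auto
  have d: "hsrc K \<phi> = J" "htgt K \<phi> = L" using c unfolding is_cell_def by auto
  show "is_inverse_cell K \<phi> \<psi>" unfolding is_inverse_cell_def d using a(3,4) c(2) unfolding is_cell_def by auto
  fix \<omega> assume w: "is_inverse_cell K \<phi> \<omega>"
  have t: "is_cell K \<omega> L J (vsrc K \<omega>) (vtgt K \<omega>)" and e: "\<omega> \<cdot> \<phi> = cid K J" 
    using w unfolding is_inverse_cell_def d unfolding is_cell_def by auto
  have "\<omega> = \<omega> \<cdot> (\<phi> \<cdot> \<psi>)" using ccomp_id[OF t] a(4) by simp
  also have "\<dots> = (\<omega> \<cdot> \<phi>) \<cdot> \<psi>" using ccomp_assoc[OF c(2) c(1) t] by simp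
  also have "\<dots> = \<psi>" using e gl_idl[OF a(2)] by simp
  finally show "\<omega> = \<psi>" .
qed

lemma gl_cancel_l: assumes "gi \<omega> \<omega>' L N A B" "gl \<phi> J L A B" "gl \<psi> J L A B" "\<omega> \<cdot> \<phi> = \<omega> \<cdot> \<psi>" shows "\<phi> = \<psi>"
proof -
  have a: "gl \<omega> L N A B" "gl \<omega>' N L A B" "\<omega>' \<cdot> \<omega> = cid K L" using assms(1) unfolding gi_def by auto
  have "\<phi> = (\<omega>' \<cdot> \<omega>) \<cdot> \<phi>" by (simp only: a(3) gl_idl[OF assms(2)])
  also have "\<dots> = (\<omega>' \<cdot> \<omega>) \<cdot> \<psi>" by (simp only: gl_assoc[OF assms(2) a(1,2)] gl_assoc[OF assms(3) a(1,2)] assms(4))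
  also have "\<dots> = \<psi>" by (simp only: a(3) gl_idl[OF assms(3)])
  finally show ?thesis .
qed

lemma gl_cancel_r: assumes "gi \<omega> \<omega>' J L A B" "gl \<phi> L N A B" "gl \<psi> L N A B" "\<phi> \<cdot> \<omega> = \<psi> \<cdot> \<omega>" shows "\<phi> = \<psi>"
proof -
  have a: "gl \<omega> J L A B" "gl \<omega>' L J A B" "\<omega> \<cdot> \<omega>' = cid K L" using assms(1) unfolding gi_def by auto
  have "\<phi> = \<phi> \<cdot> (\<omega> \<cdot> \<omega>')" by (simp only: a(3) gl_idr[OF assms(2)])
  also have "\<dots> = \<psi> \<cdot> (\<omega> \<cdot> \<omega>')" by (simp only: gl_assoc[OF a(2,1) assms(2), symmetric] gl_assoc[OF a(2,1) assms(3), symmetric] assms(4))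
  also have "\<dots> = \<psi>" by (simp only: a(3) gl_idr[OF assms(3)])
  finally show ?thesis .
qed

lemma gi_lunit: "is_hor K J A B \<Longrightarrow> \<exists>\<psi>. gi (lunit K J) \<psi> (hunit K A \<odot> J) J A B"
  using coh_gi[OF lunit] hunit hcomp hor_Obj by meson

lemma gi_runit: "is_hor K J A B \<Longrightarrow> \<exists>\<psi>. gi (runit K J) \<psi> (J \<odot> hunit K B) J A B"
  using coh_gi[OF runit] hunit hcomp hor_Obj by meson

lemma gi_asc: "is_hor K J A B \<Longrightarrow> is_hor K H B C \<Longrightarrow> is_hor K G C D \<Longrightarrow>
   \<exists>\<psi>. gi (asc K J H G) \<psi> ((J \<odot> H) \<odot> G) (J \<odot> (H \<odot> G)) A D"
  by (rule coh_gi[OF asc]) (assumption | rule hcomp)+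

lemma gll: "is_hor K J A B \<Longrightarrow> gl (lunit K J) (hunit K A \<odot> J) J A B"
  using gi_lunit unfolding gi_def by blast

lemma glr: "is_hor K J A B \<Longrightarrow> gl (runit K J) (J \<odot> hunit K B) J A B"
  using gi_runit unfolding gi_def by blast

lemma gla: "is_hor K J A B \<Longrightarrow> is_hor K H B C \<Longrightarrow> is_hor K G C D \<Longrightarrow>
   gl (asc K J H G) ((J \<odot> H) \<odot> G) (J \<odot> (H \<odot> G)) A D"
  using gi_asc[of J A B H C G D] unfolding gi_def by blast

lemma l_nat: "gl \<phi> J L A B \<Longrightarrow> lunit K L \<cdot> (cid K (hunit K A) \<Odot> \<phi>) = \<phi> \<cdot> lunit K J"
  using lunit_natural[of \<phi> J L "vid K A" "vid K B"] cunit_vid hor_Obj[of J A B] unfolding gl_def by auto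

lemma r_nat: "gl \<phi> J L A B \<Longrightarrow> runit K L \<cdot> (\<phi> \<Odot> cid K (hunit K B)) = \<phi> \<cdot> runit K J"
  using runit_natural[of \<phi> J L "vid K A" "vid K B"] cunit_vid hor_Obj[of J A B] unfolding gl_def by auto

lemma a_nat: "gl \<phi> J J' A B \<Longrightarrow> gl \<chi> H H' B C \<Longrightarrow> gl \<omega> G G' C D \<Longrightarrow>
  asc K J' H' G' \<cdot> ((\<phi> \<Odot> \<chi>) \<Odot> \<omega>) = (\<phi> \<Odot> (\<chi> \<Odot> \<omega>)) \<cdot> asc K J H G"
  unfolding gl_def using asc_natural by blast

lemma faith_l: assumes "gl \<phi> J L A B" "gl \<psi> J L A B" "cid K (hunit K A) \<Odot> \<phi> = cid K (hunit K A) \<Odot> \<psi>"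
  shows "\<phi> = \<psi>"
proof -
  have J: "is_hor K J A B" using assms unfolding gl_def by blast
  obtain i where "gi (lunit K J) i (hunit K A \<odot> J) J A B" using gi_lunit[OF J] by blast
  from gl_cancel_r[OF this assms(1,2)] show ?thesis using l_nat[OF assms(1)] l_nat[OF assms(2)] assms(3) by simp
qed

lemma faith_r: assumes "gl \<phi> J L A B" "gl \<psi> J L A B" "\<phi> \<Odot> cid K (hunit K B) = \<psi> \<Odot> cid K (hunit K B)"
  shows "\<phi> = \<psi>"
proof -
  have J: "is_hor K J A B" using assms unfolding gl_def by blast
  obtain i where "gi (runit K J) i (J \<odot> hunit K B) J A B" using gi_runit[OF J] by blast
  from gl_cancel_r[OF this assms(1,2)] show ?thesis using r_nat[OF assms(1)] r_nat[OF assms(2)] assms(3) by simp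
qed

lemma l_unit_tensor: assumes J: "is_hor K J A B"
  shows "lunit K (hunit K A \<odot> J) = cid K (hunit K A) \<Odot> lunit K J"
proof -
  let ?u = "hunit K A"
  have u: "is_hor K ?u A A" using J hunit hor_Obj by blast
  obtain i where i: "gi (lunit K J) i (?u \<odot> J) J A B" using gi_lunit[OF J] by blast
  show ?thesis
    by (rule gl_cancel_l[OF i gll[OF hcomp[OF u J]] gl_h[OF gl_id[OF u] gll[OF J]]])
      (simp add: l_nat[OF gll[OF J]])
qed

lemma gi_hid: assumes "gi \<phi> \<psi> J L A B" "is_hor K H B E" 
  shows "gi (\<phi> \<Odot> cid K H) (\<psi> \<Odot> cid K H) (J \<odot> H) (L \<odot> H) A E"
proof -
  note i = gl_id[OF assms(2)]
  have h: "is_hor K J A B" "is_hor K L A B" using assms gi_def unfolding gl_def by auto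
  have a: "gl \<phi> J L A B" "gl \<psi> L J A B" "\<psi> \<cdot> \<phi> = cid K J" "\<phi> \<cdot> \<psi> = cid K L" using assms(1) unfolding gi_def by auto
  show ?thesis unfolding gi_def
    using gl_h[OF a(1) i] gl_h[OF a(2) i] gl_ic[OF a(1) i a(2) i] gl_ic[OF a(2) i a(1) i]
      a(3,4) gl_idl[OF i] chcomp_cid[OF h(1) assms(2)] chcomp_cid[OF h(2) assms(2)] by simp
qed

lemma l_tensor: assumes J: "is_hor K J A B" and H: "is_hor K H B C"
  shows "lunit K (J \<odot> H) \<cdot> asc K (hunit K A) J H = lunit K J \<Odot> cid K H"
proof -
  let ?u = "hunit K A" let ?i = "cid K ?u"
  have u: "is_hor K ?u A A" using J hunit hor_Obj by blast
  note iu = gl_id[OF u] and iH = gl_id[OF H] and iJ = gl_id[OF J]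
  note a1 = gla[OF u J H] and a2 = gla[OF u hcomp[OF u J] H] and a3 = gla[OF u u J]
   and a4 = gla[OF u u hcomp[OF J H]] and a5 = gla[OF hcomp[OF u u] J H]
  note lJ = gll[OF J] and lJH = gll[OF hcomp[OF J H]] and r1 = glr[OF u]
  have A: "(?i \<Odot> (lunit K (J \<odot> H) \<cdot> asc K ?u J H)) \<cdot> asc K ?u (?u \<odot> J) H \<cdot> (asc K ?u ?u J \<Odot> cid K H)
     = (?i \<Odot> lunit K (J \<odot> H)) \<cdot> (?i \<Odot> asc K ?u J H) \<cdot> asc K ?u (?u \<odot> J) H \<cdot> (asc K ?u ?u J \<Odot> cid K H)"
    using gl_ic[OF iu a1 iu lJH] gl_idl[OF iu] 
      gl_assoc[OF gl_comp[OF gl_h[OF a3 iH] a2] gl_h[OF iu a1] gl_h[OF iu lJH]] by simp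
  also have "\<dots> = (?i \<Odot> lunit K (J \<odot> H)) \<cdot> asc K ?u ?u (J \<odot> H) \<cdot> asc K (?u \<odot> ?u) J H"
    using pentagon[OF u u J H] by simp
  also have "\<dots> = (runit K ?u \<Odot> cid K (J \<odot> H)) \<cdot> asc K (?u \<odot> ?u) J H"
    using gl_assoc[OF a5 a4 gl_h[OF iu lJH]] triangle[OF u hcomp[OF J H]] by simp
  also have "\<dots> = asc K ?u J H \<cdot> ((runit K ?u \<Odot> cid K J) \<Odot> cid K H)"
    using a_nat[OF r1 iJ iH] chcomp_cid[OF J H] by simp
  also have "\<dots> = asc K ?u J H \<cdot> (((?i \<Odot> lunit K J) \<cdot> asc K ?u ?u J) \<Odot> cid K H)"
    using triangle[OF u J] by simp
  also have "\<dots> = asc K ?u J H \<cdot> (((?i \<Odot> lunit K J) \<Odot> cid K H) \<cdot> (asc K ?u ?u J \<Odot> cid K H))"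
    using gl_ic[OF a3 iH gl_h[OF iu lJ] iH] gl_idl[OF iH] by simp
  also have "\<dots> = (asc K ?u J H \<cdot> ((?i \<Odot> lunit K J) \<Odot> cid K H)) \<cdot> (asc K ?u ?u J \<Odot> cid K H)"
    using gl_assoc[OF gl_h[OF a3 iH] gl_h[OF gl_h[OF iu lJ] iH] a1] by simp
  also have "\<dots> = ((?i \<Odot> (lunit K J \<Odot> cid K H)) \<cdot> asc K ?u (?u \<odot> J) H) \<cdot> (asc K ?u ?u J \<Odot> cid K H)"
    using a_nat[OF iu lJ iH] by simp
  also have "\<dots> = (?i \<Odot> (lunit K J \<Odot> cid K H)) \<cdot> asc K ?u (?u \<odot> J) H \<cdot> (asc K ?u ?u J \<Odot> cid K H)"
    using gl_assoc[OF gl_h[OF a3 iH] a2 gl_h[OF iu gl_h[OF lJ iH]]] by simp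
  finally have B: "(?i \<Odot> (lunit K (J \<odot> H) \<cdot> asc K ?u J H)) \<cdot> (asc K ?u (?u \<odot> J) H \<cdot> (asc K ?u ?u J \<Odot> cid K H))
    = (?i \<Odot> (lunit K J \<Odot> cid K H)) \<cdot> (asc K ?u (?u \<odot> J) H \<cdot> (asc K ?u ?u J \<Odot> cid K H))" .
  note X = gl_comp[OF a1 lJH] and Y = gl_h[OF lJ iH]
  note XX = gl_h[OF iu X] and YY = gl_h[OF iu Y]
  obtain p where p: "gi (asc K ?u (?u \<odot> J) H) p ((?u \<odot> (?u \<odot> J)) \<odot> H) (?u \<odot> ((?u \<odot> J) \<odot> H)) A C"
    using gi_asc[OF u hcomp[OF u J] H] by blast
  obtain q where q: "gi (asc K ?u ?u J) q ((?u \<odot> ?u) \<odot> J) (?u \<odot> (?u \<odot> J)) A B"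
    using gi_asc[OF u u J] by blast
  have B': "((?i \<Odot> (lunit K (J \<odot> H) \<cdot> asc K ?u J H)) \<cdot> asc K ?u (?u \<odot> J) H) \<cdot> (asc K ?u ?u J \<Odot> cid K H)
    = ((?i \<Odot> (lunit K J \<Odot> cid K H)) \<cdot> asc K ?u (?u \<odot> J) H) \<cdot> (asc K ?u ?u J \<Odot> cid K H)"
    using B gl_assoc[OF gl_h[OF a3 iH] a2 XX] gl_assoc[OF gl_h[OF a3 iH] a2 YY] by simp
  have B'': "(?i \<Odot> (lunit K (J \<odot> H) \<cdot> asc K ?u J H)) \<cdot> asc K ?u (?u \<odot> J) H
    = (?i \<Odot> (lunit K J \<Odot> cid K H)) \<cdot> asc K ?u (?u \<odot> J) H"
    by (rule gl_cancel_r[OF gi_hid[OF q H] gl_comp[OF a2 XX] gl_comp[OF a2 YY] B'])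
  have "?i \<Odot> (lunit K (J \<odot> H) \<cdot> asc K ?u J H) = ?i \<Odot> (lunit K J \<Odot> cid K H)"
    by (rule gl_cancel_r[OF p XX YY B''])
  then show ?thesis using faith_l[OF X Y] by simp
qed

lemma lunit_eq_runit: assumes "A \<in> Obj K" shows "lunit K (hunit K A) = runit K (hunit K A)"
proof -
  let ?u = "hunit K A"
  have u: "is_hor K ?u A A" using assms hunit by blast
  have "lunit K ?u \<Odot> cid K ?u = runit K ?u \<Odot> cid K ?u"
    using l_tensor[OF u u] l_unit_tensor[OF u] triangle[OF u u] by simp
  then show ?thesis using faith_r[OF gll[OF u] glr[OF u]] by simp
qed

abbreviation "lam A \<equiv> lunit K (hunit K A)"

abbreviation "lam_inv A \<equiv> inv_cell K (lam A)"

lemma gi_l: assumes "A \<in> Obj K" shows "gi (lam A) (lam_inv A) (hunit K A \<odot> hunit K A) (hunit K A) A A"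
  using gi_lunit[OF hunit[OF assms]] gi_inv by blast

text \<open>\<open>is_vcell\<close> with explicit source and target objects, and the vertical composition of \<open>\<V> K\<close>.\<close>

definition "vc \<phi> f g A C \<longleftrightarrow> is_ver K f A C \<and> is_ver K g A C \<and>
        is_cell K \<phi> (hunit K A) (hunit K C) f g"

lemma vc_Obj: "vc \<phi> f g A C \<Longrightarrow> A \<in> Obj K \<and> C \<in> Obj K"
  unfolding vc_def using ver_Obj by blast

lemma vid_sides: "is_ver K f A C \<Longrightarrow> f \<bullet> vid K A = f" "is_ver K f A C \<Longrightarrow> vid K C \<bullet> f = f"
  using vcomp_id by auto

lemma glcell: "gl \<phi> J L A B \<Longrightarrow> is_cell K \<phi> J L (vid K A) (vid K B)" unfolding gl_def by blast

lemma c_gl: "is_cell K \<phi> J L f g \<Longrightarrow> gl \<psi> L N C D \<Longrightarrow> is_ver K f A C \<Longrightarrow> is_ver K g B D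
   \<Longrightarrow> is_cell K (\<psi> \<cdot> \<phi>) J N f g"
  using ccomp[of \<phi> J L f g \<psi> N "vid K C" "vid K D"] vid_sides glcell[of \<psi> L N C D] by simp

lemma gl_c: "is_cell K \<phi> J L f g \<Longrightarrow> gl \<psi> N J A B \<Longrightarrow> is_ver K f A C \<Longrightarrow> is_ver K g B D
   \<Longrightarrow> is_cell K (\<phi> \<cdot> \<psi>) N L f g"
  using ccomp[of \<psi> N J "vid K A" "vid K B" \<phi> L f g] vid_sides glcell[of \<psi> N J A B] by simp

definition "vv \<phi> \<psi> A C = lam C \<cdot> (\<phi> \<Odot> \<psi>) \<cdot> lam_inv A"

lemma gl_l: "A \<in> Obj K \<Longrightarrow> gl (lam A) (hunit K A \<odot> hunit K A) (hunit K A) A A"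
  and gl_li: "A \<in> Obj K \<Longrightarrow> gl (lam_inv A) (hunit K A) (hunit K A \<odot> hunit K A) A A"
  and li_l: "A \<in> Obj K \<Longrightarrow> lam_inv A \<cdot> lam A = cid K (hunit K A \<odot> hunit K A)"
  and l_li: "A \<in> Obj K \<Longrightarrow> lam A \<cdot> lam_inv A = cid K (hunit K A)"
  using gi_l unfolding gi_def by blast+

lemma vc_inner: assumes "vc \<phi> f g A C" "vc \<psi> g h A C"
  shows "is_cell K ((\<phi> \<Odot> \<psi>) \<cdot> lam_inv A) (hunit K A) (hunit K C \<odot> hunit K C) f h"
  proof -
  have o: "A \<in> Obj K" "C \<in> Obj K" using vc_Obj[OF assms(1)] by auto
  have c: "is_cell K \<phi> (hunit K A) (hunit K C) f g" "is_cell K \<psi> (hunit K A) (hunit K C) g h"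
    "is_ver K f A C" "is_ver K h A C" using assms unfolding vc_def by auto
  show ?thesis by (rule gl_c[OF chcomp[OF c(1,2)] gl_li[OF o(1)] c(3,4)])
qed

lemma vv: assumes "vc \<phi> f g A C" "vc \<psi> g h A C" shows "vc (vv \<phi> \<psi> A C) f h A C"
  proof -
  have o: "A \<in> Obj K" "C \<in> Obj K" using vc_Obj[OF assms(1)] by auto
  have c: "is_ver K f A C" "is_ver K h A C" using assms unfolding vc_def by auto
  show ?thesis using c_gl[OF vc_inner[OF assms] gl_l[OF o(2)] c] c unfolding vc_def vv_def by simp
qed

lemma vv_id: assumes "vc \<phi> f g A C"
  shows "vv (cunit K f) \<phi> A C = \<phi>" "vv \<phi> (cunit K g) A C = \<phi>"
proof -
  have o: "A \<in> Obj K" "C \<in> Obj K" using vc_Obj[OF assms] by auto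
  have c: "is_cell K \<phi> (hunit K A) (hunit K C) f g" "is_ver K f A C" "is_ver K g A C"
    using assms unfolding vc_def by auto
  note u = cunit[OF c(2)] cunit[OF c(3)]
  have "vv (cunit K f) \<phi> A C = (lam C \<cdot> (cunit K f \<Odot> \<phi>)) \<cdot> lam_inv A"
    unfolding vv_def using ccomp_assoc[OF glcell[OF gl_li[OF o(1)]] chcomp[OF u(1) c(1)] glcell[OF gl_l[OF o(2)]]] by simp
  also have "\<dots> = (\<phi> \<cdot> lam A) \<cdot> lam_inv A" using lunit_natural[OF c(1)] by simp
  also have "\<dots> = \<phi>" using ccomp_assoc[OF glcell[OF gl_li[OF o(1)]] glcell[OF gl_l[OF o(1)]] c(1)] l_li[OF o(1)]
     ccomp_id[OF c(1)] by simp
  finally show "vv (cunit K f) \<phi> A C = \<phi>" .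
  have "vv \<phi> (cunit K g) A C = (lam C \<cdot> (\<phi> \<Odot> cunit K g)) \<cdot> lam_inv A"
    unfolding vv_def using ccomp_assoc[OF glcell[OF gl_li[OF o(1)]] chcomp[OF c(1) u(2)] glcell[OF gl_l[OF o(2)]]] by simp
  also have "\<dots> = (\<phi> \<cdot> lam A) \<cdot> lam_inv A" using runit_natural[OF c(1)] lunit_eq_runit o by simp
  also have "\<dots> = \<phi>" using ccomp_assoc[OF glcell[OF gl_li[OF o(1)]] glcell[OF gl_l[OF o(1)]] c(1)] l_li[OF o(1)]
     ccomp_id[OF c(1)] by simp
  finally show "vv \<phi> (cunit K g) A C = \<phi>" .
qed

lemma vv_interchange: assumes "vc \<phi> f g A C" "vc \<psi> g h A C" "vc \<phi>' f' g' C E" "vc \<psi>' g' h' C E"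
  shows "vv \<phi>' \<psi>' C E \<cdot> vv \<phi> \<psi> A C = vv (\<phi>' \<cdot> \<phi>) (\<psi>' \<cdot> \<psi>) A E"
proof -
  have o: "A \<in> Obj K" "C \<in> Obj K" "E \<in> Obj K" using vc_Obj[OF assms(1)] vc_Obj[OF assms(3)] by auto
  note i1 = vc_inner[OF assms(1,2)] and i2 = vc_inner[OF assms(3,4)]
  have t: "is_cell K (\<phi> \<Odot> \<psi>) (hunit K A \<odot> hunit K A) (hunit K C \<odot> hunit K C) f h"
      "is_cell K (\<phi>' \<Odot> \<psi>') (hunit K C \<odot> hunit K C) (hunit K E \<odot> hunit K E) f' h'"
    using chcomp assms unfolding vc_def by blast+
  note lE = glcell[OF gl_l[OF o(3)]] and lC = glcell[OF gl_l[OF o(2)]] and liC = glcell[OF gl_li[OF o(2)]]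
    and liA = glcell[OF gl_li[OF o(1)]]
  have v: "is_cell K (vv \<phi> \<psi> A C) (hunit K A) (hunit K C) f h" using vv[OF assms(1,2)] unfolding vc_def by blast
  have "vv \<phi>' \<psi>' C E \<cdot> vv \<phi> \<psi> A C = lam E \<cdot> ((\<phi>' \<Odot> \<psi>') \<cdot> lam_inv C) \<cdot> vv \<phi> \<psi> A C"
    unfolding vv_def[of \<phi>'] using ccomp_assoc[OF v i2 lE] by simp
  also have "\<dots> = lam E \<cdot> (\<phi>' \<Odot> \<psi>') \<cdot> lam_inv C \<cdot> vv \<phi> \<psi> A C" using ccomp_assoc[OF v liC t(2)] by simp
  also have "\<dots> = lam E \<cdot> (\<phi>' \<Odot> \<psi>') \<cdot> (\<phi> \<Odot> \<psi>) \<cdot> lam_inv A" unfolding vv_def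
    using ccomp_assoc[OF i1 lC liC] li_l[OF o(2)] ccomp_id[OF i1] by simp
  also have "\<dots> = lam E \<cdot> ((\<phi>' \<Odot> \<psi>') \<cdot> (\<phi> \<Odot> \<psi>)) \<cdot> lam_inv A" using ccomp_assoc[OF liA t] by simp
  also have "\<dots> = vv (\<phi>' \<cdot> \<phi>) (\<psi>' \<cdot> \<psi>) A E" unfolding vv_def
    using interchange[of \<phi> _ _ f g \<psi> _ _ h \<phi>' _ f' g' \<psi>' _ h'] assms unfolding vc_def by metis
  finally show ?thesis .
qed

lemma vv_assoc: assumes "vc \<phi> f g A C" "vc \<psi> g h A C" "vc \<chi> h k A C"
  shows "vv (vv \<phi> \<psi> A C) \<chi> A C = vv \<phi> (vv \<psi> \<chi> A C) A C"
proof -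
  have o: "A \<in> Obj K" "C \<in> Obj K" using vc_Obj[OF assms(1)] by auto
  let ?u = "hunit K A" let ?w = "hunit K C" let ?i = "cid K ?u" let ?j = "cid K ?w"
  have u: "is_hor K ?u A A" and w: "is_hor K ?w C C" using o hunit by auto
  have c: "is_cell K \<phi> ?u ?w f g" "is_cell K \<psi> ?u ?w g h" "is_cell K \<chi> ?u ?w h k"
      "is_ver K f A C" "is_ver K g A C" "is_ver K h A C" "is_ver K k A C"
    using assms unfolding vc_def by auto
  note iu = glcell[OF gl_id[OF u]] and iw = glcell[OF gl_id[OF w]]
  note lC = glcell[OF gl_l[OF o(2)]] and liA = glcell[OF gl_li[OF o(1)]]
  note t12 = chcomp[OF c(1,2)] and t23 = chcomp[OF c(2,3)]
  note i12 = vc_inner[OF assms(1,2)] and i23 = vc_inner[OF assms(2,3)]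
  note t123 = chcomp[OF t12 c(3)] and t123' = chcomp[OF c(1) t23]
  note lj = gl_h[OF gl_l[OF o(2)] gl_id[OF w]] and jl = gl_h[OF gl_id[OF w] gl_l[OF o(2)]]
  note lii = gl_h[OF gl_li[OF o(1)] gl_id[OF u]] and ili = gl_h[OF gl_id[OF u] gl_li[OF o(1)]]
  note aC = gla[OF w w w] and aA = gla[OF u u u]
  have "vv \<phi> \<psi> A C \<Odot> \<chi> = (lam C \<Odot> ?j) \<cdot> (((\<phi> \<Odot> \<psi>) \<cdot> lam_inv A) \<Odot> \<chi>)"
    unfolding vv_def using interchange[OF i12 c(3) lC iw] ccomp_id[OF c(3)] by simp
  also have "((\<phi> \<Odot> \<psi>) \<cdot> lam_inv A) \<Odot> \<chi> = ((\<phi> \<Odot> \<psi>) \<Odot> \<chi>) \<cdot> (lam_inv A \<Odot> ?i)"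
    using interchange[OF liA iu t12 c(3)] ccomp_id[OF c(3)] by simp
  finally have L: "vv \<phi> \<psi> A C \<Odot> \<chi> = (lam C \<Odot> ?j) \<cdot> ((\<phi> \<Odot> \<psi>) \<Odot> \<chi>) \<cdot> (lam_inv A \<Odot> ?i)" .
  have "\<phi> \<Odot> vv \<psi> \<chi> A C = (?j \<Odot> lam C) \<cdot> (\<phi> \<Odot> ((\<psi> \<Odot> \<chi>) \<cdot> lam_inv A))"
    unfolding vv_def using interchange[OF c(1) i23 iw lC] ccomp_id[OF c(1)] by simp
  also have "\<phi> \<Odot> ((\<psi> \<Odot> \<chi>) \<cdot> lam_inv A) = (\<phi> \<Odot> (\<psi> \<Odot> \<chi>)) \<cdot> (?i \<Odot> lam_inv A)"
    using interchange[OF iu liA c(1) t23] ccomp_id[OF c(1)] by simp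
  finally have R: "\<phi> \<Odot> vv \<psi> \<chi> A C = (?j \<Odot> lam C) \<cdot> (\<phi> \<Odot> (\<psi> \<Odot> \<chi>)) \<cdot> (?i \<Odot> lam_inv A)" .
  have tri: "(?j \<Odot> lam C) \<cdot> asc K ?w ?w ?w = lam C \<Odot> ?j" "(?i \<Odot> lam A) \<cdot> asc K ?u ?u ?u = lam A \<Odot> ?i"
    using triangle[OF w w] triangle[OF u u] lunit_eq_runit o by auto
  have inv1: "(?i \<Odot> lam_inv A) \<cdot> (?i \<Odot> lam A) = cid K (?u \<odot> (?u \<odot> ?u))"
    using gl_ic[OF gl_id[OF u] gl_l[OF o(1)] gl_id[OF u] gl_li[OF o(1)]] li_l[OF o(1)] gl_idl[OF gl_id[OF u]]
      chcomp_cid[OF u hcomp[OF u u]] by simp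
  have inv2: "(lam A \<Odot> ?i) \<cdot> (lam_inv A \<Odot> ?i) = cid K (?u \<odot> ?u)"
    using gl_ic[OF gl_li[OF o(1)] gl_id[OF u] gl_l[OF o(1)] gl_id[OF u]] l_li[OF o(1)] gl_idl[OF gl_id[OF u]]
      chcomp_cid[OF u u] by simp
  have il: "gl (?i \<Odot> lam A) (?u \<odot> (?u \<odot> ?u)) (?u \<odot> ?u) A A" by (rule gl_h[OF gl_id[OF u] gl_l[OF o(1)]])
  have "asc K ?u ?u ?u \<cdot> (lam_inv A \<Odot> ?i) = ((?i \<Odot> lam_inv A) \<cdot> (?i \<Odot> lam A)) \<cdot> asc K ?u ?u ?u \<cdot> (lam_inv A \<Odot> ?i)"
    using inv1 gl_idl[OF gl_comp[OF lii aA]] by simp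
  also have "\<dots> = (?i \<Odot> lam_inv A) \<cdot> ((?i \<Odot> lam A) \<cdot> asc K ?u ?u ?u) \<cdot> (lam_inv A \<Odot> ?i)"
    using gl_assoc[OF gl_comp[OF lii aA] il ili] gl_assoc[OF lii aA il] by simp
  also have "\<dots> = ?i \<Odot> lam_inv A" using tri inv2 gl_idr[OF ili] by simp
  finally have al: "asc K ?u ?u ?u \<cdot> (lam_inv A \<Odot> ?i) = ?i \<Odot> lam_inv A" .
  have "vv \<phi> \<psi> A C \<Odot> \<chi> = ((?j \<Odot> lam C) \<cdot> asc K ?w ?w ?w) \<cdot> ((\<phi> \<Odot> \<psi>) \<Odot> \<chi>) \<cdot> (lam_inv A \<Odot> ?i)"
    using L tri by simp
  also have "\<dots> = (?j \<Odot> lam C) \<cdot> asc K ?w ?w ?w \<cdot> ((\<phi> \<Odot> \<psi>) \<Odot> \<chi>) \<cdot> (lam_inv A \<Odot> ?i)"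
    using ccomp_assoc[OF ccomp[OF glcell[OF lii] t123] glcell[OF aC] glcell[OF jl]] by simp
  also have "\<dots> = (?j \<Odot> lam C) \<cdot> (asc K ?w ?w ?w \<cdot> ((\<phi> \<Odot> \<psi>) \<Odot> \<chi>)) \<cdot> (lam_inv A \<Odot> ?i)"
    using ccomp_assoc[OF glcell[OF lii] t123 glcell[OF aC]] by simp
  also have "\<dots> = (?j \<Odot> lam C) \<cdot> ((\<phi> \<Odot> (\<psi> \<Odot> \<chi>)) \<cdot> asc K ?u ?u ?u) \<cdot> (lam_inv A \<Odot> ?i)"
    using asc_natural[OF c(1-3)] by simp
  also have "\<dots> = (?j \<Odot> lam C) \<cdot> (\<phi> \<Odot> (\<psi> \<Odot> \<chi>)) \<cdot> asc K ?u ?u ?u \<cdot> (lam_inv A \<Odot> ?i)"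
    using ccomp_assoc[OF glcell[OF lii] glcell[OF aA] t123'] by simp
  also have "\<dots> = \<phi> \<Odot> vv \<psi> \<chi> A C" using al R by simp
  finally show ?thesis unfolding vv_def[of "vv \<phi> \<psi> A C"] vv_def[of \<phi> "vv \<psi> \<chi> A C"] by simp
qed

lemma is_vcell_vc: "is_vcell K \<phi> f g \<longleftrightarrow> vc \<phi> f g (vdom K f) (vcod K f)"
  unfolding is_vcell_def vc_def is_ver_def by auto

lemma vc_dom: "vc \<phi> f g A C \<Longrightarrow> vdom K f = A \<and> vcod K f = C \<and> vsrc K \<phi> = f \<and> vtgt K \<phi> = g"
  unfolding vc_def is_ver_def is_cell_def by auto

lemma cell2_V: "is_cell2 (\<V> K) \<phi> f g \<longleftrightarrow> vc \<phi> f g (vdom K f) (vcod K f)"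
proof
  assume "is_cell2 (\<V> K) \<phi> f g"
  then obtain f' g' where v: "is_vcell K \<phi> f' g'" and e: "vsrc K \<phi> = f" "vtgt K \<phi> = g"
    unfolding is_cell2_def vertical_2cat_def by auto
  have w: "vc \<phi> f' g' (vdom K f') (vcod K f')" using v unfolding is_vcell_vc .
  have "f' = f" "g' = g" using vc_dom[OF w] e by auto
  with w show "vc \<phi> f g (vdom K f) (vcod K f)" by simp
next
  assume w: "vc \<phi> f g (vdom K f) (vcod K f)"
  then have "is_vcell K \<phi> f g" unfolding is_vcell_vc .
  then show "is_cell2 (\<V> K) \<phi> f g"
    unfolding is_cell2_def vertical_2cat_def using vc_dom[OF w] by auto
qed

lemma cell2_V': "vc \<phi> f g A C \<Longrightarrow> is_cell2 (\<V> K) \<phi> f g"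
  unfolding cell2_V using vc_dom by metis

lemma cell2_VE: "is_cell2 (\<V> K) \<phi> f g \<Longrightarrow> \<exists>A C. vc \<phi> f g A C"
  unfolding cell2_V by auto

lemma vcomp2_V: "vc \<phi> f g A C \<Longrightarrow> \<phi> \<Zcomp>\<^bsub>\<V> K\<^esub> \<psi> = vv \<phi> \<psi> A C"
  unfolding vertical_2cat_def vv_def by (simp add: vc_dom)

lemma V_simps: "Ob (\<V> K) = Obj K" "Arr (\<V> K) = Ver K" "dom1 (\<V> K) = vdom K" "cod1 (\<V> K) = vcod K"
  "id1 (\<V> K) = vid K" "comp1 (\<V> K) = vcomp K" "id2 (\<V> K) = cunit K" "hcomp2 (\<V> K) = ccomp K"
  "src2 (\<V> K) = vsrc K" "tgt2 (\<V> K) = vtgt K"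
  unfolding vertical_2cat_def by (auto simp: fun_eq_iff)

lemma is_arr_V: "is_arr (\<V> K) f A C \<longleftrightarrow> is_ver K f A C"
  unfolding is_arr_def is_ver_def V_simps ..

lemma vc_hc: assumes "vc \<phi> f g A C" "vc \<chi> k m C E" shows "vc (\<chi> \<cdot> \<phi>) (k \<bullet> f) (m \<bullet> g) A E"
  using ccomp[of \<phi> "hunit K A" "hunit K C" f g \<chi> "hunit K E" k m] vcomp[of f A C k E] vcomp[of g A C m E] assms unfolding vc_def by simp

lemma vc_cunit: "is_ver K f A C \<Longrightarrow> vc (cunit K f) f f A C"
  unfolding vc_def using cunit by blast

theorem two_category_vertical: "two_category (\<V> K)"
proof (rule two_category.intro, unfold is_arr_V V_simps)
  fix f assume "f \<in> Ver K" then show "vdom K f \<in> Obj K \<and> vcod K f \<in> Obj K" using ver_obj by blast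
next
  fix A assume "A \<in> Obj K" then show "is_ver K (vid K A) A A" using vid by blast
next
  fix f A C g E assume "is_ver K f A C" "is_ver K g C E"
  then show "is_ver K (g \<bullet> f) A E" using vcomp by blast
next
  fix f A C assume "is_ver K f A C" then show "f \<bullet> vid K A = f \<and> vid K C \<bullet> f = f" using vcomp_id by blast
next
  fix f A C g E h B assume "is_ver K f A C" "is_ver K g C E" "is_ver K h E B"
  then show "(h \<bullet> g) \<bullet> f = h \<bullet> (g \<bullet> f)" using vcomp_assoc by blast
next
  fix \<phi> f g assume "is_cell2 (\<V> K) \<phi> f g"
  then show "f \<in> Ver K \<and> g \<in> Ver K \<and> vdom K f = vdom K g \<and> vcod K f = vcod K g"
    unfolding cell2_V vc_def is_ver_def by auto
next
  fix f assume "f \<in> Ver K"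
  then show "is_cell2 (\<V> K) (cunit K f) f f" using vc_cunit cell2_V' is_ver_def by metis
next
  fix \<phi> f g \<psi> h assume a: "is_cell2 (\<V> K) \<phi> f g" "is_cell2 (\<V> K) \<psi> g h"
  then obtain A C where c: "vc \<phi> f g A C" "vc \<psi> g h A C"
    using cell2_VE[OF a(1)] cell2_VE[OF a(2)] unfolding vc_def is_ver_def by auto
  then show "is_cell2 (\<V> K) (\<phi> \<Zcomp>\<^bsub>\<V> K\<^esub> \<psi>) f h" using vv cell2_V' vcomp2_V by metis
next
  fix \<phi> f g assume "is_cell2 (\<V> K) \<phi> f g"
  then obtain A C where c: "vc \<phi> f g A C" using cell2_VE by blast
  then have "vc (cunit K f) f f A C" using vc_cunit unfolding vc_def by blast
  then show "cunit K f \<Zcomp>\<^bsub>\<V> K\<^esub> \<phi> = \<phi> \<and> \<phi> \<Zcomp>\<^bsub>\<V> K\<^esub> cunit K g = \<phi>"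
    using vcomp2_V vv_id c by metis
next
  fix \<phi> f g \<psi> h \<chi> k assume a: "is_cell2 (\<V> K) \<phi> f g" "is_cell2 (\<V> K) \<psi> g h" "is_cell2 (\<V> K) \<chi> h k"
  then obtain A C where c: "vc \<phi> f g A C" "vc \<psi> g h A C" "vc \<chi> h k A C"
    using cell2_VE[OF a(1)] cell2_VE[OF a(2)] cell2_VE[OF a(3)] unfolding vc_def is_ver_def by auto
  show "\<phi> \<Zcomp>\<^bsub>\<V> K\<^esub> \<psi> \<Zcomp>\<^bsub>\<V> K\<^esub> \<chi> = \<phi> \<Zcomp>\<^bsub>\<V> K\<^esub> (\<psi> \<Zcomp>\<^bsub>\<V> K\<^esub> \<chi>)"
    using vcomp2_V[OF c(1)] vcomp2_V[OF c(2)] vcomp2_V[OF vv[OF c(1,2)]] vv_assoc[OF c] by simp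
next
  fix \<phi> f g \<chi> k m assume a: "is_cell2 (\<V> K) \<phi> f g" "is_cell2 (\<V> K) \<chi> k m" "vcod K f = vdom K k"
  then have "vc \<phi> f g (vdom K f) (vcod K f)" "vc \<chi> k m (vcod K f) (vcod K k)" unfolding cell2_V by auto
  then show "is_cell2 (\<V> K) (\<chi> \<cdot> \<phi>) (k \<bullet> f) (m \<bullet> g)" using vc_hc cell2_V' by blast
next
  fix \<phi> f g assume "is_cell2 (\<V> K) \<phi> f g"
  then have c: "vc \<phi> f g (vdom K f) (vcod K f)" unfolding cell2_V .
  then show "\<phi> \<cdot> cunit K (vid K (vdom K f)) = \<phi> \<and> cunit K (vid K (vcod K f)) \<cdot> \<phi> = \<phi>"
    using vc_Obj[OF c] cunit_vid ccomp_id unfolding vc_def by metis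
next
  fix \<phi> f f' \<chi> g g' \<omega> h h'
  assume a: "is_cell2 (\<V> K) \<phi> f f'" "is_cell2 (\<V> K) \<chi> g g'" "is_cell2 (\<V> K) \<omega> h h'"
    "vcod K f = vdom K g" "vcod K g = vdom K h"
  then show "(\<omega> \<cdot> \<chi>) \<cdot> \<phi> = \<omega> \<cdot> \<chi> \<cdot> \<phi>" unfolding cell2_V vc_def using ccomp_assoc by metis
next
  fix f A C g E assume "is_ver K f A C" "is_ver K g C E"
  then show "cunit K g \<cdot> cunit K f = cunit K (g \<bullet> f)" using cunit_vcomp by metis
next
  fix \<phi> f g \<psi> h \<phi>' f' g' \<psi>' h'
  assume a: "is_cell2 (\<V> K) \<phi> f g" "is_cell2 (\<V> K) \<psi> g h" "is_cell2 (\<V> K) \<phi>' f' g'"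
    "is_cell2 (\<V> K) \<psi>' g' h'" "vcod K f = vdom K f'"
  then obtain A C E where c: "vc \<phi> f g A C" "vc \<psi> g h A C" "vc \<phi>' f' g' C E" "vc \<psi>' g' h' C E"
    unfolding cell2_V unfolding vc_def is_ver_def by auto
  show "(\<phi>' \<Zcomp>\<^bsub>\<V> K\<^esub> \<psi>') \<cdot> (\<phi> \<Zcomp>\<^bsub>\<V> K\<^esub> \<psi>) = (\<phi>' \<cdot> \<phi>) \<Zcomp>\<^bsub>\<V> K\<^esub> (\<psi>' \<cdot> \<psi>)"
    using vcomp2_V[OF c(1)] vcomp2_V[OF c(3)] vcomp2_V[OF vc_hc[OF c(1,3)]] vv_interchange[OF c] by simp
qed

end
end

theory Submission
  imports Defs
begin

text \<open>
  Call a horizontal morphism \<open>H\<close> into \<open>B\<close> good if every cell \<open>H \<odot> j\<^sup>* \<Rightarrow> 1\<^sub>M\<close> with vertical target \<open>d\<close>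
  factors uniquely through \<open>\<epsilon>'\<close>; the pointwise condition in \<open>K\<close> says that every \<open>H\<close> is good.
  The composite \<open>\<kappa>: f\<^sub>* \<odot> j\<^sup>* \<Rightarrow> 1\<^sub>B\<close> of the companion and conjoint counits is cartesian, so a tabulation
  of \<open>f\<^sub>* \<odot> j\<^sup>*\<close> is a comma object \<open>f/j\<close>.  As the tabulation and the cells \<open>1 \<Rightarrow> f\<^sub>*\<close> are opcartesian, Street's
  condition at \<open>f\<close> is equivalent to \<open>f\<^sub>*\<close> being good.  Finally, an arbitrary \<open>H\<close> with opcartesian
  tabulation \<open>(p, q)\<close> receives an opcartesian cell \<open>t: q\<^sub>* \<Rightarrow> H\<close> with vertical target an identity.  It exhibits
  \<open>H\<close> as a retract of \<open>p\<^sup>* \<odot> q\<^sub>*\<close>, hence \<open>t \<odot> j\<^sup>*\<close> can be cancelled on the right, and \<open>H\<close> is good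
  because \<open>q\<^sub>*\<close> is.
\<close>

text \<open>The hypotheses make \<open>h\<close> a bijection from the solutions of \<open>A\<close>
  onto those of \<open>B\<close>, so unique existence transfers along it. Below, \<open>h\<close> is
  composition with an opcartesian cell.\<close>

lemma ex1_reindex:
  assumes "\<And>x. A x \<Longrightarrow> B (h x)" and "\<And>y. B y \<Longrightarrow> \<exists>!x. A x \<and> y = h x"
  shows "(\<exists>!y. B y \<and> P y) \<longleftrightarrow> (\<exists>!x. A x \<and> P (h x))"
proof
  assume "\<exists>!y. B y \<and> P y"
  then obtain y where y: "B y" "P y" and uy: "\<And>y'. B y' \<Longrightarrow> P y' \<Longrightarrow> y' = y"
    by blast
  obtain x where x: "A x" "y = h x" and ux: "\<And>x'. A x' \<Longrightarrow> y = h x' \<Longrightarrow> x' = x"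
    using assms(2)[OF y(1)] by blast
  show "\<exists>!x. A x \<and> P (h x)"
  proof (rule ex1I[of _ x])
    fix x' assume "A x' \<and> P (h x')"
    then show "x' = x"
      using ux[of x'] uy[of "h x'"] assms(1) by blast
  qed (use x y in blast)
next
  assume "\<exists>!x. A x \<and> P (h x)"
  then obtain x where x: "A x" "P (h x)" and ux: "\<And>x'. A x' \<Longrightarrow> P (h x') \<Longrightarrow> x' = x"
    by blast
  show "\<exists>!y. B y \<and> P y"
  proof (rule ex1I[of _ "h x"])
    fix y assume y: "B y \<and> P y"
    then obtain x' where "A x'" "y = h x'"
      using assms(2) by blast
    then show "y = h x"
      using ux y by blast
  qed (use x assms(1) in blast)
qed

context double_category
begin

section \<open>Cells of a double category up to coherence\<close>

abbreviation "lunit_inv J \<equiv> inv_cell K (lunit K J)"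

abbreviation "runit_inv J \<equiv> inv_cell K (runit K J)"

section \<open>Boundaries, identities and associativity of cells\<close>

lemma is_cell_self: "\<phi> \<in> Cell K \<Longrightarrow> is_cell K \<phi> (hsrc K \<phi>) (htgt K \<phi>) (vsrc K \<phi>) (vtgt K \<phi>)"
  by (simp add: is_cell_def)

lemma is_cellD:
  assumes "is_cell K \<phi> J L f g"
  shows "\<phi> \<in> Cell K" "hsrc K \<phi> = J" "htgt K \<phi> = L" "vsrc K \<phi> = f" "vtgt K \<phi> = g"
    "J \<in> Hor K" "L \<in> Hor K" "f \<in> Ver K" "g \<in> Ver K"
    "vdom K f = hdom K J" "vcod K f = hdom K L" "vdom K g = hcod K J" "vcod K g = hcod K L"
  using assms cell_hor[of \<phi>] cell_vsrc[of \<phi>] cell_vtgt[of \<phi>] by (auto simp: is_cell_def is_ver_def)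

lemma obj_simps [simp]:
  "f \<in> Ver K \<Longrightarrow> vdom K f \<in> Obj K"
  "f \<in> Ver K \<Longrightarrow> vcod K f \<in> Obj K"
  "J \<in> Hor K \<Longrightarrow> hdom K J \<in> Obj K"
  "J \<in> Hor K \<Longrightarrow> hcod K J \<in> Obj K"
  using ver_obj hor_obj by auto

lemma vid_simps [simp]:
  assumes "A \<in> Obj K"
  shows "vid K A \<in> Ver K" "vdom K (vid K A) = A" "vcod K (vid K A) = A"
  using vid[OF assms] by (simp_all add: is_ver_def)

lemma vcomp_simps [simp]:
  assumes "f \<in> Ver K" "g \<in> Ver K" "vdom K g = vcod K f"
  shows "g \<bullet> f \<in> Ver K" "vdom K (g \<bullet> f) = vdom K f" "vcod K (g \<bullet> f) = vcod K g"
  using vcomp[of f _ _ g] assms by (auto simp: is_ver_def)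

lemma vcomp_vid [simp]:
  "f \<in> Ver K \<Longrightarrow> vdom K f = A \<Longrightarrow> f \<bullet> vid K A = f"
  "f \<in> Ver K \<Longrightarrow> vcod K f = A \<Longrightarrow> vid K A \<bullet> f = f"
  using vcomp_id by (auto simp: is_ver_def)

lemma vcomp_assoc' [simp]:
  "f \<in> Ver K \<Longrightarrow> g \<in> Ver K \<Longrightarrow> h \<in> Ver K \<Longrightarrow> vdom K g = vcod K f \<Longrightarrow> vdom K h = vcod K g
    \<Longrightarrow> (h \<bullet> g) \<bullet> f = h \<bullet> g \<bullet> f"
  using vcomp_assoc by (auto simp: is_ver_def)

lemma hunit_simps [simp]:
  assumes "A \<in> Obj K"
  shows "hunit K A \<in> Hor K" "hdom K (hunit K A) = A" "hcod K (hunit K A) = A"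
  using hunit[OF assms] by (simp_all add: is_hor_def)

lemma hcomp_simps [simp]:
  assumes "J \<in> Hor K" "H \<in> Hor K" "hdom K H = hcod K J"
  shows "J \<odot> H \<in> Hor K" "hdom K (J \<odot> H) = hdom K J" "hcod K (J \<odot> H) = hcod K H"
  using hcomp[of J _ _ H] assms by (auto simp: is_hor_def)

lemma cell_simps [simp]:
  assumes "\<phi> \<in> Cell K"
  shows "hsrc K \<phi> \<in> Hor K" "htgt K \<phi> \<in> Hor K" "vsrc K \<phi> \<in> Ver K" "vtgt K \<phi> \<in> Ver K"
    "vdom K (vsrc K \<phi>) = hdom K (hsrc K \<phi>)" "vcod K (vsrc K \<phi>) = hdom K (htgt K \<phi>)"
    "vdom K (vtgt K \<phi>) = hcod K (hsrc K \<phi>)" "vcod K (vtgt K \<phi>) = hcod K (htgt K \<phi>)"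
  using is_cellD[OF is_cell_self[OF assms]] by simp_all

lemma cid_simps [simp]:
  assumes "J \<in> Hor K"
  shows "cid K J \<in> Cell K" "hsrc K (cid K J) = J" "htgt K (cid K J) = J"
    "vsrc K (cid K J) = vid K (hdom K J)" "vtgt K (cid K J) = vid K (hcod K J)"
  using cid[of J] assms by (simp_all add: is_cell_def is_hor_def)

lemma cunit_simps [simp]:
  assumes "f \<in> Ver K"
  shows "cunit K f \<in> Cell K" "hsrc K (cunit K f) = hunit K (vdom K f)"
    "htgt K (cunit K f) = hunit K (vcod K f)" "vsrc K (cunit K f) = f" "vtgt K (cunit K f) = f"
  using cunit[of f] assms by (simp_all add: is_cell_def is_ver_def)

lemma ccomp_simps [simp]:
  assumes "\<phi> \<in> Cell K" "\<psi> \<in> Cell K" "hsrc K \<psi> = htgt K \<phi>"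
  shows "\<psi> \<cdot> \<phi> \<in> Cell K" "hsrc K (\<psi> \<cdot> \<phi>) = hsrc K \<phi>" "htgt K (\<psi> \<cdot> \<phi>) = htgt K \<psi>"
    "vsrc K (\<psi> \<cdot> \<phi>) = vsrc K \<psi> \<bullet> vsrc K \<phi>" "vtgt K (\<psi> \<cdot> \<phi>) = vtgt K \<psi> \<bullet> vtgt K \<phi>"
  using ccomp[of \<phi> _ _ _ _ \<psi>] assms by (auto simp: is_cell_def)

lemma chcomp_simps [simp]:
  assumes "\<phi> \<in> Cell K" "\<psi> \<in> Cell K" "vsrc K \<psi> = vtgt K \<phi>"
  shows "\<phi> \<Odot> \<psi> \<in> Cell K" "hsrc K (\<phi> \<Odot> \<psi>) = hsrc K \<phi> \<odot> hsrc K \<psi>"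
    "htgt K (\<phi> \<Odot> \<psi>) = htgt K \<phi> \<odot> htgt K \<psi>"
    "vsrc K (\<phi> \<Odot> \<psi>) = vsrc K \<phi>" "vtgt K (\<phi> \<Odot> \<psi>) = vtgt K \<psi>"
  using chcomp[of \<phi> _ _ _ _ \<psi>] assms by (auto simp: is_cell_def)

lemma ccomp_cid [simp]:
  "\<phi> \<in> Cell K \<Longrightarrow> hsrc K \<phi> = J \<Longrightarrow> \<phi> \<cdot> cid K J = \<phi>"
  "\<phi> \<in> Cell K \<Longrightarrow> htgt K \<phi> = J \<Longrightarrow> cid K J \<cdot> \<phi> = \<phi>"
  using ccomp_id by (auto simp: is_cell_def)

lemma ccomp_assoc' [simp]:
  "\<phi> \<in> Cell K \<Longrightarrow> \<psi> \<in> Cell K \<Longrightarrow> \<omega> \<in> Cell K \<Longrightarrow> hsrc K \<psi> = htgt K \<phi> \<Longrightarrow> hsrc K \<omega> = htgt K \<psi>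
    \<Longrightarrow> (\<omega> \<cdot> \<psi>) \<cdot> \<phi> = \<omega> \<cdot> \<psi> \<cdot> \<phi>"
  using ccomp_assoc by (auto simp: is_cell_def)

lemma cunit_vid' [simp]: "A \<in> Obj K \<Longrightarrow> cunit K (vid K A) = cid K (hunit K A)"
  by (rule cunit_vid)

lemma cunit_ccomp:
  "f \<in> Ver K \<Longrightarrow> g \<in> Ver K \<Longrightarrow> vdom K g = vcod K f \<Longrightarrow> cunit K g \<cdot> cunit K f = cunit K (g \<bullet> f)"
  using cunit_vcomp by (auto simp: is_ver_def)

lemma chcomp_cid' [simp]:
  "J \<in> Hor K \<Longrightarrow> H \<in> Hor K \<Longrightarrow> hdom K H = hcod K J \<Longrightarrow> cid K J \<Odot> cid K H = cid K (J \<odot> H)"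
  using chcomp_cid by (auto simp: is_hor_def)

lemma lunit_gi: "J \<in> Hor K
    \<Longrightarrow> gi (lunit K J) (lunit_inv J) (hunit K (hdom K J) \<odot> J) J (hdom K J) (hcod K J)"
  using gi_lunit[of J "hdom K J" "hcod K J"] gi_inv[of "lunit K J"] by (auto simp: is_hor_def)

lemma runit_gi: "J \<in> Hor K
    \<Longrightarrow> gi (runit K J) (runit_inv J) (J \<odot> hunit K (hcod K J)) J (hdom K J) (hcod K J)"
  using gi_runit[of J "hdom K J" "hcod K J"] gi_inv[of "runit K J"] by (auto simp: is_hor_def)

lemma lunit_simps [simp]:
  assumes "J \<in> Hor K"
  shows "lunit K J \<in> Cell K" "hsrc K (lunit K J) = hunit K (hdom K J) \<odot> J"
    "htgt K (lunit K J) = J" "vsrc K (lunit K J) = vid K (hdom K J)"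
    "vtgt K (lunit K J) = vid K (hcod K J)"
    "lunit_inv J \<in> Cell K" "hsrc K (lunit_inv J) = J"
    "htgt K (lunit_inv J) = hunit K (hdom K J) \<odot> J" "vsrc K (lunit_inv J) = vid K (hdom K J)"
    "vtgt K (lunit_inv J) = vid K (hcod K J)"
    "lunit K J \<cdot> lunit_inv J = cid K J"
    "lunit_inv J \<cdot> lunit K J = cid K (hunit K (hdom K J) \<odot> J)"
  using lunit_gi[OF assms] by (simp_all add: gi_def gl_def is_cell_def)

lemma runit_simps [simp]:
  assumes "J \<in> Hor K"
  shows "runit K J \<in> Cell K" "hsrc K (runit K J) = J \<odot> hunit K (hcod K J)"
    "htgt K (runit K J) = J" "vsrc K (runit K J) = vid K (hdom K J)"
    "vtgt K (runit K J) = vid K (hcod K J)"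
    "runit_inv J \<in> Cell K" "hsrc K (runit_inv J) = J"
    "htgt K (runit_inv J) = J \<odot> hunit K (hcod K J)" "vsrc K (runit_inv J) = vid K (hdom K J)"
    "vtgt K (runit_inv J) = vid K (hcod K J)"
    "runit K J \<cdot> runit_inv J = cid K J"
    "runit_inv J \<cdot> runit K J = cid K (J \<odot> hunit K (hcod K J))"
  using runit_gi[OF assms] by (simp_all add: gi_def gl_def is_cell_def)

lemma asc_simps [simp]:
  assumes "J \<in> Hor K" "H \<in> Hor K" "G \<in> Hor K" "hdom K H = hcod K J" "hdom K G = hcod K H"
  shows "asc K J H G \<in> Cell K" "hsrc K (asc K J H G) = (J \<odot> H) \<odot> G"
    "htgt K (asc K J H G) = J \<odot> (H \<odot> G)" "vsrc K (asc K J H G) = vid K (hdom K J)"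
    "vtgt K (asc K J H G) = vid K (hcod K G)"
  using gla[of J _ _ H _ G] assms by (auto simp: gl_def is_cell_def is_hor_def)

section \<open>Interchange and naturality of the coherence cells\<close>

lemma interchange':
  assumes "\<phi> \<in> Cell K" "\<chi> \<in> Cell K" "\<psi> \<in> Cell K" "\<omega> \<in> Cell K" "vsrc K \<chi> = vtgt K \<phi>"
    "vsrc K \<omega> = vtgt K \<psi>" "hsrc K \<psi> = htgt K \<phi>" "hsrc K \<omega> = htgt K \<chi>"
  shows "(\<psi> \<Odot> \<omega>) \<cdot> (\<phi> \<Odot> \<chi>) = (\<psi> \<cdot> \<phi>) \<Odot> (\<omega> \<cdot> \<chi>)"
  using interchange[of \<phi> _ _ _ _ \<chi> _ _ _ \<psi> _ _ _ \<omega>] assms by (auto simp: is_cell_def)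

text \<open>Composites are kept nested to the right, so the pair to be interchanged usually comes
  with a further cell \<theta> that is applied first.\<close>

lemma interchange_assoc:
  assumes "\<phi> \<in> Cell K" "\<chi> \<in> Cell K" "\<psi> \<in> Cell K" "\<omega> \<in> Cell K" "vsrc K \<chi> = vtgt K \<phi>"
    "vsrc K \<omega> = vtgt K \<psi>" "hsrc K \<psi> = htgt K \<phi>" "hsrc K \<omega> = htgt K \<chi>"
    "\<theta> \<in> Cell K" "htgt K \<theta> = hsrc K \<phi> \<odot> hsrc K \<chi>"
  shows "(\<psi> \<Odot> \<omega>) \<cdot> (\<phi> \<Odot> \<chi>) \<cdot> \<theta> = ((\<psi> \<cdot> \<phi>) \<Odot> (\<omega> \<cdot> \<chi>)) \<cdot> \<theta>"
  using assms by (simp flip: interchange')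

lemma lunit_nat:
  "\<phi> \<in> Cell K \<Longrightarrow> lunit K (htgt K \<phi>) \<cdot> (cunit K (vsrc K \<phi>) \<Odot> \<phi>) = \<phi> \<cdot> lunit K (hsrc K \<phi>)"
  using lunit_natural[OF is_cell_self] .

lemma runit_nat:
  "\<phi> \<in> Cell K \<Longrightarrow> runit K (htgt K \<phi>) \<cdot> (\<phi> \<Odot> cunit K (vtgt K \<phi>)) = \<phi> \<cdot> runit K (hsrc K \<phi>)"
  using runit_natural[OF is_cell_self] .

lemma lunit_inv_nat:
  assumes "\<phi> \<in> Cell K"
  shows "(cunit K (vsrc K \<phi>) \<Odot> \<phi>) \<cdot> lunit_inv (hsrc K \<phi>) = lunit_inv (htgt K \<phi>) \<cdot> \<phi>"
proof -
  let ?u = "cunit K (vsrc K \<phi>) \<Odot> \<phi>"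
  have "?u = lunit_inv (htgt K \<phi>) \<cdot> lunit K (htgt K \<phi>) \<cdot> ?u"
    using assms by (simp flip: ccomp_assoc')
  also have "\<dots> = lunit_inv (htgt K \<phi>) \<cdot> \<phi> \<cdot> lunit K (hsrc K \<phi>)"
    using assms by (simp add: lunit_nat)
  finally have "?u \<cdot> lunit_inv (hsrc K \<phi>) = (lunit_inv (htgt K \<phi>) \<cdot> \<phi> \<cdot> lunit K (hsrc K \<phi>)) \<cdot> lunit_inv (hsrc K \<phi>)"
    by simp
  then show ?thesis
    using assms by simp
qed

lemma runit_inv_nat:
  assumes "\<phi> \<in> Cell K"
  shows "(\<phi> \<Odot> cunit K (vtgt K \<phi>)) \<cdot> runit_inv (hsrc K \<phi>) = runit_inv (htgt K \<phi>) \<cdot> \<phi>"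
proof -
  let ?u = "\<phi> \<Odot> cunit K (vtgt K \<phi>)"
  have "?u = runit_inv (htgt K \<phi>) \<cdot> runit K (htgt K \<phi>) \<cdot> ?u"
    using assms by (simp flip: ccomp_assoc')
  also have "\<dots> = runit_inv (htgt K \<phi>) \<cdot> \<phi> \<cdot> runit K (hsrc K \<phi>)"
    using assms by (simp add: runit_nat)
  finally have "?u \<cdot> runit_inv (hsrc K \<phi>) = (runit_inv (htgt K \<phi>) \<cdot> \<phi> \<cdot> runit K (hsrc K \<phi>)) \<cdot> runit_inv (hsrc K \<phi>)"
    by simp
  then show ?thesis
    using assms by simp
qed

lemma asc_nat:
  assumes "\<phi> \<in> Cell K" "\<chi> \<in> Cell K" "\<omega> \<in> Cell K" "vsrc K \<chi> = vtgt K \<phi>" "vsrc K \<omega> = vtgt K \<chi>"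
  shows "asc K (htgt K \<phi>) (htgt K \<chi>) (htgt K \<omega>) \<cdot> ((\<phi> \<Odot> \<chi>) \<Odot> \<omega>)
    = (\<phi> \<Odot> (\<chi> \<Odot> \<omega>)) \<cdot> asc K (hsrc K \<phi>) (hsrc K \<chi>) (hsrc K \<omega>)"
  using asc_natural[of \<phi> _ _ _ _ \<chi> _ _ _ \<omega>] assms by (auto simp: is_cell_def)

text \<open>Serves to apply an equation for \<open>\<alpha> \<cdot> \<beta>\<close> inside a
  right-nested composite, where \<theta> stands for everything applied earlier.\<close>

lemma ccomp_eq_assoc:
  assumes "\<alpha> \<cdot> \<beta> = \<gamma>" "\<alpha> \<in> Cell K" "\<beta> \<in> Cell K" "\<theta> \<in> Cell K" "hsrc K \<alpha> = htgt K \<beta>" "hsrc K \<beta> = htgt K \<theta>"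
  shows "\<alpha> \<cdot> \<beta> \<cdot> \<theta> = \<gamma> \<cdot> \<theta>"
  using assms by (simp flip: ccomp_assoc')

section \<open>Cartesian and opcartesian cells\<close>

text \<open>The vertical mirror image of \<open>is_opcartesian\<close>: such a cell presents its
  horizontal source as the restriction of its horizontal target along the two vertical
  morphisms.\<close>

definition is_cartesian :: "'c \<Rightarrow> bool" where
  "is_cartesian \<phi> \<longleftrightarrow> \<phi> \<in> Cell K \<and>
     (\<forall>\<chi> H h k.
        h \<in> Ver K \<and> vcod K h = vdom K (vsrc K \<phi>) \<and>
        k \<in> Ver K \<and> vcod K k = vdom K (vtgt K \<phi>) \<and>
        is_cell K \<chi> H (htgt K \<phi>) (vsrc K \<phi> \<bullet> h) (vtgt K \<phi> \<bullet> k)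
        \<longrightarrow> (\<exists>!\<chi>'. is_cell K \<chi>' H (hsrc K \<phi>) h k \<and> \<chi> = \<phi> \<cdot> \<chi>'))"

lemma cartesian_ex1:
  assumes "is_cartesian \<phi>" "is_cell K \<phi> J L f g" "h \<in> Ver K" "vcod K h = hdom K J"
    "k \<in> Ver K" "vcod K k = hcod K J" "is_cell K \<chi> H L (f \<bullet> h) (g \<bullet> k)"
  shows "\<exists>!\<chi>'. is_cell K \<chi>' H J h k \<and> \<chi> = \<phi> \<cdot> \<chi>'"
  using assms is_cellD[OF assms(2)] unfolding is_cartesian_def by simp

lemma opcartesian_ex1:
  assumes "is_opcartesian K \<phi>" "is_cell K \<phi> J L f g" "h \<in> Ver K" "vdom K h = hdom K L"
    "k \<in> Ver K" "vdom K k = hcod K L" "is_cell K \<chi> J N (h \<bullet> f) (k \<bullet> g)"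
  shows "\<exists>!\<chi>'. is_cell K \<chi>' L N h k \<and> \<chi> = \<chi>' \<cdot> \<phi>"
  using assms is_cellD[OF assms(2)] unfolding is_opcartesian_def by simp

lemma cartesianI:
  assumes "\<phi> \<in> Cell K"
    and "\<And>\<chi> H h k. \<lbrakk>h \<in> Ver K; vcod K h = hdom K (hsrc K \<phi>); k \<in> Ver K; vcod K k = hcod K (hsrc K \<phi>);
      is_cell K \<chi> H (htgt K \<phi>) (vsrc K \<phi> \<bullet> h) (vtgt K \<phi> \<bullet> k)\<rbrakk>
      \<Longrightarrow> \<exists>!\<chi>'. is_cell K \<chi>' H (hsrc K \<phi>) h k \<and> \<chi> = \<phi> \<cdot> \<chi>'"
  shows "is_cartesian \<phi>"
  using assms unfolding is_cartesian_def by simp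

lemma opcartesianI:
  assumes "\<phi> \<in> Cell K"
    and "\<And>\<chi> L h k. \<lbrakk>h \<in> Ver K; vdom K h = hdom K (htgt K \<phi>); k \<in> Ver K; vdom K k = hcod K (htgt K \<phi>);
      is_cell K \<chi> (hsrc K \<phi>) L (h \<bullet> vsrc K \<phi>) (k \<bullet> vtgt K \<phi>)\<rbrakk>
      \<Longrightarrow> \<exists>!\<chi>'. is_cell K \<chi>' (htgt K \<phi>) L h k \<and> \<chi> = \<chi>' \<cdot> \<phi>"
  shows "is_opcartesian K \<phi>"
  using assms unfolding is_opcartesian_def by simp

lemma cartesian_cancel:
  assumes "is_cartesian \<phi>" "\<phi> \<in> Cell K" "\<alpha> \<in> Cell K" "\<beta> \<in> Cell K" "htgt K \<alpha> = hsrc K \<phi>" "htgt K \<beta> = hsrc K \<phi>"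
    "vsrc K \<alpha> = vsrc K \<beta>" "vtgt K \<alpha> = vtgt K \<beta>" "\<phi> \<cdot> \<alpha> = \<phi> \<cdot> \<beta>"
  shows "\<alpha> = \<beta>"
proof -
  \<comment> \<open>The horizontal sources agree, both being that of the common composite.\<close>
  have e: "hsrc K \<alpha> = hsrc K \<beta>"
    using arg_cong[OF assms(9), of "hsrc K"] assms(1-8) by simp
  have "\<exists>!\<chi>'. is_cell K \<chi>' (hsrc K \<alpha>) (hsrc K \<phi>) (vsrc K \<alpha>) (vtgt K \<alpha>) \<and> \<phi> \<cdot> \<alpha> = \<phi> \<cdot> \<chi>'"
    by (rule cartesian_ex1[OF assms(1) is_cell_self[OF assms(2)]]) (use assms(1-8) e in \<open>simp_all add: is_cell_def\<close>)
  moreover have "is_cell K \<alpha> (hsrc K \<alpha>) (hsrc K \<phi>) (vsrc K \<alpha>) (vtgt K \<alpha>)" "is_cell K \<beta> (hsrc K \<alpha>) (hsrc K \<phi>) (vsrc K \<alpha>) (vtgt K \<alpha>)"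
    using assms(1-8) e by (simp_all add: is_cell_def)
  ultimately show ?thesis
    using assms(9) by blast
qed

lemma opcartesian_cancel:
  assumes "is_opcartesian K \<phi>" "\<phi> \<in> Cell K" "\<alpha> \<in> Cell K" "\<beta> \<in> Cell K" "hsrc K \<alpha> = htgt K \<phi>" "hsrc K \<beta> = htgt K \<phi>"
    "vsrc K \<alpha> = vsrc K \<beta>" "vtgt K \<alpha> = vtgt K \<beta>" "\<alpha> \<cdot> \<phi> = \<beta> \<cdot> \<phi>"
  shows "\<alpha> = \<beta>"
proof -
  have e: "htgt K \<alpha> = htgt K \<beta>"
    using arg_cong[OF assms(9), of "htgt K"] assms(1-8) by simp
  have "\<exists>!\<chi>'. is_cell K \<chi>' (htgt K \<phi>) (htgt K \<alpha>) (vsrc K \<alpha>) (vtgt K \<alpha>) \<and> \<alpha> \<cdot> \<phi> = \<chi>' \<cdot> \<phi>"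
    by (rule opcartesian_ex1[OF assms(1) is_cell_self[OF assms(2)]]) (use assms(1-8) e in \<open>simp_all add: is_cell_def\<close>)
  moreover have "is_cell K \<alpha> (htgt K \<phi>) (htgt K \<alpha>) (vsrc K \<alpha>) (vtgt K \<alpha>)" "is_cell K \<beta> (htgt K \<phi>) (htgt K \<alpha>) (vsrc K \<alpha>) (vtgt K \<alpha>)"
    using assms(1-8) e by (simp_all add: is_cell_def)
  ultimately show ?thesis
    using assms(9) by blast
qed

text \<open>Factor through \<psi> first and then through \<phi>; uniqueness follows by cancelling
  the two in the same order.\<close>

lemma cartesian_ccomp:
  assumes \<phi>: "is_cartesian \<phi>" and \<psi>: "is_cartesian \<psi>" and e: "hsrc K \<psi> = htgt K \<phi>"
  shows "is_cartesian (\<psi> \<cdot> \<phi>)"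
proof -
  have c [simp]: "\<phi> \<in> Cell K" "\<psi> \<in> Cell K"
    using \<phi> \<psi> by (auto simp: is_cartesian_def)
  show ?thesis
  proof (rule cartesianI)
    fix \<chi> H h k
    assume "h \<in> Ver K" "vcod K h = hdom K (hsrc K (\<psi> \<cdot> \<phi>))" "k \<in> Ver K" "vcod K k = hcod K (hsrc K (\<psi> \<cdot> \<phi>))"
      "is_cell K \<chi> H (htgt K (\<psi> \<cdot> \<phi>)) (vsrc K (\<psi> \<cdot> \<phi>) \<bullet> h) (vtgt K (\<psi> \<cdot> \<phi>) \<bullet> k)"
    then have a: "h \<in> Ver K" "vcod K h = hdom K (hsrc K \<phi>)" "k \<in> Ver K" "vcod K k = hcod K (hsrc K \<phi>)"
      "is_cell K \<chi> H (htgt K \<psi>) (vsrc K \<psi> \<bullet> vsrc K \<phi> \<bullet> h) (vtgt K \<psi> \<bullet> vtgt K \<phi> \<bullet> k)"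
      using e by simp_all
    have "\<exists>!\<chi>'. is_cell K \<chi>' H (hsrc K \<psi>) (vsrc K \<phi> \<bullet> h) (vtgt K \<phi> \<bullet> k) \<and> \<chi> = \<psi> \<cdot> \<chi>'"
      by (rule cartesian_ex1[OF \<psi> is_cell_self]) (use a e in simp_all)
    then obtain \<chi>1 where 1: "is_cell K \<chi>1 H (htgt K \<phi>) (vsrc K \<phi> \<bullet> h) (vtgt K \<phi> \<bullet> k)" "\<chi> = \<psi> \<cdot> \<chi>1"
      using e by auto
    have "\<exists>!\<chi>'. is_cell K \<chi>' H (hsrc K \<phi>) h k \<and> \<chi>1 = \<phi> \<cdot> \<chi>'"
      by (rule cartesian_ex1[OF \<phi> is_cell_self]) (use a e 1 in simp_all)
    then obtain \<chi>2 where 2: "is_cell K \<chi>2 H (hsrc K \<phi>) h k" "\<chi>1 = \<phi> \<cdot> \<chi>2"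
      by auto
    note s = is_cellD[OF 2(1)]
    show "\<exists>!\<chi>'. is_cell K \<chi>' H (hsrc K (\<psi> \<cdot> \<phi>)) h k \<and> \<chi> = (\<psi> \<cdot> \<phi>) \<cdot> \<chi>'"
    proof (rule ex1I[of _ \<chi>2])
      fix \<alpha> assume \<alpha>: "is_cell K \<alpha> H (hsrc K (\<psi> \<cdot> \<phi>)) h k \<and> \<chi> = (\<psi> \<cdot> \<phi>) \<cdot> \<alpha>"
      then have \<alpha>': "is_cell K \<alpha> H (hsrc K \<phi>) h k"
        using e by simp
      note t = is_cellD[OF \<alpha>']
      have "\<psi> \<cdot> \<phi> \<cdot> \<alpha> = \<psi> \<cdot> \<phi> \<cdot> \<chi>2"
        using \<alpha> 1 2 s t e by simp
      then have "\<phi> \<cdot> \<alpha> = \<phi> \<cdot> \<chi>2"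
        using cartesian_cancel[OF \<psi>, of "\<phi> \<cdot> \<alpha>" "\<phi> \<cdot> \<chi>2"] s t e by simp
      then show "\<alpha> = \<chi>2"
        using cartesian_cancel[OF \<phi>, of \<alpha> \<chi>2] s t by simp
    qed (use 1 2 e s in simp)
  qed (use e in simp)
qed

text \<open>A cell \<chi> out of the source of \<psi> is composed with \<phi> and factored through
  \<open>\<psi> \<cdot> \<phi>\<close>; afterwards \<phi> is cancelled because it is
  opcartesian.\<close>

lemma opcartesian_right_factor:
  assumes \<phi>: "is_opcartesian K \<phi>" and \<psi>\<phi>: "is_opcartesian K (\<psi> \<cdot> \<phi>)"
    and \<psi> [simp]: "\<psi> \<in> Cell K" and e: "hsrc K \<psi> = htgt K \<phi>"
  shows "is_opcartesian K \<psi>"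
proof -
  have c [simp]: "\<phi> \<in> Cell K"
    using \<phi> by (auto simp: is_opcartesian_def)
  show ?thesis
  proof (rule opcartesianI)
    fix \<chi> L h k
    assume a: "h \<in> Ver K" "vdom K h = hdom K (htgt K \<psi>)" "k \<in> Ver K" "vdom K k = hcod K (htgt K \<psi>)"
      "is_cell K \<chi> (hsrc K \<psi>) L (h \<bullet> vsrc K \<psi>) (k \<bullet> vtgt K \<psi>)"
    note s = is_cellD[OF a(5)]
    have "\<exists>!\<chi>'. is_cell K \<chi>' (htgt K (\<psi> \<cdot> \<phi>)) L h k \<and> \<chi> \<cdot> \<phi> = \<chi>' \<cdot> \<psi> \<cdot> \<phi>"
      by (rule opcartesian_ex1[OF \<psi>\<phi> is_cell_self])
        (use a(1-4) s e in \<open>simp_all add: is_cell_def\<close>)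
    then have "\<exists>!\<chi>'. is_cell K \<chi>' (htgt K \<psi>) L h k \<and> \<chi> \<cdot> \<phi> = \<chi>' \<cdot> \<psi> \<cdot> \<phi>"
      using e by simp
    then obtain \<chi>' where 1: "is_cell K \<chi>' (htgt K \<psi>) L h k" "\<chi> \<cdot> \<phi> = \<chi>' \<cdot> \<psi> \<cdot> \<phi>"
      and u: "\<And>\<alpha>. is_cell K \<alpha> (htgt K \<psi>) L h k \<Longrightarrow> \<chi> \<cdot> \<phi> = \<alpha> \<cdot> \<psi> \<cdot> \<phi> \<Longrightarrow> \<alpha> = \<chi>'"
      by blast
    note t = is_cellD[OF 1(1)]
    show "\<exists>!\<chi>'. is_cell K \<chi>' (htgt K \<psi>) L h k \<and> \<chi> = \<chi>' \<cdot> \<psi>"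
    proof (rule ex1I[of _ \<chi>'])
      have "\<chi> \<cdot> \<phi> = (\<chi>' \<cdot> \<psi>) \<cdot> \<phi>"
        using 1 t e by simp
      then have "\<chi> = \<chi>' \<cdot> \<psi>"
        using opcartesian_cancel[OF \<phi>, of \<chi> "\<chi>' \<cdot> \<psi>"] s t e by simp
      then show "is_cell K \<chi>' (htgt K \<psi>) L h k \<and> \<chi> = \<chi>' \<cdot> \<psi>"
        using 1 by simp
      fix \<alpha> assume \<alpha>: "is_cell K \<alpha> (htgt K \<psi>) L h k \<and> \<chi> = \<alpha> \<cdot> \<psi>"
      then show "\<alpha> = \<chi>'"
        using u[of \<alpha>] e is_cellD[of \<alpha> "htgt K \<psi>" L h k] by simp
    qed
  qed simp
qed

text \<open>Factor \<open>\<chi> \<cdot> \<beta>\<close> through \<phi> and compose with \<alpha>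
  again. The vertical boundary of \<alpha> is arbitrary, so \<alpha> may be the unit cell of an
  isomorphism of objects.\<close>

lemma opcartesian_ccomp_iso:
  assumes \<phi>: "is_opcartesian K \<phi>" and u: "\<alpha> \<in> Cell K" "\<beta> \<in> Cell K" "htgt K \<alpha> = hsrc K \<phi>"
      "htgt K \<beta> = hsrc K \<alpha>" "hsrc K \<beta> = hsrc K \<phi>"
    and 1: "\<alpha> \<cdot> \<beta> = cid K (hsrc K \<phi>)" "\<beta> \<cdot> \<alpha> = cid K (hsrc K \<alpha>)"
  shows "is_opcartesian K (\<phi> \<cdot> \<alpha>)"
proof -
  have c [simp]: "\<phi> \<in> Cell K"
    using \<phi> by (auto simp: is_opcartesian_def)
  note u [simp]
  \<comment> \<open>These are the vertical boundaries of the first inverse law; they give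
    \<open>\<chi> \<cdot> \<beta>\<close> the boundary needed to factor through \<phi>.\<close>
  have v: "vsrc K \<alpha> \<bullet> vsrc K \<beta> = vid K (hdom K (hsrc K \<phi>))" "vtgt K \<alpha> \<bullet> vtgt K \<beta> = vid K (hcod K (hsrc K \<phi>))"
    using ccomp_simps(4,5)[of \<beta> \<alpha>] 1(1) by simp_all
  show ?thesis
  proof (rule opcartesianI)
    fix \<chi> L h k
    assume "h \<in> Ver K" "vdom K h = hdom K (htgt K (\<phi> \<cdot> \<alpha>))" "k \<in> Ver K" "vdom K k = hcod K (htgt K (\<phi> \<cdot> \<alpha>))"
      "is_cell K \<chi> (hsrc K (\<phi> \<cdot> \<alpha>)) L (h \<bullet> vsrc K (\<phi> \<cdot> \<alpha>)) (k \<bullet> vtgt K (\<phi> \<cdot> \<alpha>))"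
    then have a: "h \<in> Ver K" "vdom K h = hdom K (htgt K \<phi>)" "k \<in> Ver K" "vdom K k = hcod K (htgt K \<phi>)"
      "is_cell K \<chi> (hsrc K \<alpha>) L (h \<bullet> vsrc K \<phi> \<bullet> vsrc K \<alpha>) (k \<bullet> vtgt K \<phi> \<bullet> vtgt K \<alpha>)"
      by simp_all
    note s = is_cellD[OF a(5)]
    have "\<exists>!\<chi>'. is_cell K \<chi>' (htgt K \<phi>) L h k \<and> \<chi> \<cdot> \<beta> = \<chi>' \<cdot> \<phi>"
      by (rule opcartesian_ex1[OF \<phi> is_cell_self])
        (use a(1-4) s v in \<open>simp_all add: is_cell_def\<close>)
    then obtain \<chi>' where 2: "is_cell K \<chi>' (htgt K \<phi>) L h k" "\<chi> \<cdot> \<beta> = \<chi>' \<cdot> \<phi>"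
      and w: "\<And>\<omega>. is_cell K \<omega> (htgt K \<phi>) L h k \<Longrightarrow> \<chi> \<cdot> \<beta> = \<omega> \<cdot> \<phi> \<Longrightarrow> \<omega> = \<chi>'"
      by blast
    note t = is_cellD[OF 2(1)]
    show "\<exists>!\<chi>'. is_cell K \<chi>' (htgt K (\<phi> \<cdot> \<alpha>)) L h k \<and> \<chi> = \<chi>' \<cdot> \<phi> \<cdot> \<alpha>"
    proof (rule ex1I[of _ \<chi>'])
      have "\<chi> = \<chi> \<cdot> \<beta> \<cdot> \<alpha>"
        using 1 s by simp
      also have "\<dots> = \<chi>' \<cdot> \<phi> \<cdot> \<alpha>"
        using ccomp_eq_assoc[OF 2(2), of \<alpha>] s t by simp
      finally show "is_cell K \<chi>' (htgt K (\<phi> \<cdot> \<alpha>)) L h k \<and> \<chi> = \<chi>' \<cdot> \<phi> \<cdot> \<alpha>"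
        using 2 by simp
      fix \<omega> assume \<omega>: "is_cell K \<omega> (htgt K (\<phi> \<cdot> \<alpha>)) L h k \<and> \<chi> = \<omega> \<cdot> \<phi> \<cdot> \<alpha>"
      then have o: "is_cell K \<omega> (htgt K \<phi>) L h k"
        by simp
      then show "\<omega> = \<chi>'"
        using w[of \<omega>] \<omega> is_cellD[OF o] 1 by simp
    qed
  qed simp
qed

lemma lunit_nat_assoc:
  assumes "\<phi> \<in> Cell K" "\<theta> \<in> Cell K" "htgt K \<theta> = hunit K (hdom K (hsrc K \<phi>)) \<odot> hsrc K \<phi>"
  shows "\<phi> \<cdot> lunit K (hsrc K \<phi>) \<cdot> \<theta> = lunit K (htgt K \<phi>) \<cdot> (cunit K (vsrc K \<phi>) \<Odot> \<phi>) \<cdot> \<theta>"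
  using ccomp_eq_assoc[OF lunit_nat[OF assms(1)], of \<theta>] assms by simp

lemma runit_nat_assoc:
  assumes "\<phi> \<in> Cell K" "\<theta> \<in> Cell K" "htgt K \<theta> = hsrc K \<phi> \<odot> hunit K (hcod K (hsrc K \<phi>))"
  shows "\<phi> \<cdot> runit K (hsrc K \<phi>) \<cdot> \<theta> = runit K (htgt K \<phi>) \<cdot> (\<phi> \<Odot> cunit K (vtgt K \<phi>)) \<cdot> \<theta>"
  using ccomp_eq_assoc[OF runit_nat[OF assms(1)], of \<theta>] assms by simp

section \<open>Companions and conjoints\<close>

lemma conjointD:
  assumes "is_conjoint K f F \<epsilon> \<eta>"
  shows "f \<in> Ver K" "F \<in> Hor K" "hdom K F = vcod K f" "hcod K F = vdom K f"
    "\<epsilon> \<in> Cell K" "hsrc K \<epsilon> = F" "htgt K \<epsilon> = hunit K (vcod K f)" "vsrc K \<epsilon> = vid K (vcod K f)" "vtgt K \<epsilon> = f"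
    "\<eta> \<in> Cell K" "hsrc K \<eta> = hunit K (vdom K f)" "htgt K \<eta> = F" "vsrc K \<eta> = f" "vtgt K \<eta> = vid K (vdom K f)"
    "\<epsilon> \<cdot> \<eta> = cunit K f" "lunit K F \<cdot> (\<epsilon> \<Odot> \<eta>) \<cdot> runit_inv F = cid K F"
  using assms unfolding is_conjoint_def is_cell_def is_hor_def by blast+

lemma companionD:
  assumes "is_companion K f F \<epsilon> \<eta>"
  shows "f \<in> Ver K" "F \<in> Hor K" "hdom K F = vdom K f" "hcod K F = vcod K f"
    "\<epsilon> \<in> Cell K" "hsrc K \<epsilon> = F" "htgt K \<epsilon> = hunit K (vcod K f)" "vsrc K \<epsilon> = f" "vtgt K \<epsilon> = vid K (vcod K f)"
    "\<eta> \<in> Cell K" "hsrc K \<eta> = hunit K (vdom K f)" "htgt K \<eta> = F" "vsrc K \<eta> = vid K (vdom K f)" "vtgt K \<eta> = f"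
    "\<epsilon> \<cdot> \<eta> = cunit K f" "runit K F \<cdot> (\<eta> \<Odot> \<epsilon>) \<cdot> lunit_inv F = cid K F"
  using assms unfolding is_companion_def is_cell_def is_hor_def by blast+

text \<open>Insert the second conjoint identity between \<rho> and \<beta>, then slide the unitors
  outwards by naturality. Apart from the vertical boundary, the left factor involves only
  \<open>\<epsilon> \<cdot> \<rho>\<close> and the right factor only
  \<open>\<beta> \<cdot> \<eta>\<close>.\<close>

lemma conjoint_expand:
  assumes F: "is_conjoint K f F \<epsilon> \<eta>" and c [simp]: "\<rho> \<in> Cell K" "htgt K \<rho> = F" "\<beta> \<in> Cell K" "hsrc K \<beta> = F"
  shows "\<beta> \<cdot> \<rho> = lunit K (htgt K \<beta>) \<cdot> ((cunit K (vsrc K \<beta>) \<cdot> \<epsilon> \<cdot> \<rho>) \<Odot> (\<beta> \<cdot> \<eta> \<cdot> cunit K (vtgt K \<rho>)))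
    \<cdot> runit_inv (hsrc K \<rho>)"
proof -
  note F' [simp] = conjointD[OF F]
  have "\<beta> \<cdot> \<rho> = \<beta> \<cdot> (lunit K F \<cdot> (\<epsilon> \<Odot> \<eta>) \<cdot> runit_inv F) \<cdot> \<rho>"
    by simp
  also have "\<dots> = \<beta> \<cdot> lunit K F \<cdot> (\<epsilon> \<Odot> \<eta>) \<cdot> (\<rho> \<Odot> cunit K (vtgt K \<rho>)) \<cdot> runit_inv (hsrc K \<rho>)"
    using runit_inv_nat[of \<rho>] by (simp del: F'(16))
  also have "\<dots> = lunit K (htgt K \<beta>) \<cdot> (cunit K (vsrc K \<beta>) \<Odot> \<beta>) \<cdot> (\<epsilon> \<Odot> \<eta>) \<cdot> (\<rho> \<Odot> cunit K (vtgt K \<rho>)) \<cdot> runit_inv (hsrc K \<rho>)"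
    using lunit_nat_assoc[of \<beta>] by simp
  finally show ?thesis
    by (simp add: interchange' interchange_assoc)
qed

lemma conjoint_eps_cartesian:
  assumes F: "is_conjoint K f F \<epsilon> \<eta>"
  shows "is_cartesian \<epsilon>"
proof (rule cartesianI)
  note F' [simp] = conjointD[OF F]
  show "\<epsilon> \<in> Cell K"
    by simp
  fix \<chi> H h k
  assume "h \<in> Ver K" "vcod K h = hdom K (hsrc K \<epsilon>)" "k \<in> Ver K" "vcod K k = hcod K (hsrc K \<epsilon>)"
    "is_cell K \<chi> H (htgt K \<epsilon>) (vsrc K \<epsilon> \<bullet> h) (vtgt K \<epsilon> \<bullet> k)"
  then have h [simp]: "h \<in> Ver K" "vcod K h = vcod K f" "k \<in> Ver K" "vcod K k = vdom K f"
    and "is_cell K \<chi> H (hunit K (vcod K f)) h (f \<bullet> k)"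
    by simp_all
  note \<chi> [simp] = is_cellD[OF this(5)]
  have k [simp]: "vdom K k = hcod K H"
    using \<chi>(12) h by (simp del: \<chi>(12))
  \<comment> \<open>The candidate factor: \<eta>, restricted along \<open>k\<close>, is attached to
    \<chi> on the right.\<close>
  define X where "X = lunit K F \<cdot> (\<chi> \<Odot> (\<eta> \<cdot> cunit K k)) \<cdot> runit_inv H"
  have X: "is_cell K X H F h k"
    by (simp add: X_def is_cell_def)
  \<comment> \<open>Interchange turns the right factor into
    \<open>\<epsilon> \<cdot> \<eta> \<cdot> cunit K k\<close>, a unit cell. The left and right
    unitors agree at a horizontal unit, so naturality of \<open>runit\<close> then leaves
    \<chi>.\<close>
  have "\<epsilon> \<cdot> X = runit K (htgt K \<chi>) \<cdot> (\<chi> \<Odot> cunit K (vtgt K \<chi>)) \<cdot> runit_inv H"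
    using lunit_nat_assoc[of \<epsilon> "(\<chi> \<Odot> (\<eta> \<cdot> cunit K k)) \<cdot> runit_inv H"] ccomp_eq_assoc[of \<epsilon> \<eta> "cunit K f" "cunit K k"]
    by (simp add: X_def interchange_assoc lunit_eq_runit cunit_ccomp)
  also have "\<dots> = \<chi>"
    using runit_nat_assoc[of \<chi> "runit_inv H"] by simp
  finally have e: "\<chi> = \<epsilon> \<cdot> X"
    by simp
  show "\<exists>!\<chi>'. is_cell K \<chi>' H (hsrc K \<epsilon>) h k \<and> \<chi> = \<epsilon> \<cdot> \<chi>'"
  proof (rule ex1I[of _ X])
    fix \<omega> assume o: "is_cell K \<omega> H (hsrc K \<epsilon>) h k \<and> \<chi> = \<epsilon> \<cdot> \<omega>"
    then have o': "is_cell K \<omega> H F h k"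
      by simp
    note [simp] = is_cellD[OF o']
    \<comment> \<open>With \<beta> an identity, the expansion formula recovers \<omega> from
      \<open>\<epsilon> \<cdot> \<omega>\<close>.\<close>
    show "\<omega> = X"
      using conjoint_expand[OF F, of \<omega> "cid K F"] o by (simp add: X_def)
  qed (use X e in simp)
qed

text \<open>The second companion identity whiskered with \<open>J\<close>. Naturality of the
  associator, the triangle axiom and its left-unit analogue \<open>l_tensor\<close> regroup the
  composite so that \<epsilon> acts on \<open>J\<close>.\<close>

lemma companion_zigzag:
  assumes F: "is_companion K f F \<epsilon> \<eta>" and J [simp]: "J \<in> Hor K" "hdom K J = vcod K f"
  shows "(cid K F \<Odot> lunit K J) \<cdot> (\<eta> \<Odot> (\<epsilon> \<Odot> cid K J)) \<cdot> lunit_inv (F \<odot> J) = cid K (F \<odot> J)"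
proof -
  note F' [simp] = companionD[OF F]
  let ?a = "asc K (hunit K (vdom K f)) F J"
  \<comment> \<open>By \<open>l_tensor\<close> the inverse unitor at \<open>F \<odot> J\<close> is
    the whiskered inverse unitor at \<open>F\<close> followed by the associator.\<close>
  have "?a \<cdot> (lunit_inv F \<Odot> cid K J) = lunit_inv (F \<odot> J) \<cdot> lunit K (F \<odot> J) \<cdot> ?a \<cdot> (lunit_inv F \<Odot> cid K J)"
    by (simp flip: ccomp_assoc')
  also have "lunit K (F \<odot> J) \<cdot> ?a \<cdot> (lunit_inv F \<Odot> cid K J) = (lunit K F \<Odot> cid K J) \<cdot> (lunit_inv F \<Odot> cid K J)"
    using ccomp_eq_assoc[OF l_tensor[of F "vdom K f" "vcod K f" J "hcod K J"], of "lunit_inv F \<Odot> cid K J"]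
    by (simp add: is_hor_def)
  also have "\<dots> = cid K (F \<odot> J)"
    by (simp add: interchange')
  finally have l: "lunit_inv (F \<odot> J) = ?a \<cdot> (lunit_inv F \<Odot> cid K J)"
    by simp
  have "(\<eta> \<Odot> (\<epsilon> \<Odot> cid K J)) \<cdot> lunit_inv (F \<odot> J)
      = asc K F (hunit K (vcod K f)) J \<cdot> ((\<eta> \<Odot> \<epsilon>) \<Odot> cid K J) \<cdot> (lunit_inv F \<Odot> cid K J)"
    using ccomp_eq_assoc[OF asc_nat[of \<eta> \<epsilon> "cid K J"], of "lunit_inv F \<Odot> cid K J"] l by simp
  then have "(cid K F \<Odot> lunit K J) \<cdot> (\<eta> \<Odot> (\<epsilon> \<Odot> cid K J)) \<cdot> lunit_inv (F \<odot> J)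
      = (runit K F \<Odot> cid K J) \<cdot> ((\<eta> \<Odot> \<epsilon>) \<Odot> cid K J) \<cdot> (lunit_inv F \<Odot> cid K J)"
    using ccomp_eq_assoc[OF triangle[of F "vdom K f" "vcod K f" J "hcod K J"],
        of "((\<eta> \<Odot> \<epsilon>) \<Odot> cid K J) \<cdot> (lunit_inv F \<Odot> cid K J)"]
    by (simp add: is_hor_def)
  then show ?thesis
    by (simp add: interchange')
qed

text \<open>Insert the zigzag identity after \<sigma> and slide the inverse unitor past \<sigma>: a
  cell into \<open>F \<odot> J\<close> is determined by its vertical source and its composite with
  \<open>lunit K J \<cdot> (\<epsilon> \<Odot> cid K J)\<close>.\<close>

lemma companion_expand:
  assumes F: "is_companion K f F \<epsilon> \<eta>" and J [simp]: "J \<in> Hor K" "hdom K J = vcod K f"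
    and s [simp]: "\<sigma> \<in> Cell K" "htgt K \<sigma> = F \<odot> J"
  shows "\<sigma> = ((\<eta> \<cdot> cunit K (vsrc K \<sigma>)) \<Odot> (lunit K J \<cdot> (\<epsilon> \<Odot> cid K J) \<cdot> \<sigma>)) \<cdot> lunit_inv (hsrc K \<sigma>)"
proof -
  note F' [simp] = companionD[OF F]
  have "\<sigma> = ((cid K F \<Odot> lunit K J) \<cdot> (\<eta> \<Odot> (\<epsilon> \<Odot> cid K J)) \<cdot> lunit_inv (F \<odot> J)) \<cdot> \<sigma>"
    by (simp add: companion_zigzag[OF F] del: ccomp_assoc')
  also have "\<dots> = (cid K F \<Odot> lunit K J) \<cdot> (\<eta> \<Odot> (\<epsilon> \<Odot> cid K J)) \<cdot> (cunit K (vsrc K \<sigma>) \<Odot> \<sigma>) \<cdot> lunit_inv (hsrc K \<sigma>)"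
    using lunit_inv_nat[of \<sigma>] by simp
  finally show ?thesis
    by (simp add: interchange_assoc)
qed

text \<open>\<open>F \<odot> J\<close> is the restriction of \<open>J\<close> along
  \<open>f\<close>. A factor is built by attaching \<eta> on the left, and
  \<open>companion_expand\<close> gives its uniqueness.\<close>

lemma companion_restriction_cartesian:
  assumes F: "is_companion K f F \<epsilon> \<eta>" and J [simp]: "J \<in> Hor K" "hdom K J = vcod K f"
  shows "is_cartesian (lunit K J \<cdot> (\<epsilon> \<Odot> cid K J))" (is "is_cartesian ?\<kappa>")
proof (rule cartesianI)
  note F' [simp] = companionD[OF F]
  have \<kappa>: "is_cell K ?\<kappa> (F \<odot> J) J f (vid K (hcod K J))"
    by (simp add: is_cell_def)
  note \<kappa>' = is_cellD(1-5)[OF this]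
  show "?\<kappa> \<in> Cell K"
    by (rule \<kappa>')
  fix \<chi> H h k
  assume "h \<in> Ver K" "vcod K h = hdom K (hsrc K ?\<kappa>)" "k \<in> Ver K" "vcod K k = hcod K (hsrc K ?\<kappa>)"
    "is_cell K \<chi> H (htgt K ?\<kappa>) (vsrc K ?\<kappa> \<bullet> h) (vtgt K ?\<kappa> \<bullet> k)"
  then have h [simp]: "h \<in> Ver K" "vcod K h = vdom K f" "k \<in> Ver K" "vcod K k = hcod K J"
    and "is_cell K \<chi> H J (f \<bullet> h) k"
    by (simp_all add: \<kappa>')
  note \<chi> [simp] = is_cellD[OF this(5)]
  have k [simp]: "vdom K h = hdom K H"
    using \<chi>(10) h by (simp del: \<chi>(10))
  define X where "X = ((\<eta> \<cdot> cunit K h) \<Odot> \<chi>) \<cdot> lunit_inv H"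
  have X: "is_cell K X H (F \<odot> J) h k"
    by (simp add: X_def is_cell_def)
  have "?\<kappa> \<cdot> X = lunit K (htgt K \<chi>) \<cdot> (cunit K (vsrc K \<chi>) \<Odot> \<chi>) \<cdot> lunit_inv H"
    using ccomp_eq_assoc[of \<epsilon> \<eta> "cunit K f" "cunit K h"]
    by (simp add: X_def interchange_assoc cunit_ccomp)
  also have "\<dots> = \<chi>"
    using lunit_nat_assoc[of \<chi> "lunit_inv H"] by simp
  finally have e: "\<chi> = ?\<kappa> \<cdot> X"
    by simp
  show "\<exists>!\<chi>'. is_cell K \<chi>' H (hsrc K ?\<kappa>) h k \<and> \<chi> = ?\<kappa> \<cdot> \<chi>'"
    unfolding \<kappa>'
  proof (rule ex1I[of _ X])
    fix \<omega> assume o: "is_cell K \<omega> H (F \<odot> J) h k \<and> \<chi> = ?\<kappa> \<cdot> \<omega>"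
    then have o': "is_cell K \<omega> H (F \<odot> J) h k"
      by simp
    note [simp] = is_cellD[OF o']
    show "\<omega> = X"
      using companion_expand[OF F J, of \<omega>] o by (simp add: X_def)
  qed (use X e in simp)
qed

text \<open>Attaching \<open>cunit K k \<cdot> \<epsilon>\<close> on the right is inverse to
  composing with \<eta>. The identity \<open>\<epsilon> \<cdot> \<eta> = cunit K f\<close> gives
  existence, the other companion identity uniqueness.\<close>

lemma companion_eta_opcartesian:
  assumes F: "is_companion K f F \<epsilon> \<eta>"
  shows "is_opcartesian K \<eta>"
proof (rule opcartesianI)
  note F' [simp] = companionD[OF F]
  show "\<eta> \<in> Cell K"
    by simp
  fix \<chi> L h k
  assume "h \<in> Ver K" "vdom K h = hdom K (htgt K \<eta>)" "k \<in> Ver K" "vdom K k = hcod K (htgt K \<eta>)"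
    "is_cell K \<chi> (hsrc K \<eta>) L (h \<bullet> vsrc K \<eta>) (k \<bullet> vtgt K \<eta>)"
  then have h [simp]: "h \<in> Ver K" "vdom K h = vdom K f" "k \<in> Ver K" "vdom K k = vcod K f"
    and "is_cell K \<chi> (hunit K (vdom K f)) L h (k \<bullet> f)"
    by simp_all
  note \<chi> [simp] = is_cellD[OF this(5)]
  have k [simp]: "vcod K k = hcod K L"
    using \<chi>(13) h by (simp del: \<chi>(13))
  define X where "X = runit K L \<cdot> (\<chi> \<Odot> (cunit K k \<cdot> \<epsilon>)) \<cdot> lunit_inv F"
  have X: "is_cell K X F L h k"
    by (simp add: X_def is_cell_def)
  have "X \<cdot> \<eta> = runit K (htgt K \<chi>) \<cdot> (\<chi> \<Odot> cunit K (vtgt K \<chi>)) \<cdot> runit_inv (hsrc K \<chi>)"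
    using lunit_inv_nat[of \<eta>, symmetric]
    by (simp add: X_def interchange_assoc lunit_eq_runit cunit_ccomp)
  also have "\<dots> = \<chi>"
    using runit_nat_assoc[of \<chi> "runit_inv (hsrc K \<chi>)"] by simp
  finally have e: "\<chi> = X \<cdot> \<eta>"
    by simp
  show "\<exists>!\<chi>'. is_cell K \<chi>' (htgt K \<eta>) L h k \<and> \<chi> = \<chi>' \<cdot> \<eta>"
  proof (rule ex1I[of _ X])
    fix \<omega> assume o: "is_cell K \<omega> (htgt K \<eta>) L h k \<and> \<chi> = \<omega> \<cdot> \<eta>"
    then have o': "is_cell K \<omega> F L h k"
      by simp
    note [simp] = is_cellD[OF o']
    have "\<omega> = \<omega> \<cdot> runit K F \<cdot> (\<eta> \<Odot> \<epsilon>) \<cdot> lunit_inv F"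
      by simp
    also have "\<dots> = runit K L \<cdot> (\<omega> \<Odot> cunit K k) \<cdot> (\<eta> \<Odot> \<epsilon>) \<cdot> lunit_inv F"
      using runit_nat_assoc[of \<omega> "(\<eta> \<Odot> \<epsilon>) \<cdot> lunit_inv F"] by simp
    also have "\<dots> = X"
      using o by (simp add: X_def interchange_assoc)
    finally show "\<omega> = X" .
  qed (use X e in simp)
qed

section \<open>Tabulations and comma objects\<close>

lemma comma_cone_V:
  assumes "f \<in> Ver K" "g \<in> Ver K" "vcod K f = E"
  shows "comma_cone (\<V> K) f g X a b \<phi> \<longleftrightarrow> X \<in> Obj K \<and> is_ver K a X (vdom K f) \<and> is_ver K b X (vdom K g) \<and>
     vcod K g = E \<and> is_cell K \<phi> (hunit K X) (hunit K E) (f \<bullet> a) (g \<bullet> b)"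
  using assms by (auto simp: comma_cone_def V_simps is_arr_V cell2_V vc_def is_ver_def)

lemma comma_factor_V:
  "comma_factor (\<V> K) P a b \<pi> X a' b' \<phi> u \<longleftrightarrow> is_ver K u X P \<and> a \<bullet> u = a' \<and> b \<bullet> u = b' \<and> \<pi> \<cdot> cunit K u = \<phi>"
  by (simp add: comma_factor_def V_simps is_arr_V whisker_right_def)

text \<open>The cell equation of the comma factorisation is that of the tabulation composed with
  \<kappa>, which can be cancelled. The two equations for the projections are the vertical source
  and target of \<open>\<tau> \<cdot> cunit K u = \<sigma>\<close>.\<close>

lemma comma_factor_iff_tab_factor:
  assumes \<kappa>: "is_cartesian \<kappa>" "is_cell K \<kappa> N (hunit K E) f g"
    and \<tau>: "\<tau> \<in> Cell K" "hsrc K \<tau> = hunit K T" "htgt K \<tau> = N" "T \<in> Obj K"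
    and \<sigma>: "is_cell K \<sigma> (hunit K X) N a b" "X \<in> Obj K"
  shows "comma_factor (\<V> K) T (vsrc K \<tau>) (vtgt K \<tau>) (\<kappa> \<cdot> \<tau>) X a b (\<kappa> \<cdot> \<sigma>) u \<longleftrightarrow> tab_factor K T \<tau> X \<sigma> u"
proof
  note [simp] = is_cellD[OF \<kappa>(2)] is_cellD[OF \<sigma>(1)] \<tau> \<sigma>(2)
  {
    assume "comma_factor (\<V> K) T (vsrc K \<tau>) (vtgt K \<tau>) (\<kappa> \<cdot> \<tau>) X a b (\<kappa> \<cdot> \<sigma>) u"
    then have u: "is_ver K u X T" "vsrc K \<tau> \<bullet> u = a" "vtgt K \<tau> \<bullet> u = b" "(\<kappa> \<cdot> \<tau>) \<cdot> cunit K u = \<kappa> \<cdot> \<sigma>"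
      by (simp_all add: comma_factor_V)
    then have [simp]: "u \<in> Ver K" "vdom K u = X" "vcod K u = T"
      by (simp_all add: is_ver_def)
    have "\<tau> \<cdot> cunit K u = \<sigma>"
      by (rule cartesian_cancel[OF \<kappa>(1)]) (use u in simp_all)
    then show "tab_factor K T \<tau> X \<sigma> u"
      using u by (simp add: tab_factor_def)
  next
    assume "tab_factor K T \<tau> X \<sigma> u"
    then have u: "is_ver K u X T" "\<tau> \<cdot> cunit K u = \<sigma>"
      by (simp_all add: tab_factor_def)
    then have [simp]: "u \<in> Ver K" "vdom K u = X" "vcod K u = T"
      by (simp_all add: is_ver_def)
    have "vsrc K \<tau> \<bullet> u = a" "vtgt K \<tau> \<bullet> u = b"
      using arg_cong[OF u(2), of "vsrc K"] arg_cong[OF u(2), of "vtgt K"] by simp_all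
    then show "comma_factor (\<V> K) T (vsrc K \<tau>) (vtgt K \<tau>) (\<kappa> \<cdot> \<tau>) X a b (\<kappa> \<cdot> \<sigma>) u"
      using u by (simp add: comma_factor_V)
  }
qed

lemma tabulation_ex1:
  assumes "is_tabulation K N T \<tau>" "X \<in> Obj K" "\<phi> \<in> Cell K" "hsrc K \<phi> = hunit K X" "htgt K \<phi> = N"
  shows "\<exists>!u. tab_factor K T \<tau> X \<phi> u"
  using assms unfolding is_tabulation_def by blast

text \<open>In \<V> the 2-cell of a cone is a cell into \<open>hunit K E\<close> with boundary
  \<open>f \<bullet> a\<close>, \<open>g \<bullet> b\<close>, which is what a cartesian \<kappa>
  factors. Cones on \<open>X\<close> thus correspond to cells from \<open>hunit K X\<close> to
  \<open>N\<close>.\<close>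

lemma cartesian_cone_ex1:
  assumes \<kappa>: "is_cartesian \<kappa>" "is_cell K \<kappa> N (hunit K E) f g" and E: "E \<in> Obj K"
    and c: "comma_cone (\<V> K) f g X a b \<phi>"
  shows "\<exists>!\<sigma>. is_cell K \<sigma> (hunit K X) N a b \<and> \<phi> = \<kappa> \<cdot> \<sigma>"
proof -
  note [simp] = is_cellD[OF \<kappa>(2)] E
  have "is_ver K a X (hdom K N)" "is_ver K b X (hcod K N)" "is_cell K \<phi> (hunit K X) (hunit K E) (f \<bullet> a) (g \<bullet> b)"
    using c comma_cone_V[of f g E] by auto
  then show ?thesis
    by (intro cartesian_ex1[OF \<kappa>]) (simp_all add: is_ver_def)
qed

text \<open>Cones are cells into \<open>N\<close> composed with \<kappa>, so the one-dimensional
  properties coincide. The two-dimensional property of the comma object is that of the tabulation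
  with the horizontal morphism taken to be a unit.\<close>

lemma tabulation_comma_object:
  assumes \<kappa>: "is_cartesian \<kappa>" "is_cell K \<kappa> N (hunit K E) f g" and E: "E \<in> Obj K"
    and T: "is_tabulation K N T \<tau>"
  shows "is_comma_object (\<V> K) f g T (vsrc K \<tau>) (vtgt K \<tau>) (\<kappa> \<cdot> \<tau>)"
proof -
  note \<kappa>' [simp] = is_cellD[OF \<kappa>(2)] and E [simp]
  have \<tau> [simp]: "\<tau> \<in> Cell K" "hsrc K \<tau> = hunit K T" "htgt K \<tau> = N" "T \<in> Obj K"
    using T by (simp_all add: is_tabulation_def)
  note cone = cartesian_cone_ex1[OF \<kappa> E]
  note fac = comma_factor_iff_tab_factor[OF \<kappa> \<tau>]
  have obj: "X \<in> Obj K" if "comma_cone (\<V> K) f g X a b \<phi>" for X a b \<phi>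
    using that by (simp add: comma_cone_def V_simps)
  have one: "\<exists>!u. comma_factor (\<V> K) T (vsrc K \<tau>) (vtgt K \<tau>) (\<kappa> \<cdot> \<tau>) X a b \<phi> u"
    if c: "comma_cone (\<V> K) f g X a b \<phi>" for X a b \<phi>
  proof -
    obtain \<sigma> where \<sigma>: "is_cell K \<sigma> (hunit K X) N a b" "\<phi> = \<kappa> \<cdot> \<sigma>"
      using cone[OF c] by blast
    show ?thesis
      using tabulation_ex1[OF T obj[OF c] is_cellD(1-3)[OF \<sigma>(1)]] fac[OF \<sigma>(1) obj[OF c]] \<sigma>(2) by simp
  qed
  have two: "\<exists>!\<xi>'. is_cell2 (\<V> K) \<xi>' u u' \<and> vsrc K \<tau> \<rhd>\<^bsub>\<V> K\<^esub> \<xi>' = \<xi>\<^sub>A \<and> vtgt K \<tau> \<rhd>\<^bsub>\<V> K\<^esub> \<xi>' = \<xi>\<^sub>B"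
    if c: "comma_cone (\<V> K) f g X a b \<phi>" "comma_cone (\<V> K) f g X a' b' \<psi>"
      and u: "comma_factor (\<V> K) T (vsrc K \<tau>) (vtgt K \<tau>) (\<kappa> \<cdot> \<tau>) X a b \<phi> u"
        "comma_factor (\<V> K) T (vsrc K \<tau>) (vtgt K \<tau>) (\<kappa> \<cdot> \<tau>) X a' b' \<psi> u'"
      and \<xi>: "is_cell2 (\<V> K) \<xi>\<^sub>A a a'" "is_cell2 (\<V> K) \<xi>\<^sub>B b b'"
      and e: "(f \<rhd>\<^bsub>\<V> K\<^esub> \<xi>\<^sub>A) \<Zcomp>\<^bsub>\<V> K\<^esub> \<psi> = \<phi> \<Zcomp>\<^bsub>\<V> K\<^esub> (g \<rhd>\<^bsub>\<V> K\<^esub> \<xi>\<^sub>B)"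
    for X a b \<phi> a' b' \<psi> u u' \<xi>\<^sub>A \<xi>\<^sub>B
  proof -
    have X [simp]: "X \<in> Obj K"
      by (rule obj[OF c(1)])
    obtain \<sigma> where \<sigma>: "is_cell K \<sigma> (hunit K X) N a b" "\<phi> = \<kappa> \<cdot> \<sigma>"
      using cone[OF c(1)] by blast
    obtain \<sigma>' where \<sigma>': "is_cell K \<sigma>' (hunit K X) N a' b'" "\<psi> = \<kappa> \<cdot> \<sigma>'"
      using cone[OF c(2)] by blast
    note [simp] = is_cellD[OF \<sigma>(1)] is_cellD[OF \<sigma>'(1)]
    have t: "tab_factor K T \<tau> X \<sigma> u" "tab_factor K T \<tau> X \<sigma>' u'"
      using u fac[OF \<sigma>(1) X] fac[OF \<sigma>'(1) X] \<sigma>(2) \<sigma>'(2) by simp_all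
    then have [simp]: "u \<in> Ver K" "vdom K u = X" "vcod K u = T" "u' \<in> Ver K" "vdom K u' = X" "vcod K u' = T"
      by (simp_all add: tab_factor_def is_ver_def)
    have \<xi>': "is_cell K \<xi>\<^sub>A (hunit K X) (hunit K (hdom K N)) a a'" "is_cell K \<xi>\<^sub>B (hunit K X) (hunit K (hcod K N)) b b'"
      using \<xi> by (simp_all add: cell2_V vc_def)
    note [simp] = is_cellD(1-5)[OF \<xi>'(1)] is_cellD(1-5)[OF \<xi>'(2)]
    have e': "lunit K (hunit K E) \<cdot> ((cunit K f \<cdot> \<xi>\<^sub>A) \<Odot> (\<kappa> \<cdot> \<sigma>')) \<cdot> lunit_inv (hunit K X)
        = lunit K (hunit K E) \<cdot> ((\<kappa> \<cdot> \<sigma>) \<Odot> (cunit K g \<cdot> \<xi>\<^sub>B)) \<cdot> lunit_inv (hunit K X)"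
      using e by (simp add: \<sigma>(2) \<sigma>'(2) vertical_2cat_def whisker_left_def)
    \<comment> \<open>The compatibility condition of the tabulation holds after composing with
      \<kappa>, where naturality of the unitors turns it into \<open>e'\<close>; then \<kappa> is
      cancelled.\<close>
    have "lunit K N \<cdot> (\<xi>\<^sub>A \<Odot> \<sigma>') \<cdot> runit_inv (hunit K X) = runit K N \<cdot> (\<sigma> \<Odot> \<xi>\<^sub>B) \<cdot> lunit_inv (hunit K X)"
      (is "?l = ?r")
    proof (rule cartesian_cancel[OF \<kappa>(1)])
      have "\<kappa> \<cdot> ?l = lunit K (hunit K E) \<cdot> ((cunit K f \<cdot> \<xi>\<^sub>A) \<Odot> (\<kappa> \<cdot> \<sigma>')) \<cdot> lunit_inv (hunit K X)"
        using lunit_nat_assoc[of \<kappa> "(\<xi>\<^sub>A \<Odot> \<sigma>') \<cdot> runit_inv (hunit K X)"]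
        by (simp add: interchange_assoc lunit_eq_runit)
      moreover have "\<kappa> \<cdot> ?r = lunit K (hunit K E) \<cdot> ((\<kappa> \<cdot> \<sigma>) \<Odot> (cunit K g \<cdot> \<xi>\<^sub>B)) \<cdot> lunit_inv (hunit K X)"
        using runit_nat_assoc[of \<kappa> "(\<sigma> \<Odot> \<xi>\<^sub>B) \<cdot> lunit_inv (hunit K X)"]
        by (simp add: interchange_assoc lunit_eq_runit)
      ultimately show "\<kappa> \<cdot> ?l = \<kappa> \<cdot> ?r"
        using e' by simp
    qed simp_all
    \<comment> \<open>The two-dimensional property for both objects equal to \<open>X\<close> and
      the horizontal morphism \<open>hunit K X\<close>.\<close>
    then have "\<exists>!\<xi>'. is_cell K \<xi>' (hunit K X) (hunit K T) u u' \<and>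
        cunit K (vsrc K \<tau>) \<cdot> \<xi>' = \<xi>\<^sub>A \<and> cunit K (vtgt K \<tau>) \<cdot> \<xi>' = \<xi>\<^sub>B"
      using T[unfolded is_tabulation_def, THEN conjunct2, THEN conjunct2, THEN conjunct2, THEN conjunct2,
          THEN conjunct2, THEN conjunct2, rule_format, of X \<sigma> X \<sigma>' u u' "hunit K X" \<xi>\<^sub>A \<xi>\<^sub>B] \<xi>' t
      by (simp add: is_hor_def)
    then show ?thesis
      by (simp add: cell2_V vc_def whisker_left_def V_simps is_ver_def)
  qed
  have "comma_cone (\<V> K) f g T (vsrc K \<tau>) (vtgt K \<tau>) (\<kappa> \<cdot> \<tau>)"
    by (simp add: comma_cone_V[of f g E] is_ver_def is_cell_def)
  note cone_\<tau> = this
  show ?thesis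
    unfolding is_comma_object_def
  proof (intro conjI allI impI, goal_cases)
    case (6 X a b \<phi> a' b' \<psi> u u' \<xi>\<^sub>A \<xi>\<^sub>B)
    then show ?case
      by (elim conjE) (rule two)
  qed (use cone_\<tau> one in \<open>simp_all add: V_simps\<close>)
qed

text \<open>Transferred along \<kappa>, the universal property of \<open>P\<close> gives an
  isomorphism \<open>u\<close> from \<open>P\<close> to the tabulation \<open>T\<close> with
  \<open>\<tau> \<cdot> cunit K u = \<sigma>\<close>. Precomposing the opcartesian \<tau> with the
  invertible cell \<open>cunit K u\<close> keeps it opcartesian.\<close>

lemma comma_object_opcartesian:
  assumes \<kappa>: "is_cartesian \<kappa>" "is_cell K \<kappa> N (hunit K E) f g" and E: "E \<in> Obj K"
    and T: "is_tabulation K N T \<tau>" "is_opcartesian K \<tau>"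
    and P: "is_comma_object (\<V> K) f g P a b \<pi>"
  shows "\<exists>\<sigma>. is_cell K \<sigma> (hunit K P) N a b \<and> \<pi> = \<kappa> \<cdot> \<sigma> \<and> is_opcartesian K \<sigma>"
proof -
  note \<kappa>' [simp] = is_cellD[OF \<kappa>(2)] and E [simp]
  have \<tau> [simp]: "\<tau> \<in> Cell K" "hsrc K \<tau> = hunit K T" "htgt K \<tau> = N" "T \<in> Obj K"
    using T by (simp_all add: is_tabulation_def)
  have c: "comma_cone (\<V> K) f g P a b \<pi>"
    using P by (simp add: is_comma_object_def)
  then have P' [simp]: "P \<in> Obj K"
    by (simp add: comma_cone_def V_simps)
  obtain \<sigma> where \<sigma>: "is_cell K \<sigma> (hunit K P) N a b" "\<pi> = \<kappa> \<cdot> \<sigma>"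
    using cartesian_cone_ex1[OF \<kappa> E c] by blast
  note \<sigma>' [simp] = is_cellD[OF \<sigma>(1)]
  have fac: "comma_factor (\<V> K) P a b \<pi> X a' b' (\<kappa> \<cdot> \<rho>) w \<longleftrightarrow> tab_factor K P \<sigma> X \<rho> w"
    if "is_cell K \<rho> (hunit K X) N a' b'" "X \<in> Obj K" for X a' b' \<rho> w
    using comma_factor_iff_tab_factor[OF \<kappa>, of \<sigma> P \<rho> X a' b' w] that \<sigma>(2) by simp
  have com: "\<exists>!w. comma_factor (\<V> K) P a b \<pi> X a' b' \<phi> w" if "comma_cone (\<V> K) f g X a' b' \<phi>" for X a' b' \<phi>
    using P that unfolding is_comma_object_def by blast
  \<comment> \<open>Thus \<sigma> has the one-dimensional property of a tabulation of
    \<open>N\<close>.\<close>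
  have uni: "\<exists>!w. tab_factor K P \<sigma> X \<rho> w" if \<rho>: "is_cell K \<rho> (hunit K X) N a' b'" "X \<in> Obj K" for X a' b' \<rho>
  proof -
    note [simp] = is_cellD[OF \<rho>(1)] \<rho>(2)
    have "comma_cone (\<V> K) f g X a' b' (\<kappa> \<cdot> \<rho>)"
      by (simp add: comma_cone_V[of f g E] is_ver_def is_cell_def)
    from com[OF this] show ?thesis
      by (simp add: fac[OF \<rho>])
  qed
  have \<tau>c: "is_cell K \<tau> (hunit K T) N (vsrc K \<tau>) (vtgt K \<tau>)"
    by (simp add: is_cell_def)
  obtain u where u: "tab_factor K T \<tau> P \<sigma> u"
    using tabulation_ex1[OF T(1) P', of \<sigma>] by auto
  obtain v where v: "tab_factor K P \<sigma> T \<tau> v"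
    using uni[OF \<tau>c] by auto
  have [simp]: "u \<in> Ver K" "vdom K u = P" "vcod K u = T" "v \<in> Ver K" "vdom K v = T" "vcod K v = P"
    using u v by (simp_all add: tab_factor_def is_ver_def)
  have e: "\<tau> \<cdot> cunit K u = \<sigma>" "\<sigma> \<cdot> cunit K v = \<tau>"
    using u v by (simp_all add: tab_factor_def)
  \<comment> \<open>Both \<open>v \<bullet> u\<close> and the identity factor \<sigma> through
    itself, hence they are equal; likewise for \<tau> below.\<close>
  have "tab_factor K P \<sigma> P \<sigma> (v \<bullet> u)" "tab_factor K P \<sigma> P \<sigma> (vid K P)"
    using ccomp_eq_assoc[OF e(2), of "cunit K u"] e(1) by (simp_all add: tab_factor_def is_ver_def flip: cunit_ccomp)
  then have vu: "v \<bullet> u = vid K P"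
    using uni[OF \<sigma>(1) P'] by blast
  have "tab_factor K T \<tau> T \<tau> (u \<bullet> v)" "tab_factor K T \<tau> T \<tau> (vid K T)"
    using ccomp_eq_assoc[OF e(1), of "cunit K v"] e(2) by (simp_all add: tab_factor_def is_ver_def flip: cunit_ccomp)
  then have uv: "u \<bullet> v = vid K T"
    using tabulation_ex1[OF T(1) \<tau>(4) \<tau>(1,2,3)] by blast
  have "is_opcartesian K (\<tau> \<cdot> cunit K u)"
    by (rule opcartesian_ccomp_iso[OF T(2), of _ "cunit K v"]) (simp_all add: cunit_ccomp uv vu)
  then show ?thesis
    using \<sigma> e(1) by auto
qed

text \<open>Expanding \<sigma> at the companion and then \<open>\<beta> \<cdot> \<rho>\<close> at
  the conjoint rewrites a double-categorical composite as a composite in \<V> of three whiskered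
  2-cells: \<open>\<chi> \<cdot> \<eta>\<close>, the comma 2-cell, and
  \<open>\<beta> \<cdot> \<eta>'\<close>.\<close>

lemma companion_conjoint_expand:
  assumes F: "is_companion K f F \<epsilon> \<eta>" and G: "is_conjoint K j G \<epsilon>' \<eta>'" and fj: "vcod K f = vcod K j"
    and \<sigma> [simp]: "\<sigma> \<in> Cell K" "hsrc K \<sigma> = hunit K P" "htgt K \<sigma> = F \<odot> G" "P \<in> Obj K"
    and \<chi> [simp]: "\<chi> \<in> Cell K" "hsrc K \<chi> = F" "htgt K \<chi> = hunit K M" "vtgt K \<chi> = r"
    and \<beta> [simp]: "\<beta> \<in> Cell K" "hsrc K \<beta> = G" "htgt K \<beta> = hunit K M" "vsrc K \<beta> = r"
    and M [simp]: "M \<in> Obj K"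
  shows "(lam M \<cdot> (\<chi> \<Odot> \<beta>)) \<cdot> \<sigma> = vv ((\<chi> \<cdot> \<eta>) \<cdot> cunit K (vsrc K \<sigma>))
    (vv (cunit K r \<cdot> (\<epsilon>' \<cdot> lunit K G \<cdot> (\<epsilon> \<Odot> cid K G)) \<cdot> \<sigma>) ((\<beta> \<cdot> \<eta>') \<cdot> cunit K (vtgt K \<sigma>)) P M) P M"
proof -
  note F' [simp] = companionD[OF F] and G' [simp] = conjointD[OF G] and fj [simp]
  have [simp]: "r \<in> Ver K" "vdom K r = vcod K j" "vcod K r = M"
    using cell_simps[OF \<beta>(1)] by simp_all
  \<comment> \<open>By \<open>companion_expand\<close>, \<rho> is the right factor of \<sigma>; it
    lands in the conjoint \<open>G\<close>, where \<open>conjoint_expand\<close> applies.\<close>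
  define \<rho> where "\<rho> = lunit K G \<cdot> (\<epsilon> \<Odot> cid K G) \<cdot> \<sigma>"
  have "is_cell K \<rho> (hunit K P) G (f \<bullet> vsrc K \<sigma>) (vtgt K \<sigma>)"
    by (simp add: \<rho>_def is_cell_def)
  note \<rho> [simp] = is_cellD(1-5)[OF this]
  have b: "\<beta> \<cdot> \<rho> = vv (cunit K r \<cdot> \<epsilon>' \<cdot> \<rho>) (\<beta> \<cdot> \<eta>' \<cdot> cunit K (vtgt K \<sigma>)) P M"
    using conjoint_expand[OF G, of \<rho> \<beta>] by (simp add: vv_def lunit_eq_runit)
  have "(\<chi> \<Odot> \<beta>) \<cdot> \<sigma> = (\<chi> \<Odot> \<beta>) \<cdot> ((\<eta> \<cdot> cunit K (vsrc K \<sigma>)) \<Odot> \<rho>) \<cdot> lunit_inv (hunit K P)"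
    using companion_expand[OF F, of G \<sigma>] by (simp add: \<rho>_def)
  also have "\<dots> = ((\<chi> \<cdot> \<eta> \<cdot> cunit K (vsrc K \<sigma>)) \<Odot> (\<beta> \<cdot> \<rho>)) \<cdot> lunit_inv (hunit K P)"
    by (simp add: interchange_assoc)
  finally show ?thesis
    unfolding b by (simp add: vv_def \<rho>_def)
qed

text \<open>\<open>H\<close> is a retract of \<open>F \<odot> G\<close> by cells \<open>n\<close>,
  \<open>m\<close>, and whiskering with \<open>J\<close> preserves the retraction. As
  \<open>m\<close> is built from \<open>t\<close>, the composite
  \<open>\<omega> \<cdot> (m \<Odot> cid K J)\<close> depends only on
  \<open>\<omega> \<cdot> (t \<Odot> cid K J)\<close>.\<close>

lemma opcartesian_whisker_cancel:
  assumes t: "is_opcartesian K t" "is_cell K t G H p (vid K E)"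
    and F: "is_conjoint K p F \<epsilon> \<eta>" and J [simp]: "J \<in> Hor K" "hdom K J = E" "E \<in> Obj K"
    and c: "is_cell K \<alpha> (H \<odot> J) L s k" "is_cell K \<beta> (H \<odot> J) L s k"
    and e: "\<alpha> \<cdot> (t \<Odot> cid K J) = \<beta> \<cdot> (t \<Odot> cid K J)"
  shows "\<alpha> = \<beta>"
proof -
  note F' [simp] = conjointD[OF F]
  note t' = is_cellD[OF t(2)]
  have [simp]: "hcod K G = E" "hcod K H = E" "hdom K G = vdom K p" "hdom K H = vcod K p"
    using t'(6,10-13) by simp_all
  note [simp] = t'(1-7)
  define m where "m = lunit K H \<cdot> (\<epsilon> \<Odot> t)"
  have "is_cell K m (F \<odot> G) H (vid K (vcod K p)) (vid K E)"
    by (simp add: m_def is_cell_def)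
  note m [simp] = is_cellD(1-5)[OF this]
  \<comment> \<open>The section \<open>n\<close> comes from opcartesianness of \<open>t\<close>,
    applied to \<open>G\<close> with the conjoint unit attached on the left.\<close>
  have "\<exists>!n. is_cell K n H (F \<odot> G) (vid K (vcod K p)) (vid K E) \<and> (\<eta> \<Odot> cid K G) \<cdot> lunit_inv G = n \<cdot> t"
    by (rule opcartesian_ex1[OF t]) (simp_all add: is_cell_def)
  then obtain n where n: "is_cell K n H (F \<odot> G) (vid K (vcod K p)) (vid K E)"
    and nt: "n \<cdot> t = (\<eta> \<Odot> cid K G) \<cdot> lunit_inv G"
    by (metis (no_types))
  note [simp] = is_cellD(1-5)[OF n]
  \<comment> \<open>After composing with \<open>t\<close>, interchange produces
    \<open>\<epsilon> \<cdot> \<eta>\<close> on the left, a unit cell, and only \<open>t\<close>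
    remains.\<close>
  have "m \<cdot> n = cid K H"
  proof (rule opcartesian_cancel[OF t(1)])
    have "(m \<cdot> n) \<cdot> t = lunit K (htgt K t) \<cdot> (cunit K (vsrc K t) \<Odot> t) \<cdot> lunit_inv G"
      using nt by (simp add: m_def interchange_assoc)
    also have "\<dots> = t"
      using lunit_nat_assoc[of t "lunit_inv G"] by simp
    finally show "(m \<cdot> n) \<cdot> t = cid K H \<cdot> t"
      by simp
  qed simp_all
  then have mn: "(m \<Odot> cid K J) \<cdot> (n \<Odot> cid K J) = cid K (H \<odot> J)"
    by (simp add: interchange')
  \<comment> \<open>The associator and \<open>l_tensor\<close> bring \<open>J\<close> next to
    \<open>t\<close>, and naturality of \<open>lunit\<close> brings \<omega> onto
    \<open>t \<Odot> cid K J\<close>.\<close>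
  have *: "\<omega> \<cdot> (m \<Odot> cid K J) = lunit K L \<cdot> ((cunit K s \<cdot> \<epsilon>) \<Odot> (\<omega> \<cdot> (t \<Odot> cid K J))) \<cdot> asc K F G J"
    if \<omega>: "is_cell K \<omega> (H \<odot> J) L s k" for \<omega>
  proof -
    note [simp] = is_cellD[OF \<omega>]
    have "m \<Odot> cid K J = (lunit K H \<Odot> cid K J) \<cdot> ((\<epsilon> \<Odot> t) \<Odot> cid K J)"
      by (simp add: m_def interchange')
    also have "\<dots> = lunit K (H \<odot> J) \<cdot> asc K (hunit K (vcod K p)) H J \<cdot> ((\<epsilon> \<Odot> t) \<Odot> cid K J)"
      using ccomp_eq_assoc[OF l_tensor[of H "vcod K p" E J "hcod K J"], of "(\<epsilon> \<Odot> t) \<Odot> cid K J"]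
      by (simp add: is_hor_def)
    also have "\<dots> = lunit K (H \<odot> J) \<cdot> (\<epsilon> \<Odot> (t \<Odot> cid K J)) \<cdot> asc K F G J"
      using asc_nat[of \<epsilon> t "cid K J"] by simp
    finally have "\<omega> \<cdot> (m \<Odot> cid K J) = \<omega> \<cdot> lunit K (H \<odot> J) \<cdot> (\<epsilon> \<Odot> (t \<Odot> cid K J)) \<cdot> asc K F G J"
      by simp
    also have "\<dots> = lunit K L \<cdot> (cunit K s \<Odot> \<omega>) \<cdot> (\<epsilon> \<Odot> (t \<Odot> cid K J)) \<cdot> asc K F G J"
      using lunit_nat_assoc[of \<omega> "(\<epsilon> \<Odot> (t \<Odot> cid K J)) \<cdot> asc K F G J"] by simp
    finally show ?thesis
      by (simp add: interchange_assoc)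
  qed
  have "\<omega> = (\<omega> \<cdot> (m \<Odot> cid K J)) \<cdot> (n \<Odot> cid K J)" if "is_cell K \<omega> (H \<odot> J) L s k" for \<omega>
    using is_cellD[OF that] mn by simp
  from this[OF c(1)] this[OF c(2)] show ?thesis
    using *[OF c(1)] *[OF c(2)] e by metis
qed

section \<open>Kan extensions along companions\<close>

text \<open>The pointwise condition at a single \<open>H\<close>, isolated so that it can be
  compared between companions and general horizontal morphisms. The roles of \<open>r\<close> and
  \<open>d\<close> are played by the vertical source and target of \<beta>.\<close>

definition ran_lifts :: "'h \<Rightarrow> 'c \<Rightarrow> 'o \<Rightarrow> 'h \<Rightarrow> bool" where
  "ran_lifts J \<beta> M H \<longleftrightarrow>
     (\<forall>s \<phi>. is_ver K s (hdom K H) M \<and> is_cell K \<phi> (H \<odot> J) (hunit K M) s (vtgt K \<beta>)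
        \<longrightarrow> (\<exists>!\<chi>. is_cell K \<chi> H (hunit K M) s (vsrc K \<beta>) \<and> \<phi> = lam M \<cdot> (\<chi> \<Odot> \<beta>)))"

text \<open>Composition with the opcartesian \<sigma> matches the cells to be lifted, composition
  with the opcartesian \<eta> matches their lifts, and \<open>companion_conjoint_expand\<close>
  matches the two lifting equations.\<close>

lemma ran_lifts_companion_iff:
  assumes F: "is_companion K f F \<epsilon> \<eta>" and G: "is_conjoint K j G \<epsilon>' \<eta>'" and fj: "vcod K f = vcod K j"
    and \<beta>: "is_cell K \<beta> G (hunit K M) r d" and M: "M \<in> Obj K"
    and \<sigma>: "is_cell K \<sigma> (hunit K P) (F \<odot> G) a b" "is_opcartesian K \<sigma>" and P: "P \<in> Obj K"
    and \<pi>: "\<pi> = (\<epsilon>' \<cdot> lunit K G \<cdot> (\<epsilon> \<Odot> cid K G)) \<cdot> \<sigma>"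
  shows "defines_ran (\<V> K) a (d \<bullet> b) (r \<bullet> f)
      (vv (cunit K r \<cdot> \<pi>) ((\<beta> \<cdot> \<eta>') \<cdot> cunit K b) P M) \<longleftrightarrow> ran_lifts G \<beta> M F" (is "defines_ran _ _ _ _ ?E \<longleftrightarrow> _")
proof -
  note F' [simp] = companionD[OF F] and G' [simp] = conjointD[OF G] and fj [simp] and M [simp] and P [simp]
  note \<beta>' [simp] = is_cellD(1-5,8,9)[OF \<beta>] and \<sigma>' [simp] = is_cellD(1-5,8,9)[OF \<sigma>(1)]
  have [simp]: "vdom K r = vcod K j" "vcod K r = M" "vdom K d = vdom K j" "vcod K d = M"
    using is_cellD(10-13)[OF \<beta>] by simp_all
  have [simp]: "vdom K a = P" "vcod K a = vdom K f" "vdom K b = P" "vcod K b = vdom K j"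
    using is_cellD(10-13)[OF \<sigma>(1)] by simp_all
  have \<pi>': "is_cell K \<pi> (hunit K P) (hunit K (vcod K j)) (f \<bullet> a) (j \<bullet> b)"
    by (simp add: \<pi> is_cell_def)
  note [simp] = is_cellD(1-5)[OF \<pi>']
  have E: "vc ?E (r \<bullet> f \<bullet> a) (d \<bullet> b) P M"
    by (rule vv[of _ _ "r \<bullet> j \<bullet> b"]) (simp_all add: vc_def is_ver_def is_cell_def)
  have expand: "(lam M \<cdot> (\<chi> \<Odot> \<beta>)) \<cdot> \<sigma> = vv ((\<chi> \<cdot> \<eta>) \<cdot> cunit K a) ?E P M"
    if "is_cell K \<chi> F (hunit K M) s r" for \<chi> s
    using companion_conjoint_expand[OF F G fj, of \<sigma> P \<chi> M r \<beta>] is_cellD[OF that] by (simp add: \<pi> del: ccomp_assoc')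
  have eta: "is_opcartesian K \<eta>"
    by (rule companion_eta_opcartesian[OF F])
  have \<phi>\<sigma>: "is_cell K (\<phi> \<cdot> \<sigma>) (hunit K P) (hunit K M) (s \<bullet> a) (d \<bullet> b)"
    if "is_cell K \<phi> (F \<odot> G) (hunit K M) s d" for \<phi> s
    using is_cellD[OF that] by (simp add: is_cell_def)
  have \<chi>\<eta>: "is_cell K (\<chi> \<cdot> \<eta>) (hunit K (vdom K f)) (hunit K M) s (r \<bullet> f)"
    if "is_cell K \<chi> F (hunit K M) s r" for \<chi> s
    using is_cellD[OF that] by (simp add: is_cell_def)
  have \<chi>\<beta>: "is_cell K (lam M \<cdot> (\<chi> \<Odot> \<beta>)) (F \<odot> G) (hunit K M) s d"
    if "is_cell K \<chi> F (hunit K M) s r" for \<chi> s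
    using is_cellD[OF that] by (simp add: is_cell_def)
  \<comment> \<open>Opcartesianness of \<sigma> and, next, of \<eta> makes both translations
    bijective.\<close>
  have restrict: "\<exists>!\<phi>. is_cell K \<phi> (F \<odot> G) (hunit K M) s d \<and> \<psi> = \<phi> \<cdot> \<sigma>"
    if "is_ver K s (vdom K f) M" "is_cell K \<psi> (hunit K P) (hunit K M) (s \<bullet> a) (d \<bullet> b)" for s \<psi>
    by (rule opcartesian_ex1[OF \<sigma>(2,1)]) (use that in \<open>simp_all add: is_ver_def\<close>)
  have restrict_\<eta>: "\<exists>!\<chi>. is_cell K \<chi> F (hunit K M) s r \<and> \<psi> = \<chi> \<cdot> \<eta>"
    if "is_ver K s (vdom K f) M" "is_cell K \<psi> (hunit K (vdom K f)) (hunit K M) s (r \<bullet> f)" for s \<psi>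
    by (rule opcartesian_ex1[OF eta is_cell_self, simplified]) (use that in \<open>simp_all add: is_ver_def\<close>)
  \<comment> \<open>For a fixed \<phi>, cancelling \<sigma> identifies the equations, and reindexing
    along composition with \<eta> identifies the lifts.\<close>
  have lift_iff: "(\<exists>!\<psi>. is_cell K \<psi> (hunit K (vdom K f)) (hunit K M) s (r \<bullet> f) \<and> \<phi> \<cdot> \<sigma> = vv (\<psi> \<cdot> cunit K a) ?E P M)
      \<longleftrightarrow> (\<exists>!\<chi>. is_cell K \<chi> F (hunit K M) s r \<and> \<phi> = lam M \<cdot> (\<chi> \<Odot> \<beta>))" (is "?A \<longleftrightarrow> ?B")
    if s: "is_ver K s (vdom K f) M" and \<phi>: "is_cell K \<phi> (F \<odot> G) (hunit K M) s d" for s \<phi>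
  proof -
    have eq: "\<phi> \<cdot> \<sigma> = vv ((\<chi> \<cdot> \<eta>) \<cdot> cunit K a) ?E P M \<longleftrightarrow> \<phi> = lam M \<cdot> (\<chi> \<Odot> \<beta>)"
      if \<chi>: "is_cell K \<chi> F (hunit K M) s r" for \<chi>
    proof
      assume "\<phi> \<cdot> \<sigma> = vv ((\<chi> \<cdot> \<eta>) \<cdot> cunit K a) ?E P M"
      then show "\<phi> = lam M \<cdot> (\<chi> \<Odot> \<beta>)"
        using opcartesian_cancel[OF \<sigma>(2), of \<phi> "lam M \<cdot> (\<chi> \<Odot> \<beta>)"] expand[OF \<chi>]
          is_cellD(1-5)[OF \<phi>] is_cellD(1-5)[OF \<chi>\<beta>[OF \<chi>]] by (simp del: ccomp_assoc')
    qed (use expand[OF \<chi>] in simp)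
    have "?A \<longleftrightarrow> (\<exists>!\<chi>. is_cell K \<chi> F (hunit K M) s r \<and> \<phi> \<cdot> \<sigma> = vv ((\<chi> \<cdot> \<eta>) \<cdot> cunit K a) ?E P M)"
      by (rule ex1_reindex) (use \<chi>\<eta> restrict_\<eta>[OF s] in blast)+
    then show ?thesis
      using eq by (simp cong: conj_cong)
  qed
  have V_lift: "(\<exists>!\<psi>'. is_cell2 (\<V> K) \<psi>' s (r \<bullet> f) \<and> \<psi> = (\<psi>' \<lhd>\<^bsub>\<V> K\<^esub> a) \<Zcomp>\<^bsub>\<V> K\<^esub> ?E) \<longleftrightarrow>
      (\<exists>!\<psi>'. is_cell K \<psi>' (hunit K (vdom K f)) (hunit K M) s (r \<bullet> f) \<and> \<psi> = vv (\<psi>' \<cdot> cunit K a) ?E P M)"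
    if s: "is_ver K s (vdom K f) M" for s \<psi>
  proof -
    have "is_cell2 (\<V> K) \<psi>' s (r \<bullet> f) \<longleftrightarrow> is_cell K \<psi>' (hunit K (vdom K f)) (hunit K M) s (r \<bullet> f)" for \<psi>'
      using s by (simp add: cell2_V vc_def is_ver_def)
    moreover have "(\<psi>' \<lhd>\<^bsub>\<V> K\<^esub> a) \<Zcomp>\<^bsub>\<V> K\<^esub> ?E = vv (\<psi>' \<cdot> cunit K a) ?E P M"
      if "is_cell K \<psi>' (hunit K (vdom K f)) (hunit K M) s (r \<bullet> f)" for \<psi>'
      unfolding whisker_right_def V_simps
      by (rule vcomp2_V[of _ "s \<bullet> a" "(r \<bullet> f) \<bullet> a"])
        (use is_cellD[OF that] s in \<open>simp add: vc_def is_ver_def is_cell_def\<close>)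
    ultimately show ?thesis
      by (simp cong: conj_cong)
  qed
  have V_cell: "is_cell2 (\<V> K) \<psi> (s \<bullet> a) (d \<bullet> b) \<longleftrightarrow> is_cell K \<psi> (hunit K P) (hunit K M) (s \<bullet> a) (d \<bullet> b)"
    if "is_ver K s (vdom K f) M" for s \<psi>
    using that by (simp add: cell2_V vc_def is_ver_def)
  have "defines_ran (\<V> K) a (d \<bullet> b) (r \<bullet> f) ?E \<longleftrightarrow>
    (\<forall>s \<psi>. is_ver K s (vdom K f) M \<and> is_cell2 (\<V> K) \<psi> (s \<bullet> a) (d \<bullet> b) \<longrightarrow>
      (\<exists>!\<psi>'. is_cell2 (\<V> K) \<psi>' s (r \<bullet> f) \<and> \<psi> = (\<psi>' \<lhd>\<^bsub>\<V> K\<^esub> a) \<Zcomp>\<^bsub>\<V> K\<^esub> ?E))"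
    using cell2_V'[OF E] by (simp add: defines_ran_def is_arr_V is_ver_def V_simps)
  also have "\<dots> \<longleftrightarrow>
    (\<forall>s \<psi>. is_ver K s (vdom K f) M \<and> is_cell K \<psi> (hunit K P) (hunit K M) (s \<bullet> a) (d \<bullet> b) \<longrightarrow>
      (\<exists>!\<psi>'. is_cell K \<psi>' (hunit K (vdom K f)) (hunit K M) s (r \<bullet> f) \<and> \<psi> = vv (\<psi>' \<cdot> cunit K a) ?E P M))"
    using V_cell V_lift by (simp cong: conj_cong)
  \<comment> \<open>Quantifying over \<psi> amounts to quantifying over \<phi>, since each \<psi>
    has the form \<open>\<phi> \<cdot> \<sigma>\<close>.\<close>
  also have "\<dots> \<longleftrightarrow> (\<forall>s \<phi>. is_ver K s (vdom K f) M \<and> is_cell K \<phi> (F \<odot> G) (hunit K M) s d \<longrightarrow>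
      (\<exists>!\<psi>'. is_cell K \<psi>' (hunit K (vdom K f)) (hunit K M) s (r \<bullet> f) \<and> \<phi> \<cdot> \<sigma> = vv (\<psi>' \<cdot> cunit K a) ?E P M))"
    (is "(\<forall>s \<psi>. _ \<longrightarrow> ?P s \<psi>) \<longleftrightarrow> _")
  proof (intro iffI allI impI; elim conjE)
    fix s \<phi> assume "\<forall>s \<psi>. is_ver K s (vdom K f) M \<and> is_cell K \<psi> (hunit K P) (hunit K M) (s \<bullet> a) (d \<bullet> b) \<longrightarrow> ?P s \<psi>"
      "is_ver K s (vdom K f) M" "is_cell K \<phi> (F \<odot> G) (hunit K M) s d"
    then show "?P s (\<phi> \<cdot> \<sigma>)"
      using \<phi>\<sigma> by blast
  next
    fix s \<psi> assume *: "\<forall>s \<phi>. is_ver K s (vdom K f) M \<and> is_cell K \<phi> (F \<odot> G) (hunit K M) s d \<longrightarrow> ?P s (\<phi> \<cdot> \<sigma>)"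
      "is_ver K s (vdom K f) M" "is_cell K \<psi> (hunit K P) (hunit K M) (s \<bullet> a) (d \<bullet> b)"
    obtain \<phi> where \<phi>: "is_cell K \<phi> (F \<odot> G) (hunit K M) s d" and \<psi>: "\<psi> = \<phi> \<cdot> \<sigma>"
      using restrict[OF *(2,3)] by blast
    show "?P s \<psi>"
      unfolding \<psi> by (rule *(1)[rule_format]) (intro conjI *(2) \<phi>)
  qed
  also have "\<dots> \<longleftrightarrow> ran_lifts G \<beta> M F"
    unfolding ran_lifts_def \<beta>' F'(3)
    by (rule iff_allI, rule iff_allI, rule imp_cong[OF refl], elim conjE, rule lift_iff)
  finally show ?thesis .
qed

text \<open>Factoring \<tau> through the companion unit gives an opcartesian \<open>t\<close> from
  the companion \<open>F\<close> to \<open>H\<close>. Composing a lifting problem at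
  \<open>H\<close> with \<open>t\<close> yields one at \<open>F\<close>, and both its solutions and
  its equation transfer back.\<close>

lemma ran_lifts_opcartesian:
  assumes H: "H \<in> Hor K" "hcod K H = hdom K J" and J: "J \<in> Hor K"
    and \<beta>: "is_cell K \<beta> J (hunit K M) r d"
    and \<tau>: "is_opcartesian K \<tau>" "hsrc K \<tau> = hunit K T" "htgt K \<tau> = H" "T \<in> Obj K"
    and F: "is_companion K (vtgt K \<tau>) F \<epsilon> \<eta>" and p: "is_conjoint K (vsrc K \<tau>) G \<epsilon>' \<eta>'"
    and M: "M \<in> Obj K"
    and lifts: "ran_lifts J \<beta> M F"
  shows "ran_lifts J \<beta> M H"
proof -
  have [simp]: "\<tau> \<in> Cell K"
    using \<tau>(1) by (simp add: is_opcartesian_def)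
  note F' [simp] = companionD[OF F] and H [simp] and J [simp] and \<tau>(2,3,4) [simp] and M [simp]
  note \<beta>' [simp] = is_cellD(1-5,8,9)[OF \<beta>]
  have [simp]: "vdom K r = hdom K J" "vcod K r = M" "vdom K d = hcod K J" "vcod K d = M"
    using is_cellD(10-13)[OF \<beta>] by simp_all
  have eta: "is_opcartesian K \<eta>"
    by (rule companion_eta_opcartesian[OF F])
  have "\<exists>!t. is_cell K t F H (vsrc K \<tau>) (vid K (hdom K J)) \<and> \<tau> = t \<cdot> \<eta>"
    by (rule opcartesian_ex1[OF eta is_cell_self, simplified]) (simp_all add: is_cell_def)
  then obtain t where t: "is_cell K t F H (vsrc K \<tau>) (vid K (hdom K J))" and t\<eta>: "\<tau> = t \<cdot> \<eta>"
    by blast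
  note t' [simp] = is_cellD(1-5)[OF t]
  have to: "is_opcartesian K t"
    by (rule opcartesian_right_factor[OF eta]) (use \<tau>(1) t\<eta> in simp_all)
  have whisker: "(lam M \<cdot> (\<chi> \<Odot> \<beta>)) \<cdot> (t \<Odot> cid K J) = lam M \<cdot> ((\<chi> \<cdot> t) \<Odot> \<beta>)"
    if "is_cell K \<chi> H (hunit K M) s r" for \<chi> s
    using is_cellD[OF that] by (simp add: interchange')
  show ?thesis
    unfolding ran_lifts_def
  proof (intro allI impI, elim conjE)
    fix s \<phi>
    assume s: "is_ver K s (hdom K H) M" and "is_cell K \<phi> (H \<odot> J) (hunit K M) s (vtgt K \<beta>)"
    then have \<phi>: "is_cell K \<phi> (H \<odot> J) (hunit K M) s d"
      by simp
    note [simp] = is_cellD(1-5)[OF \<phi>]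
    have s' [simp]: "s \<in> Ver K" "vdom K s = hdom K H" "vcod K s = M"
      using s by (simp_all add: is_ver_def)
    have "is_ver K (s \<bullet> vsrc K \<tau>) (hdom K F) M"
      "is_cell K (\<phi> \<cdot> (t \<Odot> cid K J)) (F \<odot> J) (hunit K M) (s \<bullet> vsrc K \<tau>) (vtgt K \<beta>)"
      by (simp_all add: is_ver_def is_cell_def)
    then have ex: "\<exists>!\<chi>. is_cell K \<chi> F (hunit K M) (s \<bullet> vsrc K \<tau>) r \<and> \<phi> \<cdot> (t \<Odot> cid K J) = lam M \<cdot> (\<chi> \<Odot> \<beta>)"
      using lifts unfolding ran_lifts_def \<beta>' by blast
    have fact: "\<exists>!\<chi>. is_cell K \<chi> H (hunit K M) s r \<and> \<omega> = \<chi> \<cdot> t"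
      if "is_cell K \<omega> F (hunit K M) (s \<bullet> vsrc K \<tau>) r" for \<omega>
      by (rule opcartesian_ex1[OF to t]) (use that in simp_all)
    have cell_t: "is_cell K (\<chi> \<cdot> t) F (hunit K M) (s \<bullet> vsrc K \<tau>) r" if "is_cell K \<chi> H (hunit K M) s r" for \<chi>
      using is_cellD[OF that] by (simp add: is_cell_def)
    \<comment> \<open>One direction cancels the whiskered cell \<open>t \<Odot> cid K J\<close>,
      which uses the conjoint of the left leg of \<tau>.\<close>
    have eq: "\<phi> \<cdot> (t \<Odot> cid K J) = lam M \<cdot> ((\<chi> \<cdot> t) \<Odot> \<beta>) \<longleftrightarrow> \<phi> = lam M \<cdot> (\<chi> \<Odot> \<beta>)"
      if \<chi>: "is_cell K \<chi> H (hunit K M) s r" for \<chi>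
    proof
      assume "\<phi> \<cdot> (t \<Odot> cid K J) = lam M \<cdot> ((\<chi> \<cdot> t) \<Odot> \<beta>)"
      then have "\<phi> \<cdot> (t \<Odot> cid K J) = (lam M \<cdot> (\<chi> \<Odot> \<beta>)) \<cdot> (t \<Odot> cid K J)"
        unfolding whisker[OF \<chi>] .
      moreover have "is_cell K (lam M \<cdot> (\<chi> \<Odot> \<beta>)) (H \<odot> J) (hunit K M) s d"
        using is_cellD[OF \<chi>] by (simp add: is_cell_def)
      ultimately show "\<phi> = lam M \<cdot> (\<chi> \<Odot> \<beta>)"
        using opcartesian_whisker_cancel[OF to t p J refl _ \<phi>] by simp
    qed (use whisker[OF \<chi>] in simp)
    show "\<exists>!\<chi>. is_cell K \<chi> H (hunit K M) s (vsrc K \<beta>) \<and> \<phi> = lam M \<cdot> (\<chi> \<Odot> \<beta>)"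
    proof -
      have "(\<exists>!\<omega>. is_cell K \<omega> F (hunit K M) (s \<bullet> vsrc K \<tau>) r \<and> \<phi> \<cdot> (t \<Odot> cid K J) = lam M \<cdot> (\<omega> \<Odot> \<beta>))
        \<longleftrightarrow> (\<exists>!\<chi>. is_cell K \<chi> H (hunit K M) s r \<and> \<phi> \<cdot> (t \<Odot> cid K J) = lam M \<cdot> ((\<chi> \<cdot> t) \<Odot> \<beta>))"
        by (rule ex1_reindex) (use cell_t fact in blast)+
      then show ?thesis
        using ex eq by (simp cong: conj_cong)
    qed
  qed
qed

end

section \<open>Street's condition and the pointwise condition in an equipment\<close>

context equipment
begin

text \<open>The objects quantified existentially in the definition are fixed by \<open>J\<close>,
  \<open>r\<close> and \<open>d\<close>, so the condition splits into one lifting condition for each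
  \<open>H\<close>.\<close>

lemma defines_pointwise_ran_iff:
  assumes "is_hor K J B A" "is_ver K r B M" "is_ver K d A M" "is_cell K \<beta> J (hunit K M) r d"
  shows "defines_pointwise_ran K J d r \<beta> \<longleftrightarrow> (\<forall>H \<in> Hor K. hcod K H = B \<longrightarrow> ran_lifts J \<beta> M H)"
proof -
  let ?P = "\<lambda>H s \<phi>. \<exists>!\<chi>. is_cell K \<chi> H (hunit K M) s r \<and> \<phi> = lam M \<cdot> (\<chi> \<Odot> \<beta>)"
  have "defines_pointwise_ran K J d r \<beta> \<longleftrightarrow> (\<forall>C H s \<phi>. is_hor K H C B \<and> is_ver K s C M \<and>
      is_cell K \<phi> (H \<odot> J) (hunit K M) s d \<longrightarrow> ?P H s \<phi>)"
    using assms by (simp add: defines_pointwise_ran_def is_hor_def is_ver_def)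
  also have "\<dots> \<longleftrightarrow> (\<forall>H \<in> Hor K. hcod K H = B \<longrightarrow> (\<forall>s \<phi>. is_ver K s (hdom K H) M \<and>
      is_cell K \<phi> (H \<odot> J) (hunit K M) s d \<longrightarrow> ?P H s \<phi>))"
    unfolding is_hor_def by blast
  finally show ?thesis
    unfolding ran_lifts_def is_cellD(4,5)[OF assms(4)] .
qed

text \<open>An opcartesian tabulation of \<open>H\<close> reduces the lifting condition at
  \<open>H\<close> to the one at the companion of the right leg of the tabulation.\<close>

lemma companion_lifts_imp_lifts:
  assumes tab: "has_opcartesian_tabulations K" and H: "H \<in> Hor K" "hcod K H = hdom K J" and J: "J \<in> Hor K"
    and \<beta>: "is_cell K \<beta> J (hunit K M) r d" and M: "M \<in> Obj K"
    and lifts: "\<And>C f. is_ver K f C (hdom K J) \<Longrightarrow> ran_lifts J \<beta> M (companion K f)"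
  shows "ran_lifts J \<beta> M H"
proof -
  obtain T \<tau> where T: "is_tabulation K H T \<tau>" and \<tau>: "is_opcartesian K \<tau>"
    using tab H(1) unfolding has_opcartesian_tabulations_def by blast
  have [simp]: "\<tau> \<in> Cell K" "hsrc K \<tau> = hunit K T" "htgt K \<tau> = H" "T \<in> Obj K"
    using T by (simp_all add: is_tabulation_def)
  have "is_ver K (vtgt K \<tau>) T (hdom K J)"
    by (simp add: is_ver_def H)
  from lifts[OF this] show ?thesis
    by (intro ran_lifts_opcartesian[where T = T, OF H J \<beta> \<tau> _ _ _ companion conjoint M]) simp_all
qed

text \<open>Every comma object \<open>f/j\<close> corresponds to an opcartesian cell into
  \<open>companion K f \<odot> conjoint K j\<close>, so Street's condition there is the lifting
  condition at the companion of \<open>f\<close>.\<close>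

lemma defines_pointwise_ran_street_iff:
  assumes tab: "has_opcartesian_tabulations K"
    and j: "is_ver K j A B" and d: "is_ver K d A M" and r: "is_ver K r B M"
    and \<epsilon>: "is_vcell K \<epsilon> (r \<bullet> j) d"
    and \<epsilon>': "is_cell K \<epsilon>' (conjoint K j) (hunit K M) r d" "\<epsilon> = \<epsilon>' \<cdot> conjoint_eta K j"
  shows "defines_pointwise_ran_street (\<V> K) j d r \<epsilon> \<longleftrightarrow>
    (\<forall>C f. is_ver K f C B \<longrightarrow> ran_lifts (conjoint K j) \<epsilon>' M (companion K f))"
proof -
  have [simp]: "j \<in> Ver K" "vdom K j = A" "vcod K j = B" "r \<in> Ver K" "vdom K r = B" "vcod K r = M"
      "d \<in> Ver K" "vdom K d = A" "vcod K d = M"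
    using j d r by (simp_all add: is_ver_def)
  have A [simp]: "A \<in> Obj K" and B [simp]: "B \<in> Obj K" and M [simp]: "M \<in> Obj K"
    using ver_Obj[OF j] ver_Obj[OF r] by simp_all
  note G = conjoint[of j, simplified]
  note G' [simp] = conjointD[OF G]
  define \<kappa> where "\<kappa> f = conjoint_eps K j \<cdot> lunit K (conjoint K j) \<cdot> (companion_eps K f \<Odot> cid K (conjoint K j))" for f
  have \<kappa>: "is_cartesian (\<kappa> f)" "is_cell K (\<kappa> f) (companion K f \<odot> conjoint K j) (hunit K B) f j"
    if f: "is_ver K f C B" for C f
  proof -
    have [simp]: "f \<in> Ver K" "vdom K f = C" "vcod K f = B"
      using f by (simp_all add: is_ver_def)
    note F = companion[of f, simplified]
    note F' [simp] = companionD[OF F]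
    show "is_cartesian (\<kappa> f)"
      unfolding \<kappa>_def
      by (intro cartesian_ccomp conjoint_eps_cartesian[OF G] companion_restriction_cartesian[OF F]) simp_all
    show "is_cell K (\<kappa> f) (companion K f \<odot> conjoint K j) (hunit K B) f j"
      by (simp add: \<kappa>_def is_cell_def)
  qed
  have street: "defines_ran (\<V> K) a (d \<bullet> b) (r \<bullet> f) ((r \<rhd>\<^bsub>\<V> K\<^esub> \<pi>) \<Zcomp>\<^bsub>\<V> K\<^esub> (\<epsilon> \<lhd>\<^bsub>\<V> K\<^esub> b))
      \<longleftrightarrow> ran_lifts (conjoint K j) \<epsilon>' M (companion K f)"
    if f: "is_ver K f C B" and P: "is_comma_object (\<V> K) f j P a b \<pi>" for C f P a b \<pi>
  proof -
    have f' [simp]: "f \<in> Ver K" "vdom K f = C" "vcod K f = B"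
      using f by (simp_all add: is_ver_def)
    note F = companion[of f, simplified]
    have "companion K f \<odot> conjoint K j \<in> Hor K"
      using companionD[OF F] by simp
    then obtain T \<tau> where T: "is_tabulation K (companion K f \<odot> conjoint K j) T \<tau>" "is_opcartesian K \<tau>"
      using tab unfolding has_opcartesian_tabulations_def by blast
    obtain \<sigma> where \<sigma>: "is_cell K \<sigma> (hunit K P) (companion K f \<odot> conjoint K j) a b" "is_opcartesian K \<sigma>"
      and \<pi>: "\<pi> = \<kappa> f \<cdot> \<sigma>"
      using comma_object_opcartesian[OF \<kappa>[OF f] B T P] by blast
    have cone: "comma_cone (\<V> K) f j P a b \<pi>"
      using P by (simp add: is_comma_object_def)
    then have P': "P \<in> Obj K" and a: "is_ver K a P C" and b: "is_ver K b P A"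
      and \<pi>c: "is_cell K \<pi> (hunit K P) (hunit K B) (f \<bullet> a) (j \<bullet> b)"
      by (simp_all add: comma_cone_V[of f j B])
    \<comment> \<open>Unfolding the whiskerings brings Street's 2-cell into the form used in
      \<open>ran_lifts_companion_iff\<close>.\<close>
    have "(r \<rhd>\<^bsub>\<V> K\<^esub> \<pi>) \<Zcomp>\<^bsub>\<V> K\<^esub> (\<epsilon> \<lhd>\<^bsub>\<V> K\<^esub> b)
        = vv (cunit K r \<cdot> \<pi>) ((\<epsilon>' \<cdot> conjoint_eta K j) \<cdot> cunit K b) P M"
      unfolding whisker_left_def whisker_right_def V_simps \<epsilon>'(2)
      by (rule vcomp2_V[of _ "r \<bullet> f \<bullet> a" "r \<bullet> j \<bullet> b"])
        (use is_cellD[OF \<pi>c] a b P' in \<open>simp add: vc_def is_ver_def is_cell_def\<close>)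
    then show ?thesis
      using ran_lifts_companion_iff[OF F G _ \<epsilon>'(1) M \<sigma> P' \<pi>[unfolded \<kappa>_def]] by simp
  qed
  \<comment> \<open>Street's condition quantifies over all comma objects; their existence keeps it
    from being vacuous at \<open>f\<close>.\<close>
  have comma: "\<exists>P a b \<pi>. is_comma_object (\<V> K) f j P a b \<pi>" if f: "is_ver K f C B" for C f
  proof -
    have [simp]: "f \<in> Ver K" "vdom K f = C" "vcod K f = B"
      using f by (simp_all add: is_ver_def)
    have "companion K f \<odot> conjoint K j \<in> Hor K"
      using companionD[OF companion[of f, simplified]] by simp
    then obtain T \<tau> where "is_tabulation K (companion K f \<odot> conjoint K j) T \<tau>"
      using tab unfolding has_opcartesian_tabulations_def by blast
    from tabulation_comma_object[OF \<kappa>[OF f] B this] show ?thesis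
      by blast
  qed
  have "is_cell2 (\<V> K) \<epsilon> (r \<bullet> j) d"
    using \<epsilon> by (simp add: cell2_V is_vcell_vc)
  then have "defines_pointwise_ran_street (\<V> K) j d r \<epsilon> \<longleftrightarrow>
      (\<forall>C f P a b \<pi>. is_ver K f C B \<and> is_comma_object (\<V> K) f j P a b \<pi> \<longrightarrow>
        defines_ran (\<V> K) a (d \<bullet> b) (r \<bullet> f) ((r \<rhd>\<^bsub>\<V> K\<^esub> \<pi>) \<Zcomp>\<^bsub>\<V> K\<^esub> (\<epsilon> \<lhd>\<^bsub>\<V> K\<^esub> b)))"
    by (simp add: defines_pointwise_ran_street_def is_arr_V is_ver_def V_simps)
  also have "\<dots> \<longleftrightarrow> (\<forall>C f. is_ver K f C B \<longrightarrow> ran_lifts (conjoint K j) \<epsilon>' M (companion K f))"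
  proof (intro iffI allI impI)
    fix C f
    assume *: "\<forall>C f P a b \<pi>. is_ver K f C B \<and> is_comma_object (\<V> K) f j P a b \<pi> \<longrightarrow>
        defines_ran (\<V> K) a (d \<bullet> b) (r \<bullet> f) ((r \<rhd>\<^bsub>\<V> K\<^esub> \<pi>) \<Zcomp>\<^bsub>\<V> K\<^esub> (\<epsilon> \<lhd>\<^bsub>\<V> K\<^esub> b))"
      and f: "is_ver K f C B"
    obtain P a b \<pi> where P: "is_comma_object (\<V> K) f j P a b \<pi>"
      using comma[OF f] by blast
    show "ran_lifts (conjoint K j) \<epsilon>' M (companion K f)"
      using street[OF f P] * f P by blast
  next
    fix C f P a b \<pi>
    assume "\<forall>C f. is_ver K f C B \<longrightarrow> ran_lifts (conjoint K j) \<epsilon>' M (companion K f)"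
      and "is_ver K f C B \<and> is_comma_object (\<V> K) f j P a b \<pi>"
    then show "defines_ran (\<V> K) a (d \<bullet> b) (r \<bullet> f) ((r \<rhd>\<^bsub>\<V> K\<^esub> \<pi>) \<Zcomp>\<^bsub>\<V> K\<^esub> (\<epsilon> \<lhd>\<^bsub>\<V> K\<^esub> b))"
      using street by blast
  qed
  finally show ?thesis .
qed

text \<open>Both sides are lifting conditions for \<epsilon>', at the companions and at all
  horizontal morphisms into \<open>B\<close>. Companions are among the latter, and tabulations give
  the converse.\<close>

theorem street_iff_pointwise_ran:
  assumes tab: "has_opcartesian_tabulations K"
    and j: "is_ver K j A B" and d: "is_ver K d A M" and r: "is_ver K r B M"
    and \<epsilon>: "is_vcell K \<epsilon> (r \<bullet> j) d"
    and \<epsilon>': "is_cell K \<epsilon>' (conjoint K j) (hunit K M) r d" "\<epsilon> = \<epsilon>' \<cdot> conjoint_eta K j"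
  shows "defines_pointwise_ran_street (\<V> K) j d r \<epsilon> \<longleftrightarrow> defines_pointwise_ran K (conjoint K j) d r \<epsilon>'"
proof -
  have j': "j \<in> Ver K" "vdom K j = A" "vcod K j = B"
    using j by (simp_all add: is_ver_def)
  note G = conjointD(2-4)[OF conjoint[OF j'(1)]]
  have G': "is_hor K (conjoint K j) B A"
    using G j' by (simp add: is_hor_def)
  have M: "M \<in> Obj K"
    using ver_Obj[OF r] by simp
  have "(\<forall>C f. is_ver K f C B \<longrightarrow> ran_lifts (conjoint K j) \<epsilon>' M (companion K f)) \<longleftrightarrow>
      (\<forall>H \<in> Hor K. hcod K H = B \<longrightarrow> ran_lifts (conjoint K j) \<epsilon>' M H)"
  proof (intro iffI ballI allI impI)
    fix H
    assume *: "\<forall>C f. is_ver K f C B \<longrightarrow> ran_lifts (conjoint K j) \<epsilon>' M (companion K f)"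
      and H: "H \<in> Hor K" "hcod K H = B"
    show "ran_lifts (conjoint K j) \<epsilon>' M H"
      by (rule companion_lifts_imp_lifts[OF tab H(1) _ G(1) \<epsilon>'(1) M]) (use * H G(2) j' in simp_all)
  next
    fix C f
    assume *: "\<forall>H \<in> Hor K. hcod K H = B \<longrightarrow> ran_lifts (conjoint K j) \<epsilon>' M H" and "is_ver K f C B"
    then show "ran_lifts (conjoint K j) \<epsilon>' M (companion K f)"
      using companionD(2,4)[OF companion[of f]] by (simp add: is_ver_def)
  qed
  then show ?thesis
    unfolding defines_pointwise_ran_street_iff[OF assms] defines_pointwise_ran_iff[OF G' r d \<epsilon>'(1)] .
qed

end

theorem proposition5p12:
  fixes K :: "('o, 'v, 'h, 'c, 'm) equip_scheme"
    and A B M :: 'o and j d r :: 'v and \<epsilon> \<epsilon>' :: 'c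
  assumes "equipment K"
    and "has_opcartesian_tabulations K"
    and "is_ver K j A B" and "is_ver K d A M" and "is_ver K r B M"
    and "is_vcell K \<epsilon> (r \<bullet>\<^bsub>K\<^esub> j) d"
    and "is_cell K \<epsilon>' (conjoint K j) (hunit K M) r d"
    and "\<epsilon> = \<epsilon>' \<cdot>\<^bsub>K\<^esub> conjoint_eta K j"
  shows "defines_pointwise_ran_street (\<V> K) j d r \<epsilon>
         \<longleftrightarrow> defines_pointwise_ran K (conjoint K j) d r \<epsilon>'"
  using assms(1) by (rule equipment.street_iff_pointwise_ran) (fact assms)+

end
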